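(* Let $0<p,q<\infty$ and let $\omega$ be a radial weight. Then the following statements hold: (i) If $p<q$, then $L^q_p(\omega)\subsetneq T^q_p(\omega)$ with $\|f\|_{T^q_p(\omega)}\lesssim\|f\|_{L^q_p(\omega)}$ for all measurable functions $f$; (ii) $L^p_p(\omega)=L^p_\omega=T^p_p(\omega)$ with equivalence of quasinorms; (iii) If $q<p$, then $T^q_p(\omega)\subsetneq L^q_p(\omega)$ with $\|f\|_{L^q_p(\omega)}\lesssim\|f\|_{T^q_p(\omega)}$ for all measurable functions $f$.
   Context: $\mathbb{D}$ is the open unit disc, $\mathbb{T}=\partial\mathbb{D}$, and $dA=\frac{dx\,dy}{\pi}$. A weight is a function $\omega:\mathbb{D}\to[0,\infty)$ integrable over $\mathbb{D}$; it is radial if $\omega(z)=\omega(|z|)$ for all $z\in\mathbb{D}$. Throughout, it is assumed that $\widehat{\omega}(z)=\int_{|z|}^1\omega(s)\,ds>0$ for all $z\in\mathbb{D}$. The space $L^p_\omega$ is the Lebesgue space of complex-valued measurable functions on $\mathbb{D}$ with $\int_{\mathbb{D}}|f|^p\omega\,dA<\infty$, with its usual quasinorm. For $\xi\in\overline{\mathbb{D}}$, $\Gamma(\xi)=\{z\in\mathbb{D}:|\arg z-\arg\xi|<|\xi|-|z|\}$ (difference of arguments modulo $2\pi$). For $0<p,q<\infty$, $L^q_p(\omega)$ and $T^q_p(\omega)$ consist of the complex-valued measurable functions $f$ on $\mathbb{D}$ such that, respectively, $$\|f\|_{L^q_p(\omega)}=\left(\frac1{2\pi}\int_0^{2\pi}\left(\int_0^1|f(re^{i\theta})|^p\omega(r)r\,dr\right)^{q/p}d\theta\right)^{1/q}<\infty,$$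 $$\|f\|_{T^q_p(\omega)}=\left(\int_{\mathbb{T}}\left(\int_{\Gamma(\xi)}|f(z)|^p\omega(z)\frac{dA(z)}{1-|z|}\right)^{q/p}|d\xi|\right)^{1/q}<\infty.$$ $A\lesssim B$ means $A\le CB$ for some constant $C>0$ independent of $f$. *)

theory Defs
  imports "HOL-Analysis.Analysis"
begin

definition unit_disc :: "complex set" where
  "unit_disc = ball 0 1"

text \<open>The normalised area measure \<open>dA = dx dy / pi\<close>. Measurability of functions on the disc
  is Lebesgue measurability; values of a function outside the disc play no role.\<close>

definition area_measure :: "complex measure" where
  "area_measure = scale_measure (ennreal (1 / pi)) (lebesgue_on unit_disc)"

definition weight :: "(complex \<Rightarrow> real) \<Rightarrow> bool" where
  "weight \<omega> \<longleftrightarrow> (\<forall>z\<in>unit_disc. 0 \<le> \<omega> z) \<and> integrable area_measure \<omega>"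

definition radial :: "(complex \<Rightarrow> real) \<Rightarrow> bool" where
  "radial \<omega> \<longleftrightarrow> (\<forall>z\<in>unit_disc. \<omega> z = \<omega> (of_real (cmod z)))"

text \<open>The value may be \<open>\<infinity>\<close> at \<open>z = 0\<close>: integrability of a radial weight over the disc only
  controls the integral of \<open>\<omega> r * r\<close>.\<close>

definition weight_hat :: "(complex \<Rightarrow> real) \<Rightarrow> complex \<Rightarrow> ennreal" where
  "weight_hat \<omega> z = (\<integral>\<^sup>+ s\<in>{cmod z<..<1}. ennreal (\<omega> (of_real s)) \<partial>lebesgue)"

text \<open>Powers of extended nonnegative reals, used with exponent \<open>a > 0\<close> only.\<close>

definition enn_powr :: "ennreal \<Rightarrow> real \<Rightarrow> ennreal" where
  "enn_powr x a = (if x = \<infinity> then \<infinity> else ennreal (enn2real x powr a))"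

text \<open>The difference of arguments is taken modulo \<open>2 pi\<close>. With \<open>Arg 0 = 0\<close>, membership of the
  single point \<open>z = 0\<close> is a matter of convention that does not affect any integral; for \<open>\<xi> = 0\<close>
  the region is empty.\<close>

definition approach_region :: "complex \<Rightarrow> complex set" where
  "approach_region \<xi> = {z \<in> unit_disc.
     \<exists>k::int. \<bar>Arg z - Arg \<xi> + 2 * pi * of_int k\<bar> < cmod \<xi> - cmod z}"

text \<open>In the following, \<open>q\<close> is the outer (upper) and \<open>p\<close> the inner (lower) exponent. The (quasi)norms
  take values in \<open>[0, \<infinity>]\<close>.\<close>

definition L_norm :: "real \<Rightarrow> real \<Rightarrow> (complex \<Rightarrow> real) \<Rightarrow> (complex \<Rightarrow> complex) \<Rightarrow> ennreal" where
  "L_norm q p \<omega> f =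
     enn_powr (ennreal (1 / (2 * pi)) *
       (\<integral>\<^sup>+ \<theta>\<in>{0..2 * pi}.
          enn_powr (\<integral>\<^sup>+ r\<in>{0<..<1}.
             ennreal (cmod (f (rcis r \<theta>)) powr p * \<omega> (of_real r) * r) \<partial>lebesgue) (q / p)
        \<partial>lebesgue)) (1 / q)"

text \<open>The arc length integral over the unit circle is written in the parametrisation \<open>\<xi> = cis \<theta>\<close>.\<close>

definition T_norm :: "real \<Rightarrow> real \<Rightarrow> (complex \<Rightarrow> real) \<Rightarrow> (complex \<Rightarrow> complex) \<Rightarrow> ennreal" where
  "T_norm q p \<omega> f =
     enn_powr
       (\<integral>\<^sup>+ \<theta>\<in>{0..2 * pi}.
          enn_powr (\<integral>\<^sup>+ z\<in>approach_region (cis \<theta>).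
             ennreal (cmod (f z) powr p * \<omega> z / (1 - cmod z)) \<partial>area_measure) (q / p)
        \<partial>lebesgue) (1 / q)"

definition Lebesgue_norm :: "real \<Rightarrow> (complex \<Rightarrow> real) \<Rightarrow> (complex \<Rightarrow> complex) \<Rightarrow> ennreal" where
  "Lebesgue_norm p \<omega> f =
     enn_powr (\<integral>\<^sup>+ z. ennreal (cmod (f z) powr p * \<omega> z) \<partial>area_measure) (1 / p)"

definition L_space :: "real \<Rightarrow> real \<Rightarrow> (complex \<Rightarrow> real) \<Rightarrow> (complex \<Rightarrow> complex) set" where
  "L_space q p \<omega> = {f \<in> borel_measurable area_measure. L_norm q p \<omega> f < \<infinity>}"

definition T_space :: "real \<Rightarrow> real \<Rightarrow> (complex \<Rightarrow> real) \<Rightarrow> (complex \<Rightarrow> complex) set" where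
  "T_space q p \<omega> = {f \<in> borel_measurable area_measure. T_norm q p \<omega> f < \<infinity>}"

definition Lebesgue_space :: "real \<Rightarrow> (complex \<Rightarrow> real) \<Rightarrow> (complex \<Rightarrow> complex) set" where
  "Lebesgue_space p \<omega> =
     {f \<in> borel_measurable area_measure.
        (\<integral>\<^sup>+ z. ennreal (cmod (f z) powr p * \<omega> z) \<partial>area_measure) < \<infinity>}"

text \<open>The relation \<open>N f \<lesssim> N' f\<close> with a constant that is uniform in all measurable \<open>f\<close>.\<close>

definition norm_dominated ::
    "((complex \<Rightarrow> complex) \<Rightarrow> ennreal) \<Rightarrow> ((complex \<Rightarrow> complex) \<Rightarrow> ennreal) \<Rightarrow> bool" where
  "norm_dominated N N' \<longleftrightarrow>
     (\<exists>C::real. 0 < C \<and> (\<forall>f\<in>borel_measurable area_measure. N f \<le> ennreal C * N' f))"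

definition norm_equivalent ::
    "((complex \<Rightarrow> complex) \<Rightarrow> ennreal) \<Rightarrow> ((complex \<Rightarrow> complex) \<Rightarrow> ennreal) \<Rightarrow> bool" where
  "norm_equivalent N N' \<longleftrightarrow> norm_dominated N N' \<and> norm_dominated N' N"

end

theory Submission
  imports Defs
begin

text \<open>With \<open>u r t = \<bar>f (rcis r t)\<bar>\<^sup>p \<omega> r r\<close> and \<open>s = q / p\<close>, the two quasinorms are, up to constants, the \<open>L\<^sup>s\<close> norms
  in \<open>t\<close> of \<open>\<integral> u r t dr\<close> and of \<open>\<integral> (P r u) t dr\<close>, where \<open>P r\<close> averages \<open>u r\<close> over the arc of half-length
  \<open>1 - r\<close> around \<open>t\<close>; for \<open>s = 1\<close> they agree by Tonelli. For \<open>s \<noteq> 1\<close> the arcs are replaced by dyadic ones: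
  a window is covered by a cell of one of two dyadic grids shifted by a third of the period, and contains the cell
  around its centre of a slightly finer grid. For dyadic averages \<open>E\<^sub>k\<close> of \<open>g\<^sub>k \<ge> 0\<close> no maximal theorem is needed.
  Put \<open>S\<^sub>n = \<Sum>k<n. E\<^sub>k g\<^sub>k\<close>. Since \<open>S\<^bsub>k+1\<^esub>\<close> is constant on the cells of level \<open>k\<close>, one has
  \<open>\<integral> E\<^sub>k g\<^sub>k S\<^bsub>k+1\<^esub>\<^bsup>s-1\<^esup> = \<integral> g\<^sub>k S\<^bsub>k+1\<^esub>\<^bsup>s-1\<^esup>\<close>. Telescoping \<open>S\<^sub>n\<^sup>s\<close> with the mean value theorem shows that
  \<open>\<integral> \<Sum>k<n. g\<^sub>k S\<^bsub>k+1\<^esub>\<^bsup>s-1\<^esup>\<close> is at least \<open>1 / s\<close> times \<open>\<integral> S\<^sub>n\<^sup>s\<close> if \<open>s > 1\<close>, and at most that if \<open>s < 1\<close>;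
  monotonicity of \<open>S\<close> and a pointwise case distinction between \<open>S\<^sub>n\<close> and \<open>\<Sum>k<n. g\<^sub>k\<close> finish the comparison.
  Strictness is seen on functions of \<open>Arg z\<close> supported away from the circle.\<close>

section \<open>Polar coordinates\<close>

text \<open>The weight has no regularity beyond being radial, so nothing relates \<open>u r\<close>
  at different radii, and the comparison has to hold for arbitrary nonnegative families. Averaging
  and summation must be treated together, which works because an average over a coarse cell is
  constant on all finer cells. For s > 1 the power S_n^s returns on the right with factor 1/2 and is
  absorbed; this needs a finite integral, hence the estimates for bounded functions and finitely
  many levels. For s < 1 the exponent s - 1 is negative, and a constant \<epsilon> > 0 added to the
  sums keeps the powers meaningful until it is sent to zero. Two grids are needed only to cover a
  window, which may straddle a cell boundary; a small cell around its centre always fits inside.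
  Functions on the disc are Lebesgue measurable, so \<open>u\<close> comes from a Borel
  representative of |f|^p \<omega>, and the formula for the radial integrals holds for almost every
  angle only. For strictness, away from the circle the mixed norm sees the angular power |f|^q, the
  tent norm only |f|^p.\<close>

lemma lborel_complex_eq_distr:
  "(lborel :: complex measure) = distr (lborel \<Otimes>\<^sub>M lborel) borel (\<lambda>(x, y). Complex x y)"
proof (rule lborel_eqI)
  have [measurable]: "(\<lambda>(x, y). Complex x y) \<in> borel_measurable (lborel \<Otimes>\<^sub>M lborel)"
    unfolding Complex_eq by measurable
  fix l u :: complex
  assume "\<And>b. b \<in> Basis \<Longrightarrow> l \<bullet> b \<le> u \<bullet> b"
  from this[of 1] this[of \<i>] have le: "Re l \<le> Re u" "Im l \<le> Im u"
    by (auto simp: Basis_complex_def)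
  have "(\<lambda>(x, y). Complex x y) -` box l u \<inter> space (lborel \<Otimes>\<^sub>M lborel)
      = {Re l<..<Re u} \<times> {Im l<..<Im u}"
    by (auto simp: in_box_complex_iff space_pair_measure)
  then show "emeasure (distr (lborel \<Otimes>\<^sub>M lborel) borel (\<lambda>(x, y). Complex x y)) (box l u)
      = ennreal (\<Prod>b\<in>Basis. (u - l) \<bullet> b)"
    using le
    by (subst emeasure_distr)
       (auto simp: lborel.emeasure_pair_measure_Times Basis_complex_def ennreal_mult')
qed simp

lemma nn_integral_complex:
  fixes H :: "complex \<Rightarrow> ennreal"
  assumes [measurable]: "H \<in> borel_measurable borel"
  shows "(\<integral>\<^sup>+z. H z \<partial>lborel) = (\<integral>\<^sup>+x. \<integral>\<^sup>+y. H (Complex x y) \<partial>lborel \<partial>lborel)"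
proof -
  have [measurable]: "(\<lambda>(x, y). Complex x y) \<in> borel_measurable (lborel \<Otimes>\<^sub>M lborel)"
    unfolding Complex_eq by measurable
  have "(\<integral>\<^sup>+z. H z \<partial>lborel) = (\<integral>\<^sup>+z. H (case z of (x, y) \<Rightarrow> Complex x y) \<partial>(lborel \<Otimes>\<^sub>M lborel))"
    by (subst lborel_complex_eq_distr, subst nn_integral_distr) auto
  also have "\<dots> = (\<integral>\<^sup>+x. \<integral>\<^sup>+y. H (Complex x y) \<partial>lborel \<partial>lborel)"
    by (subst lborel.nn_integral_fst[symmetric]) (auto simp: case_prod_beta)
  finally show ?thesis .
qed

lemma borel_measurable_tan [measurable]: "(tan :: real \<Rightarrow> real) \<in> borel_measurable borel"
  unfolding tan_def[abs_def] by measurable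

text \<open>The derivative of tan is 1 / cos^2, so by the fundamental theorem the density gives the
  preimage of an interval from l to u the mass tan (arctan u) - tan (arctan l) = u - l. This is the
  substitution y = x tan t behind polar coordinates.\<close>

lemma lborel_eq_distr_tan:
  "(lborel :: real measure) =
    distr (density lborel (\<lambda>t. ennreal (inverse ((cos t)\<^sup>2)) * indicator {-pi/2<..<pi/2} t)) borel tan"
proof (rule lborel_eqI)
  fix l u :: real
  assume "\<And>b. b \<in> Basis \<Longrightarrow> l \<bullet> b \<le> u \<bullet> b"
  then have lu: "l \<le> u" by auto
  have *: "t \<in> {-pi/2<..<pi/2} \<Longrightarrow> tan t \<in> box l u \<longleftrightarrow> t \<in> {arctan l<..<arctan u}" for t
    using arctan_less_iff[of l "tan t"] arctan_less_iff[of "tan t" u] arctan_tan[of t]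
    by (simp add: minus_divide_left[symmetric] box_real del: arctan_less_iff)
  have sub: "{arctan l..arctan u} \<subseteq> {-pi/2<..<pi/2}"
    using arctan_lbound[of l] arctan_ubound[of u] by auto
  have [measurable]: "tan -` {l<..<u} \<in> sets borel"
    by (rule measurable_sets_borel[OF borel_measurable_tan]) auto
  have "emeasure (distr (density lborel (\<lambda>t. ennreal (inverse ((cos t)\<^sup>2)) * indicator {-pi/2<..<pi/2} t)) borel tan) (box l u)
     = (\<integral>\<^sup>+t. ennreal (inverse ((cos t)\<^sup>2)) * indicator {-pi/2<..<pi/2} t * indicator (tan -` box l u) t \<partial>lborel)"
    by (subst emeasure_distr) (auto simp: emeasure_density measurable_sets_borel)
  also have "\<dots> = (\<integral>\<^sup>+t. ennreal (inverse ((cos t)\<^sup>2)) * indicator {arctan l..arctan u} t \<partial>lborel)"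
  proof (intro nn_integral_cong_AE AE_I[of _ _ "{arctan l, arctan u}"])
    show "{t \<in> space lborel. ennreal (inverse ((cos t)\<^sup>2)) * indicator {-pi/2<..<pi/2} t * indicator (tan -` box l u) t
       \<noteq> ennreal (inverse ((cos t)\<^sup>2)) * indicator {arctan l..arctan u} t} \<subseteq> {arctan l, arctan u}"
      using * sub by (auto simp: indicator_def split: if_splits simp del: box_real)
  qed (auto intro!: emeasure_lborel_countable)
  also have "\<dots> = ennreal (tan (arctan u) - tan (arctan l))"
  proof (rule nn_integral_FTC_Icc)
    fix x assume "x \<in> {arctan l..arctan u}"
    then have "x \<in> {-pi/2<..<pi/2}" using sub by auto
    then have "cos x \<noteq> 0" using cos_gt_zero_pi[of x] by auto
    then show "(tan has_real_derivative inverse ((cos x)\<^sup>2)) (at x)"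
      by (rule DERIV_tan)
  qed (use lu in \<open>auto simp: arctan_le_iff\<close>)
  finally show "emeasure (distr (density lborel (\<lambda>t. ennreal (inverse ((cos t)\<^sup>2)) * indicator {-pi/2<..<pi/2} t)) borel tan) (box l u)
     = ennreal (\<Prod>b\<in>Basis. (u - l) \<bullet> b)"
    by (simp add: tan_arctan)
qed simp

lemma nn_integral_tan_substitution:
  fixes h :: "real \<Rightarrow> ennreal"
  assumes [measurable]: "h \<in> borel_measurable borel"
  shows "(\<integral>\<^sup>+t. h t \<partial>lborel) =
    (\<integral>\<^sup>+t. h (tan t) * ennreal (inverse ((cos t)\<^sup>2)) * indicator {-pi/2<..<pi/2} t \<partial>lborel)"
  by (subst lborel_eq_distr_tan, subst nn_integral_distr)
     (auto simp: nn_integral_density mult_ac)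

lemma borel_measurable_rcis [measurable]:
  assumes [measurable]: "f \<in> borel_measurable M" "g \<in> borel_measurable M"
  shows "(\<lambda>x. rcis (f x) (g x)) \<in> borel_measurable M"
  unfolding rcis_def cis.ctr Complex_eq by measurable

text \<open>For fixed x > 0 substitute y = x tan t, then for fixed t substitute x = r cos t: the
  factors x / cos^2 t and cos t multiply to r.\<close>

lemma nn_integral_polar_right:
  fixes H :: "complex \<Rightarrow> ennreal"
  assumes [measurable]: "H \<in> borel_measurable borel"
  shows "(\<integral>\<^sup>+x. \<integral>\<^sup>+y. H (Complex x y) * indicator {0<..} x \<partial>lborel \<partial>lborel) =
    (\<integral>\<^sup>+t. \<integral>\<^sup>+r. H (rcis r t) * ennreal r * indicator {0<..} r * indicator {-pi/2<..<pi/2} t \<partial>lborel \<partial>lborel)"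
proof -
  have [measurable]: "(\<lambda>z. Complex (fst z) (snd z)) \<in> borel_measurable (borel \<Otimes>\<^sub>M borel)"
     "\<And>x. Complex x \<in> borel_measurable borel" 
    unfolding Complex_eq[abs_def] by measurable
  have [measurable]: "(\<lambda>z. Complex (fst z) (fst z * tan (snd z))) \<in> borel_measurable (borel \<Otimes>\<^sub>M borel)"
    unfolding Complex_eq[abs_def] by measurable
  let ?C = "{-pi/2<..<pi/2}"
  have "(\<integral>\<^sup>+y. H (Complex x y) * indicator {0<..} x \<partial>lborel) =
     (\<integral>\<^sup>+t. H (Complex x (x * tan t)) * ennreal (x * inverse ((cos t)\<^sup>2)) * indicator {0<..} x * indicator ?C t \<partial>lborel)"
    for x :: real
  proof (cases "x > 0")
    case True
    have "(\<integral>\<^sup>+y. H (Complex x y) \<partial>lborel) = ennreal \<bar>x\<bar> * (\<integral>\<^sup>+y. H (Complex x (0 + x * y)) \<partial>lborel)"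
      using True by (intro nn_integral_real_affine) auto
    also have "\<dots> = ennreal \<bar>x\<bar> * (\<integral>\<^sup>+t. H (Complex x (0 + x * tan t)) * ennreal (inverse ((cos t)\<^sup>2)) * indicator ?C t \<partial>lborel)"
      by (subst nn_integral_tan_substitution) auto
    also have "\<dots> = (\<integral>\<^sup>+t. ennreal \<bar>x\<bar> * (H (Complex x (0 + x * tan t)) * ennreal (inverse ((cos t)\<^sup>2)) * indicator ?C t) \<partial>lborel)"
      by (subst nn_integral_cmult) auto
    also have "\<dots> = (\<integral>\<^sup>+t. H (Complex x (x * tan t)) * ennreal (x * inverse ((cos t)\<^sup>2)) * indicator ?C t \<partial>lborel)"
      using True by (intro nn_integral_cong) (auto simp: ennreal_mult' mult_ac)
    finally show ?thesis using True by simp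
  qed simp
  then have "(\<integral>\<^sup>+x. \<integral>\<^sup>+y. H (Complex x y) * indicator {0<..} x \<partial>lborel \<partial>lborel) =
     (\<integral>\<^sup>+x. \<integral>\<^sup>+t. H (Complex x (x * tan t)) * ennreal (x * inverse ((cos t)\<^sup>2)) * indicator {0<..} x * indicator ?C t \<partial>lborel \<partial>lborel)"
    by simp
  also have "\<dots> = (\<integral>\<^sup>+t. \<integral>\<^sup>+x. H (Complex x (x * tan t)) * ennreal (x * inverse ((cos t)\<^sup>2)) * indicator {0<..} x * indicator ?C t \<partial>lborel \<partial>lborel)"
    by (rule lborel_pair.Fubini') (simp add: Complex_eq case_prod_beta)
  also have "\<dots> = (\<integral>\<^sup>+t. \<integral>\<^sup>+r. H (rcis r t) * ennreal r * indicator {0<..} r * indicator ?C t \<partial>lborel \<partial>lborel)"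
  proof (rule nn_integral_cong)
    fix t :: real
    show "(\<integral>\<^sup>+x. H (Complex x (x * tan t)) * ennreal (x * inverse ((cos t)\<^sup>2)) * indicator {0<..} x * indicator ?C t \<partial>lborel)
      = (\<integral>\<^sup>+r. H (rcis r t) * ennreal r * indicator {0<..} r * indicator ?C t \<partial>lborel)"
    proof (cases "t \<in> ?C")
      case True
      then have c: "cos t > 0" using cos_gt_zero_pi[of t] by auto
      have "(\<integral>\<^sup>+x. H (Complex x (x * tan t)) * ennreal (x * inverse ((cos t)\<^sup>2)) * indicator {0<..} x \<partial>lborel)
        = ennreal \<bar>cos t\<bar> * (\<integral>\<^sup>+r. H (Complex (0 + cos t * r) ((0 + cos t * r) * tan t)) * ennreal ((0 + cos t * r) * inverse ((cos t)\<^sup>2)) * indicator {0<..} (0 + cos t * r) \<partial>lborel)"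
        using c by (intro nn_integral_real_affine) (auto simp: Complex_eq)
      also have "\<dots> = (\<integral>\<^sup>+r. ennreal \<bar>cos t\<bar> * (H (Complex (0 + cos t * r) ((0 + cos t * r) * tan t)) * ennreal ((0 + cos t * r) * inverse ((cos t)\<^sup>2)) * indicator {0<..} (0 + cos t * r)) \<partial>lborel)"
        by (subst nn_integral_cmult) (auto simp: Complex_eq)
      also have "\<dots> = (\<integral>\<^sup>+r. H (rcis r t) * ennreal r * indicator {0<..} r \<partial>lborel)"
      proof (rule nn_integral_cong)
        fix r :: real
        have 1: "Complex (0 + cos t * r) ((0 + cos t * r) * tan t) = rcis r t"
          using c by (auto simp: complex_eq_iff tan_def)
        have 2: "indicator {0<..} (0 + cos t * r) = (indicator {0<..} r :: ennreal)"
          using c by (auto simp: indicator_def zero_less_mult_iff)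
        have 3: "cos t * ((0 + cos t * r) * inverse ((cos t)\<^sup>2)) = r"
          using c by (simp add: field_simps power2_eq_square)
        have "ennreal \<bar>cos t\<bar> * ennreal ((0 + cos t * r) * inverse ((cos t)\<^sup>2))
            = ennreal (cos t * ((0 + cos t * r) * inverse ((cos t)\<^sup>2)))"
          using c by (subst ennreal_mult') auto
        then have "ennreal \<bar>cos t\<bar> * ennreal ((0 + cos t * r) * inverse ((cos t)\<^sup>2)) = ennreal r"
          by (simp only: 3)
        then show "ennreal \<bar>cos t\<bar> * (H (Complex (0 + cos t * r) ((0 + cos t * r) * tan t)) * ennreal ((0 + cos t * r) * inverse ((cos t)\<^sup>2)) * indicator {0<..} (0 + cos t * r)) = H (rcis r t) * ennreal r * indicator {0<..} r"
          unfolding 1 2 by (metis mult.assoc mult.left_commute)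
      qed
      finally show ?thesis using True by simp
    qed simp
  qed
  finally show ?thesis .
qed

text \<open>The part of the interval beyond \<open>T\<close> is moved back by \<open>T\<close> and
  fills the gap \<open>{0..<a}\<close>.\<close>

lemma nn_integral_periodic_aux:
  fixes h :: "real \<Rightarrow> ennreal"
  assumes [measurable]: "h \<in> borel_measurable borel"
    and per: "\<And>t. h (t + T) = h t" and a: "0 \<le> a" "a < T"
  shows "(\<integral>\<^sup>+t. h t * indicator {a..<a+T} t \<partial>lborel) = (\<integral>\<^sup>+t. h t * indicator {0..<T} t \<partial>lborel)"
proof -
  have "(\<integral>\<^sup>+t. h t * indicator {a..<a+T} t \<partial>lborel)
     = (\<integral>\<^sup>+t. h t * indicator {a..<T} t + h t * indicator {T..<a+T} t \<partial>lborel)"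
    using a by (intro nn_integral_cong) (auto simp: indicator_def)
  also have "\<dots> = (\<integral>\<^sup>+t. h t * indicator {a..<T} t \<partial>lborel) + (\<integral>\<^sup>+t. h t * indicator {T..<a+T} t \<partial>lborel)"
    by (rule nn_integral_add) auto
  also have "(\<integral>\<^sup>+t. h t * indicator {T..<a+T} t \<partial>lborel) = ennreal \<bar>1\<bar> * (\<integral>\<^sup>+t. h (T + 1 * t) * indicator {T..<a+T} (T + 1 * t) \<partial>lborel)"
    by (rule nn_integral_real_affine) auto
  also have "\<dots> = (\<integral>\<^sup>+t. h t * indicator {0..<a} t \<partial>lborel)"
    using per by (auto intro!: nn_integral_cong simp: indicator_def add.commute)
  also have "(\<integral>\<^sup>+t. h t * indicator {a..<T} t \<partial>lborel) + \<dots> = (\<integral>\<^sup>+t. h t * indicator {a..<T} t + h t * indicator {0..<a} t \<partial>lborel)"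
    by (rule nn_integral_add[symmetric]) auto
  also have "\<dots> = (\<integral>\<^sup>+t. h t * indicator {0..<T} t \<partial>lborel)"
    using a by (intro nn_integral_cong) (auto simp: indicator_def)
  finally show ?thesis .
qed

lemma nn_integral_shift:
  fixes h :: "real \<Rightarrow> ennreal"
  assumes [measurable]: "h \<in> borel_measurable borel"
  shows "(\<integral>\<^sup>+t. h (t + a) * indicator {b..<c} t \<partial>lborel) = (\<integral>\<^sup>+t. h t * indicator {b+a..<c+a} t \<partial>lborel)"
proof -
  have "(\<integral>\<^sup>+t. h t * indicator {b+a..<c+a} t \<partial>lborel) = ennreal \<bar>1\<bar> * (\<integral>\<^sup>+t. h (a + 1 * t) * indicator {b+a..<c+a} (a + 1 * t) \<partial>lborel)"
    by (rule nn_integral_real_affine) auto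
  also have "\<dots> = (\<integral>\<^sup>+t. h (t + a) * indicator {b..<c} t \<partial>lborel)"
    by (auto intro!: nn_integral_cong simp: indicator_def add.commute)
  finally show ?thesis by simp
qed

lemma nn_integral_periodic:
  fixes h :: "real \<Rightarrow> ennreal"
  assumes [measurable]: "h \<in> borel_measurable borel"
    and per: "\<And>t. h (t + T) = h t" and a: "\<bar>a\<bar> < T"
  shows "(\<integral>\<^sup>+t. h (t + a) * indicator {0..<T} t \<partial>lborel) = (\<integral>\<^sup>+t. h t * indicator {0..<T} t \<partial>lborel)"
proof (cases "a \<ge> 0")
  case True
  then show ?thesis using a nn_integral_periodic_aux[of h T a] per
    by (subst nn_integral_shift) (auto simp: add.commute)
next
  case False
  have "(\<integral>\<^sup>+t. h (t + a) * indicator {-a..<-a+T} t \<partial>lborel) = (\<integral>\<^sup>+t. h (t + a) * indicator {0..<T} t \<partial>lborel)"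
  proof (rule nn_integral_periodic_aux)
    show "h (t + T + a) = h (t + a)" for t using per[of "t + a"] by (simp add: algebra_simps)
  qed (use False a in auto)
  then show ?thesis
    by (subst (asm) nn_integral_shift) auto
qed

lemma rcis_periodic: "rcis r (t + 2 * pi) = rcis r t"
  by (simp add: rcis_def cis.ctr)

text \<open>The half plane x < 0 is the image of x > 0 under z to -z, which turns the angle by
  \<pi>; the imaginary axis is a null set.\<close>

lemma nn_integral_polar:
  fixes H :: "complex \<Rightarrow> ennreal"
  assumes [measurable]: "H \<in> borel_measurable borel"
  shows "(\<integral>\<^sup>+z. H z \<partial>lborel) =
    (\<integral>\<^sup>+t. \<integral>\<^sup>+r. H (rcis r t) * ennreal r * indicator {0<..} r * indicator {0..<2*pi} t \<partial>lborel \<partial>lborel)"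
proof -
  have [measurable]: "(\<lambda>z. Complex (fst z) (snd z)) \<in> borel_measurable (borel \<Otimes>\<^sub>M borel)"
     "\<And>x. Complex x \<in> borel_measurable borel" 
    unfolding Complex_eq[abs_def] by measurable
  define h where "h t = (\<integral>\<^sup>+r. H (rcis r t) * ennreal r * indicator {0<..} r \<partial>lborel)" for t
  have [measurable]: "h \<in> borel_measurable borel"
    unfolding h_def by measurable
  define g where "g H x = (\<integral>\<^sup>+y. H (Complex x y) \<partial>lborel)" for H :: "complex \<Rightarrow> ennreal" and x
  have g[measurable]: "g H \<in> borel_measurable borel"
    if [measurable]: "H \<in> borel_measurable borel" for H
    unfolding g_def by measurable
  have right: "(\<integral>\<^sup>+x. g H x * indicator {0<..} x \<partial>lborel) =
    (\<integral>\<^sup>+t. (\<integral>\<^sup>+r. H (rcis r t) * ennreal r * indicator {0<..} r \<partial>lborel) * indicator {-pi/2<..<pi/2} t \<partial>lborel)"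
    if [measurable]: "H \<in> borel_measurable borel" for H
    using nn_integral_polar_right[of H]
    by (simp add: g_def nn_integral_multc)
  have per: "h (t + 2 * pi) = h t" for t
    by (simp add: h_def rcis_periodic)
  have "(\<integral>\<^sup>+z. H z \<partial>lborel) = (\<integral>\<^sup>+x. g H x \<partial>lborel)"
    by (subst nn_integral_complex) (auto simp: g_def[abs_def])
  also have "\<dots> = (\<integral>\<^sup>+x. g H x * indicator {0<..} x + g H x * indicator {..<0} x \<partial>lborel)"
    by (intro nn_integral_cong_AE AE_I[of _ _ "{0}"]) (auto simp: indicator_def not_less)
  also have "\<dots> = (\<integral>\<^sup>+x. g H x * indicator {0<..} x \<partial>lborel) + (\<integral>\<^sup>+x. g H x * indicator {..<0} x \<partial>lborel)"
    by (rule nn_integral_add) auto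
  also have "(\<integral>\<^sup>+x. g H x * indicator {..<0} x \<partial>lborel) = ennreal \<bar>-1\<bar> * (\<integral>\<^sup>+x. g H (0 + -1 * x) * indicator {..<0} (0 + -1 * x) \<partial>lborel)"
    by (rule nn_integral_real_affine) auto
  also have "\<dots> = (\<integral>\<^sup>+x. g (\<lambda>z. H (- z)) x * indicator {0<..} x \<partial>lborel)"
  proof -
    have "g H (- x) = g (\<lambda>z. H (- z)) x" for x
    proof -
      have "(\<integral>\<^sup>+y. H (Complex (-x) y) \<partial>lborel) = ennreal \<bar>-1\<bar> * (\<integral>\<^sup>+y. H (Complex (-x) (0 + -1 * y)) \<partial>lborel)"
        by (rule nn_integral_real_affine) auto
      then show ?thesis by (simp add: g_def complex_minus)
    qed
    then show ?thesis by (auto intro!: nn_integral_cong simp: indicator_def)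
  qed
  also have "\<dots> = (\<integral>\<^sup>+t. h (t + pi) * indicator {-pi/2<..<pi/2} t \<partial>lborel)"
    by (subst right) (auto simp: h_def rcis_def cis.ctr complex_eq_iff intro!: nn_integral_cong arg_cong2[where f="(*)"] arg_cong[where f=H])
  also have "\<dots> = (\<integral>\<^sup>+t. h (t + pi) * indicator {-pi/2..<pi/2} t \<partial>lborel)"
    by (intro nn_integral_cong_AE AE_I[of _ _ "{-pi/2}"]) (auto simp: indicator_def)
  also have "\<dots> = (\<integral>\<^sup>+t. h t * indicator {-pi/2+pi..<pi/2+pi} t \<partial>lborel)"
    by (rule nn_integral_shift) auto
  also have "(\<integral>\<^sup>+x. g H x * indicator {0<..} x \<partial>lborel) = (\<integral>\<^sup>+t. h t * indicator {-pi/2<..<pi/2} t \<partial>lborel)"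
    by (subst right) (auto simp: h_def)
  also have "\<dots> = (\<integral>\<^sup>+t. h t * indicator {-pi/2..<pi/2} t \<partial>lborel)"
    by (intro nn_integral_cong_AE AE_I[of _ _ "{-pi/2}"]) (auto simp: indicator_def)
  also have "\<dots> + (\<integral>\<^sup>+t. h t * indicator {-pi/2+pi..<pi/2+pi} t \<partial>lborel)
     = (\<integral>\<^sup>+t. h t * indicator {-pi/2..<pi/2} t + h t * indicator {-pi/2+pi..<pi/2+pi} t \<partial>lborel)"
    by (rule nn_integral_add[symmetric]) auto
  \<comment> \<open>The angular ranges of the two half planes are adjacent and form one period
    beginning at -\<pi>/2.\<close>
  also have "\<dots> = (\<integral>\<^sup>+t. h t * indicator {0+(-pi/2)..<2*pi+(-pi/2)} t \<partial>lborel)"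
    by (intro nn_integral_cong) (auto simp: indicator_def)
  also have "\<dots> = (\<integral>\<^sup>+t. h (t + (-pi/2)) * indicator {0..<2*pi} t \<partial>lborel)"
    by (rule nn_integral_shift[symmetric]) auto
  also have "\<dots> = (\<integral>\<^sup>+t. h t * indicator {0..<2*pi} t \<partial>lborel)"
    by (rule nn_integral_periodic) (auto simp: per)
  finally show ?thesis
    by (simp add: h_def nn_integral_multc)
qed

section \<open>Averages with respect to a refining family of kernels\<close>

lemma enn_powr_ennreal: "0 \<le> r \<Longrightarrow> enn_powr (ennreal r) a = ennreal (r powr a)"
  by (simp add: enn_powr_def)

lemma enn_powr_top [simp]: "enn_powr \<infinity> a = \<infinity>" "enn_powr top a = \<infinity>"
  by (simp_all add: enn_powr_def)

lemma enn_powr_0 [simp]: "enn_powr 0 a = 0"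
  by (simp add: enn_powr_def)

lemma enn_powr_one [simp]: "enn_powr x 1 = x"
  by (cases x) (auto simp: enn_powr_ennreal)

lemma enn_powr_less_top_iff [simp]: "enn_powr x a < \<infinity> \<longleftrightarrow> x < \<infinity>"
  by (cases x) (auto simp: enn_powr_ennreal)

lemma enn_powr_mono:
  assumes "x \<le> y" "0 < a"
  shows "enn_powr x a \<le> enn_powr y a"
  using assms by (cases x; cases y) (auto simp: enn_powr_ennreal powr_mono2 top_unique)

lemma enn_powr_enn_powr:
  assumes "0 < a"
  shows "enn_powr (enn_powr x a) (1 / a) = x" "enn_powr (enn_powr x (1 / a)) a = x"
  using assms by (cases x; auto simp: enn_powr_ennreal powr_powr)+

lemma enn_powr_mult:
  assumes "0 < a"
  shows "enn_powr (x * y) a = enn_powr x a * enn_powr y a"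
proof (cases "x = 0 \<or> y = 0")
  case False
  then show ?thesis using assms
    by (cases x; cases y)
       (auto simp: enn_powr_ennreal powr_mult ennreal_mult'[symmetric] ennreal_mult_top ennreal_top_mult
         ennreal_mult_eq_top_iff)
qed auto

text \<open>The sum is at most twice the maximum; unlike convexity or subadditivity, this serves
  exponents above and below 1 alike.\<close>

lemma enn_powr_add_le:
  assumes "0 < a"
  shows "enn_powr (x + y) a \<le> ennreal (2 powr a) * (enn_powr x a + enn_powr y a)"
proof -
  have "x + y \<le> ennreal 2 * max x y"
    by (metis add_mono ennreal_numeral max.cobounded1 max.cobounded2 mult_2)
  then have "enn_powr (x + y) a \<le> enn_powr (ennreal 2 * max x y) a"
    using assms by (rule enn_powr_mono)
  also have "\<dots> = ennreal (2 powr a) * enn_powr (max x y) a"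
    using assms by (subst enn_powr_mult) (simp_all add: enn_powr_ennreal del: ennreal_numeral)
  also have "enn_powr (max x y) a \<le> enn_powr x a + enn_powr y a"
    by (auto simp: max_def)
  finally show ?thesis by (simp add: mult_left_mono)
qed

text \<open>The power is increasing with the increasing inverse \<open>enn_powr _ (1 / a)\<close>,
  hence commutes with suprema.\<close>

lemma enn_powr_SUP:
  assumes "0 < a"
  shows "enn_powr (SUP i. f i) a = (SUP i. enn_powr (f i) a)"
proof (rule antisym)
  have "f i \<le> enn_powr (SUP i. enn_powr (f i) a) (1 / a)" for i
  proof -
    have "f i = enn_powr (enn_powr (f i) a) (1 / a)"
      using assms by (simp add: enn_powr_enn_powr)
    also have "\<dots> \<le> enn_powr (SUP i. enn_powr (f i) a) (1 / a)"
      using assms by (intro enn_powr_mono SUP_upper) auto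
    finally show ?thesis .
  qed
  then have "(SUP i. f i) \<le> enn_powr (SUP i. enn_powr (f i) a) (1 / a)"
    by (rule SUP_least)
  then have "enn_powr (SUP i. f i) a \<le> enn_powr (enn_powr (SUP i. enn_powr (f i) a) (1 / a)) a"
    using assms by (rule enn_powr_mono)
  then show "enn_powr (SUP i. f i) a \<le> (SUP i. enn_powr (f i) a)"
    using assms by (simp add: enn_powr_enn_powr)
qed (use assms in \<open>auto intro!: SUP_least enn_powr_mono SUP_upper\<close>)

lemma borel_measurable_enn_powr [measurable]:
  assumes [measurable]: "f \<in> borel_measurable M"
  shows "(\<lambda>x. enn_powr (f x) a) \<in> borel_measurable M"
  unfolding enn_powr_def by measurable

text \<open>Mean value theorem, with a derivative s z^(s-1) that increases in z. It bounds one
  increment of the telescoped S_k^s by s times the average of level k times S_(k+1)^(s-1). At a = 0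
  the claim reduces to b^s \<le> s b^s.\<close>

lemma powr_diff_le:
  fixes a b s :: real
  assumes "1 \<le> s" "0 \<le> a" "a \<le> b"
  shows "b powr s - a powr s \<le> s * (b - a) * b powr (s - 1)"
proof (cases "a = 0 \<or> a = b")
  case True
  then show ?thesis
  proof
    assume "a = 0"
    moreover have "b powr s \<le> s * b powr s" using assms by (simp add: mult_le_cancel_right1)
    ultimately show ?thesis using assms powr_mult_base[of b "s - 1"] by (cases "b = 0") (auto simp: mult.assoc)
  qed auto
next
  case False
  then have "0 < a" "a < b" using assms by auto
  then have "\<exists>z>a. z < b \<and> b powr s - a powr s = (b - a) * (s * z powr (s - 1))"
    by (intro MVT2) (auto intro!: has_real_derivative_powr)
  then obtain z where z: "a < z" "z < b" "b powr s - a powr s = (b - a) * (s * z powr (s - 1))"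
    by blast
  have "z powr (s - 1) \<le> b powr (s - 1)"
    using z \<open>0 < a\<close> assms by (intro powr_mono2) auto
  then have "(b - a) * s * z powr (s - 1) \<le> (b - a) * s * b powr (s - 1)"
    using \<open>a < b\<close> assms by (intro mult_left_mono) auto
  then show ?thesis using z(3) by (simp add: mult_ac)
qed

text \<open>For s \<le> 1 the derivative decreases, so its value at the right endpoint bounds the
  difference quotient from below.\<close>

lemma powr_diff_ge:
  fixes a b s :: real
  assumes "0 < s" "s \<le> 1" "0 < a" "a \<le> b"
  shows "s * (b - a) * b powr (s - 1) \<le> b powr s - a powr s"
proof (cases "a = b")
  case False
  then have "a < b" using assms by auto
  with \<open>0 < a\<close> have "\<exists>z>a. z < b \<and> b powr s - a powr s = (b - a) * (s * z powr (s - 1))"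
    by (intro MVT2) (auto intro!: has_real_derivative_powr)
  then obtain z where z: "a < z" "z < b" "b powr s - a powr s = (b - a) * (s * z powr (s - 1))"
    by blast
  have "b powr (s - 1) \<le> z powr (s - 1)"
    using z \<open>0 < a\<close> assms by (intro powr_mono2') auto
  then have "(b - a) * s * b powr (s - 1) \<le> (b - a) * s * z powr (s - 1)"
    using \<open>a < b\<close> assms by (intro mult_left_mono) auto
  then show ?thesis using z(3) by (simp add: mult_ac)
qed auto

text \<open>A nonzero value of \<open>K k x y\<close> plays the part of x and y lying in a common
  cell of level k. \<open>K_refine\<close> then encodes two facts: the kernel of level k is constant
  on these cells (j = k), and cells of larger level are finer (j < k).\<close>

locale refining_averages = finite_measure M for M :: "'a measure" +
  fixes K :: "nat \<Rightarrow> 'a \<Rightarrow> 'a \<Rightarrow> ennreal"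
  assumes K_measurable: "(\<lambda>(x, y). K k x y) \<in> borel_measurable (M \<Otimes>\<^sub>M M)"
    and K_commute: "K k x y = K k y x"
    and nn_integral_K: "x \<in> space M \<Longrightarrow> (\<integral>\<^sup>+y. K k x y \<partial>M) = 1"
    and K_refine: "K k x y \<noteq> 0 \<Longrightarrow> j \<le> k \<Longrightarrow> K j x z = K j y z"
begin

lemma K_measurable' [measurable (raw)]:
  assumes [measurable]: "f \<in> N \<rightarrow>\<^sub>M M" "g \<in> N \<rightarrow>\<^sub>M M"
  shows "(\<lambda>x. K k (f x) (g x)) \<in> borel_measurable N"
  using measurable_compose[OF _ K_measurable, of "\<lambda>x. (f x, g x)" N k] by simp

definition avg :: "nat \<Rightarrow> ('a \<Rightarrow> ennreal) \<Rightarrow> 'a \<Rightarrow> ennreal" where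
  "avg k G x = (\<integral>\<^sup>+y. K k x y * G y \<partial>M)"

lemma borel_measurable_avg [measurable]:
  assumes [measurable]: "G \<in> borel_measurable M"
  shows "avg k G \<in> borel_measurable M"
  unfolding avg_def by measurable

lemma avg_cong_cell: "K k x y \<noteq> 0 \<Longrightarrow> j \<le> k \<Longrightarrow> avg j G x = avg j G y"
  unfolding avg_def using K_refine by simp

lemma avg_mono: "(\<And>y. G y \<le> G' y) \<Longrightarrow> avg k G x \<le> avg k G' x"
  unfolding avg_def by (intro nn_integral_mono mult_left_mono) auto

lemma avg_le_const:
  assumes "\<And>y. G y \<le> c" "x \<in> space M"
  shows "avg k G x \<le> c"
proof -
  have "avg k G x \<le> (\<integral>\<^sup>+y. K k x y * c \<partial>M)"
    unfolding avg_def using assms by (intro nn_integral_mono mult_left_mono) auto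
  also have "\<dots> = c"
    using assms by (subst nn_integral_multc) (auto simp: nn_integral_K)
  finally show ?thesis .
qed

text \<open>A function that is constant on cells can be moved under the kernel; Tonelli and symmetry
  then let the kernel be integrated out, its total mass being 1. This is the self-adjointness of
  conditional expectation.\<close>

lemma nn_integral_avg_mult:
  assumes [measurable]: "G \<in> borel_measurable M" "\<phi> \<in> borel_measurable M"
    and \<phi>: "\<And>x y. K k x y \<noteq> 0 \<Longrightarrow> \<phi> x = \<phi> y"
  shows "(\<integral>\<^sup>+x. avg k G x * \<phi> x \<partial>M) = (\<integral>\<^sup>+x. G x * \<phi> x \<partial>M)"
proof -
  interpret P: pair_sigma_finite M M ..
  have "(\<integral>\<^sup>+x. avg k G x * \<phi> x \<partial>M) = (\<integral>\<^sup>+x. \<integral>\<^sup>+y. K k x y * G y * \<phi> x \<partial>M \<partial>M)"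
    unfolding avg_def by (intro nn_integral_cong nn_integral_multc[symmetric]) auto
  also have "\<dots> = (\<integral>\<^sup>+x. \<integral>\<^sup>+y. K k y x * (G y * \<phi> y) \<partial>M \<partial>M)"
  proof (intro nn_integral_cong)
    fix x y
    show "K k x y * G y * \<phi> x = K k y x * (G y * \<phi> y)"
      using \<phi>[of x y] K_commute[of k x y] by (cases "K k x y = 0") (auto simp: mult_ac)
  qed
  also have "\<dots> = (\<integral>\<^sup>+y. \<integral>\<^sup>+x. K k y x * (G y * \<phi> y) \<partial>M \<partial>M)"
    by (rule P.Fubini') simp
  also have "\<dots> = (\<integral>\<^sup>+x. G x * \<phi> x \<partial>M)"
    by (intro nn_integral_cong) (simp add: nn_integral_multc nn_integral_K)
  finally show ?thesis .
qed

text \<open>A real version makes differences and the mean value theorem available.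
  \<open>enn2real\<close> sends \<infinity> to 0, so the way back in \<open>ennreal_real_avg\<close>
  asks for an upper bound on the function.\<close>

definition real_avg :: "nat \<Rightarrow> ('a \<Rightarrow> real) \<Rightarrow> 'a \<Rightarrow> real" where
  "real_avg k g x = enn2real (avg k (\<lambda>x. ennreal (g x)) x)"

lemma real_avg_nonneg: "0 \<le> real_avg k g x"
  by (simp add: real_avg_def)

lemma ennreal_real_avg:
  assumes "\<And>y. g y \<le> c" "x \<in> space M"
  shows "ennreal (real_avg k g x) = avg k (\<lambda>x. ennreal (g x)) x"
proof -
  have "avg k (\<lambda>x. ennreal (g x)) x \<le> ennreal c"
    using assms by (intro avg_le_const ennreal_leI) auto
  then show ?thesis
    by (simp add: real_avg_def le_less_trans[OF _ ennreal_less_top])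
qed

lemma real_avg_le_const:
  assumes "\<And>y. g y \<le> c" "0 \<le> c" "x \<in> space M"
  shows "real_avg k g x \<le> c"
proof -
  have "avg k (\<lambda>x. ennreal (g x)) x \<le> ennreal c"
    using assms by (intro avg_le_const ennreal_leI) auto
  then show ?thesis
    using assms by (simp add: real_avg_def enn2real_leI)
qed

lemma borel_measurable_real_avg [measurable]:
  assumes [measurable]: "g \<in> borel_measurable M"
  shows "real_avg k g \<in> borel_measurable M"
  unfolding real_avg_def by measurable

lemma nn_integral_real_avg_mult:
  assumes [measurable]: "g \<in> borel_measurable M" "\<phi> \<in> borel_measurable M"
    and \<phi>: "\<And>x y. K k x y \<noteq> 0 \<Longrightarrow> \<phi> x = \<phi> y"
    and "\<And>y. 0 \<le> g y" "\<And>y. g y \<le> c"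
  shows "(\<integral>\<^sup>+x. ennreal (real_avg k g x * \<phi> x) \<partial>M) = (\<integral>\<^sup>+x. ennreal (g x * \<phi> x) \<partial>M)"
proof -
  have "(\<integral>\<^sup>+x. ennreal (real_avg k g x * \<phi> x) \<partial>M)
     = (\<integral>\<^sup>+x. avg k (\<lambda>x. ennreal (g x)) x * ennreal (\<phi> x) \<partial>M)"
    using assms(5) by (intro nn_integral_cong) (simp add: ennreal_mult' real_avg_nonneg ennreal_real_avg[OF assms(5)])
  also have "\<dots> = (\<integral>\<^sup>+x. ennreal (g x) * ennreal (\<phi> x) \<partial>M)"
    using \<phi> by (intro nn_integral_avg_mult) auto
  also have "\<dots> = (\<integral>\<^sup>+x. ennreal (g x * \<phi> x) \<partial>M)"
    using assms(4) by (intro nn_integral_cong) (simp add: ennreal_mult')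
  finally show ?thesis .
qed

text \<open>The sum up to and including level k involves only levels j \<le> k and is therefore
  constant on cells of level k. \<open>Suc k\<close> rather than k makes it the right endpoint of
  the power increments. The case \<epsilon> = 0 serves s > 1, positive \<epsilon> serves s <
  1.\<close>

lemma nn_integral_partial_sums:
  assumes [measurable]: "\<And>k. g k \<in> borel_measurable M"
    and g: "\<And>k y. 0 \<le> g k y" "\<And>k y. g k y \<le> c"
  shows "(\<integral>\<^sup>+x. ennreal (\<Sum>k<n. real_avg k (g k) x * (\<epsilon> + (\<Sum>j<Suc k. real_avg j (g j) x)) powr u) \<partial>M)
       = (\<integral>\<^sup>+x. ennreal (\<Sum>k<n. g k x * (\<epsilon> + (\<Sum>j<Suc k. real_avg j (g j) x)) powr u) \<partial>M)"
proof -
  define \<phi> where "\<phi> k x = (\<epsilon> + (\<Sum>j<Suc k. real_avg j (g j) x)) powr u" for k x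
  have [measurable]: "\<phi> k \<in> borel_measurable M" for k
    unfolding \<phi>_def by measurable
  have cell: "\<phi> k x = \<phi> k y" if "K k x y \<noteq> 0" for k x y
    unfolding \<phi>_def real_avg_def using that by (simp add: avg_cong_cell del: sum.lessThan_Suc)
  have pos: "0 \<le> \<phi> k x" for k x by (simp add: \<phi>_def)
  have "(\<integral>\<^sup>+x. ennreal (\<Sum>k<n. real_avg k (g k) x * \<phi> k x) \<partial>M)
     = (\<Sum>k<n. \<integral>\<^sup>+x. ennreal (real_avg k (g k) x * \<phi> k x) \<partial>M)"
    by (subst nn_integral_sum[symmetric]) (auto simp: pos real_avg_nonneg)
  also have "\<dots> = (\<Sum>k<n. \<integral>\<^sup>+x. ennreal (g k x * \<phi> k x) \<partial>M)"
    using g cell by (intro sum.cong nn_integral_real_avg_mult[where c=c] refl) auto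
  also have "\<dots> = (\<integral>\<^sup>+x. ennreal (\<Sum>k<n. g k x * \<phi> k x) \<partial>M)"
    by (subst nn_integral_sum[symmetric]) (auto simp: pos g)
  finally show ?thesis by (simp add: \<phi>_def del: sum.lessThan_Suc)
qed

section \<open>The two inequalities for bounded functions and finitely many levels\<close>

text \<open>The threshold S = 2 s F is chosen so that above it s F \<le> S / 2, which leaves the
  factor 1/2 in front of S^s that absorption needs; below it S is replaced by the threshold.\<close>

lemma powr_split_upper:
  fixes F S s :: real
  assumes "1 < s" "0 \<le> F" "0 \<le> S"
  shows "s * (F * S powr (s - 1)) \<le> s * (2 * s) powr (s - 1) * F powr s + S powr s / 2"
proof (cases "S \<le> 2 * s * F")
  case True
  have "S powr (s - 1) \<le> (2 * s * F) powr (s - 1)"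
    using assms True by (intro powr_mono2) auto
  also have "\<dots> = (2 * s) powr (s - 1) * F powr (s - 1)"
    using assms by (intro powr_mult) 
  finally have "s * F * S powr (s - 1) \<le> s * F * ((2 * s) powr (s - 1) * F powr (s - 1))"
    using assms by (intro mult_left_mono) auto
  also have "\<dots> = s * (2 * s) powr (s - 1) * F powr s"
    using assms powr_mult_base[of F "s - 1"] by (cases "F = 0") auto
  finally show ?thesis by (simp add: mult.assoc add_increasing2)
next
  case False
  then have "s * F * S powr (s - 1) \<le> (S / 2) * S powr (s - 1)"
    by (intro mult_right_mono) auto
  also have "\<dots> = S powr s / 2"
    using assms powr_mult_base[of S "s - 1"] by auto
  finally show ?thesis using assms by (simp add: mult.assoc add_increasing)
qed

text \<open>Telescoping, moving the averages off \<open>g\<close> and splitting give X \<le> b Y + X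
  / 2 for the left integral X, the right integral Y and b half the stated constant. The bound
  \<open>c\<close> makes X finite, so that X / 2 can be subtracted.\<close>

lemma bounded_avg_upper:
  assumes [measurable]: "\<And>k. g k \<in> borel_measurable M"
    and g: "\<And>k y. 0 \<le> g k y" "\<And>k y. g k y \<le> c" and s: "1 < s"
  shows "(\<integral>\<^sup>+x. ennreal ((\<Sum>k<n. real_avg k (g k) x) powr s) \<partial>M)
      \<le> ennreal (2 * s * (2 * s) powr (s - 1)) * (\<integral>\<^sup>+x. ennreal ((\<Sum>k<n. g k x) powr s) \<partial>M)"
proof -
  define S where "S n x = (\<Sum>k<n. real_avg k (g k) x)" for n x
  define F where "F x = (\<Sum>k<n. g k x)" for x
  have [measurable]: "S n \<in> borel_measurable M" "F \<in> borel_measurable M" for n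
    unfolding S_def F_def by measurable
  have c0: "0 \<le> c" using g[of 0 undefined] by linarith
  have S0: "0 \<le> S n x" for n x unfolding S_def by (intro sum_nonneg) (simp add: real_avg_nonneg)
  have F0: "0 \<le> F x" for x unfolding F_def by (intro sum_nonneg g)
  have Smono: "S m x \<le> S n x" if "m \<le> n" for m n x
    unfolding S_def using that by (intro sum_mono2) (auto simp: real_avg_nonneg)
  have tele: "S n x powr s \<le> (\<Sum>k<n. s * (real_avg k (g k) x * S (Suc k) x powr (s - 1)))" for x
  proof -
    have "S n x powr s = (\<Sum>k<n. S (Suc k) x powr s - S k x powr s)"
      using s by (subst sum_lessThan_telescope) (simp add: S_def)
    also have "\<dots> \<le> (\<Sum>k<n. s * (real_avg k (g k) x * S (Suc k) x powr (s - 1)))"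
    proof (intro sum_mono)
      fix k
      show "S (Suc k) x powr s - S k x powr s \<le> s * (real_avg k (g k) x * S (Suc k) x powr (s - 1))"
        using powr_diff_le[of s "S k x" "S (Suc k) x"] s S0[of k x] Smono[of k "Suc k" x]
        by (simp add: S_def mult.assoc)
    qed
    finally show ?thesis .
  qed
  let ?X = "\<integral>\<^sup>+x. ennreal (S n x powr s) \<partial>M" and ?Y = "\<integral>\<^sup>+x. ennreal (F x powr s) \<partial>M"
  have "?X \<le> (\<integral>\<^sup>+x. ennreal s * ennreal (\<Sum>k<n. real_avg k (g k) x * (0 + S (Suc k) x) powr (s - 1)) \<partial>M)"
    using tele s by (intro nn_integral_mono) (auto simp: ennreal_mult'[symmetric] sum_distrib_left intro!: ennreal_leI)
  also have "\<dots> = ennreal s * (\<integral>\<^sup>+x. ennreal (\<Sum>k<n. real_avg k (g k) x * (0 + S (Suc k) x) powr (s - 1)) \<partial>M)"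
    by (rule nn_integral_cmult) auto
  also have "(\<integral>\<^sup>+x. ennreal (\<Sum>k<n. real_avg k (g k) x * (0 + S (Suc k) x) powr (s - 1)) \<partial>M)
     = (\<integral>\<^sup>+x. ennreal (\<Sum>k<n. g k x * (0 + S (Suc k) x) powr (s - 1)) \<partial>M)"
    unfolding S_def using g by (intro nn_integral_partial_sums[where c=c]) auto
  also have "ennreal s * \<dots> = (\<integral>\<^sup>+x. ennreal s * ennreal (\<Sum>k<n. g k x * (0 + S (Suc k) x) powr (s - 1)) \<partial>M)"
    by (rule nn_integral_cmult[symmetric]) auto
  also have "\<dots> \<le> (\<integral>\<^sup>+x. ennreal (s * (2 * s) powr (s - 1)) * ennreal (F x powr s) + ennreal (S n x powr s) / 2 \<partial>M)"
  proof (intro nn_integral_mono)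
    fix x
    \<comment> \<open>As s - 1 > 0, each \<open>S (Suc k)\<close> may be raised to the full sum
      \<open>S n\<close>, which pulls the power out of the sum.\<close>
    have "(\<Sum>k<n. g k x * S (Suc k) x powr (s - 1)) \<le> (\<Sum>k<n. g k x * S n x powr (s - 1))"
      using s g S0 Smono by (intro sum_mono mult_left_mono powr_mono2) auto
    also have "\<dots> = F x * S n x powr (s - 1)"
      by (simp add: F_def sum_distrib_right)
    finally have "s * (\<Sum>k<n. g k x * S (Suc k) x powr (s - 1)) \<le> s * (F x * S n x powr (s - 1))"
      using s by (intro mult_left_mono) auto
    also have "\<dots> \<le> s * (2 * s) powr (s - 1) * F x powr s + S n x powr s / 2"
      using s F0 S0 by (intro powr_split_upper) auto
    finally have "ennreal (s * (\<Sum>k<n. g k x * S (Suc k) x powr (s - 1)))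
        \<le> ennreal (s * (2 * s) powr (s - 1) * F x powr s + S n x powr s / 2)"
      by (rule ennreal_leI)
    also have "\<dots> = ennreal (s * (2 * s) powr (s - 1)) * ennreal (F x powr s) + ennreal (S n x powr s) / 2"
      using s by (simp add: ennreal_mult[of "s * (2 * s) powr (s - 1)"] ennreal_divide_numeral)
    finally show "ennreal s * ennreal (\<Sum>k<n. g k x * (0 + S (Suc k) x) powr (s - 1))
       \<le> ennreal (s * (2 * s) powr (s - 1)) * ennreal (F x powr s) + ennreal (S n x powr s) / 2"
      using s by (simp add: ennreal_mult')
  qed
  also have "\<dots> = ennreal (s * (2 * s) powr (s - 1)) * ?Y + ?X / 2"
    by (subst nn_integral_add) (auto simp: nn_integral_cmult nn_integral_divide)
  finally have le: "?X \<le> ennreal (s * (2 * s) powr (s - 1)) * ?Y + ?X / 2" .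
  have "?X \<le> (\<integral>\<^sup>+x. ennreal ((real n * c) powr s) \<partial>M)"
  proof (intro nn_integral_mono ennreal_leI powr_mono2)
    fix x assume "x \<in> space M"
    then have "S n x \<le> (\<Sum>k<n. c)"
      unfolding S_def using g c0 by (intro sum_mono real_avg_le_const) auto
    then show "S n x \<le> real n * c" by simp
  qed (use s S0 in auto)
  also have "\<dots> < \<infinity>"
    by (simp add: less_top[symmetric] ennreal_mult_eq_top_iff)
  finally have fin: "?X < \<infinity>" .
  show ?thesis
  proof (cases ?Y)
    case top
    then show ?thesis using s by (simp add: F_def ennreal_mult_top)
  next
    case (real y)
    obtain x where x: "?X = ennreal x" "0 \<le> x" using fin by (cases ?X) auto
    have "ennreal x \<le> ennreal (s * (2 * s) powr (s - 1) * y + x / 2)"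
      using le s real x by (simp add: ennreal_mult'[symmetric] ennreal_plus[symmetric] divide_ennreal[of _ 2, simplified] del: ennreal_plus)
    then have "x \<le> s * (2 * s) powr (s - 1) * y + x / 2"
      using real x s by (subst (asm) ennreal_le_iff) auto
    then have "x \<le> 2 * s * (2 * s) powr (s - 1) * y" by simp
    then have "?X \<le> ennreal (2 * s * (2 * s) powr (s - 1)) * ?Y"
      using real x s by (simp add: ennreal_mult'[symmetric] ennreal_leI)
    then show ?thesis by (simp add: S_def F_def)
  qed
qed

text \<open>Where the full sum S dominates F, monotonicity of the power is enough; elsewhere F^s
  \<le> F S^(s-1) since s - 1 < 0, and telescoping bounds the integral of this term by 1 / s times
  that of S^s. Positivity of \<epsilon> matters: \<open>0 powr (s - 1)\<close> is 0, and the
  pointwise bound would fail where S vanishes and F does not.\<close>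

lemma bounded_avg_lower:
  assumes [measurable]: "\<And>k. g k \<in> borel_measurable M"
    and g: "\<And>k y. 0 \<le> g k y" "\<And>k y. g k y \<le> c" and s: "0 < s" "s < 1" and \<epsilon>: "0 < \<epsilon>"
  shows "(\<integral>\<^sup>+x. ennreal ((\<Sum>k<n. g k x) powr s) \<partial>M)
      \<le> ennreal (1 + 1 / s) * (\<integral>\<^sup>+x. ennreal ((\<epsilon> + (\<Sum>k<n. real_avg k (g k) x)) powr s) \<partial>M)"
proof -
  define S where "S n x = \<epsilon> + (\<Sum>k<n. real_avg k (g k) x)" for n x
  define F where "F x = (\<Sum>k<n. g k x)" for x
  have [measurable]: "S n \<in> borel_measurable M" "F \<in> borel_measurable M" for n
    unfolding S_def F_def by measurable
  have S0: "0 < S n x" for n x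
    unfolding S_def using \<epsilon> by (intro add_pos_nonneg sum_nonneg) (auto simp: real_avg_nonneg)
  have F0: "0 \<le> F x" for x unfolding F_def by (intro sum_nonneg g)
  have Smono: "S m x \<le> S n x" if "m \<le> n" for m n x
    unfolding S_def using that by (intro add_left_mono sum_mono2) (auto simp: real_avg_nonneg)
  have tele: "(\<Sum>k<n. s * (real_avg k (g k) x * S (Suc k) x powr (s - 1))) \<le> S n x powr s" for x
  proof -
    have "(\<Sum>k<n. s * (real_avg k (g k) x * S (Suc k) x powr (s - 1))) \<le> (\<Sum>k<n. S (Suc k) x powr s - S k x powr s)"
    proof (intro sum_mono)
      fix k
      show "s * (real_avg k (g k) x * S (Suc k) x powr (s - 1)) \<le> S (Suc k) x powr s - S k x powr s"
        using powr_diff_ge[of s "S k x" "S (Suc k) x"] s S0[of k x] Smono[of k "Suc k" x]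
        by (simp add: S_def mult.assoc)
    qed
    also have "\<dots> = S n x powr s - S 0 x powr s"
      by (rule sum_lessThan_telescope)
    finally show ?thesis by (smt (verit) powr_ge_zero)
  qed
  have "(\<integral>\<^sup>+x. ennreal (F x powr s) \<partial>M)
     \<le> (\<integral>\<^sup>+x. ennreal (S n x powr s) + ennreal (\<Sum>k<n. g k x * S (Suc k) x powr (s - 1)) \<partial>M)"
  proof (intro nn_integral_mono)
    fix x
    have "F x powr s \<le> S n x powr s + F x * S n x powr (s - 1)"
    proof (cases "F x \<le> S n x")
      case True
      then have "F x powr s \<le> S n x powr s" using s F0 by (intro powr_mono2) auto
      then show ?thesis using F0 by (simp add: add_increasing2)
    next
      case False
      have "F x powr s = F x * F x powr (s - 1)"
        using False S0[of n x] powr_mult_base[of "F x" "s - 1"] by auto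
      also have "\<dots> \<le> F x * S n x powr (s - 1)"
        using False S0[of n x] s by (intro mult_left_mono powr_mono2') auto
      finally show ?thesis by (simp add: add_increasing)
    qed
    also have "F x * S n x powr (s - 1) = (\<Sum>k<n. g k x * S n x powr (s - 1))"
      by (simp add: F_def sum_distrib_right)
    \<comment> \<open>The negative exponent reverses monotonicity: the smaller
      \<open>S (Suc k)\<close> has the larger power.\<close>
    also have "\<dots> \<le> (\<Sum>k<n. g k x * S (Suc k) x powr (s - 1))"
      using s g S0 Smono by (intro sum_mono mult_left_mono powr_mono2') auto
    finally show "ennreal (F x powr s) \<le> ennreal (S n x powr s) + ennreal (\<Sum>k<n. g k x * S (Suc k) x powr (s - 1))"
      by (subst ennreal_plus[symmetric]) (auto intro!: ennreal_leI sum_nonneg mult_nonneg_nonneg g)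
  qed
  also have "\<dots> = (\<integral>\<^sup>+x. ennreal (S n x powr s) \<partial>M) + (\<integral>\<^sup>+x. ennreal (\<Sum>k<n. g k x * S (Suc k) x powr (s - 1)) \<partial>M)"
    by (rule nn_integral_add) auto
  also have "(\<integral>\<^sup>+x. ennreal (\<Sum>k<n. g k x * S (Suc k) x powr (s - 1)) \<partial>M)
     = (\<integral>\<^sup>+x. ennreal (\<Sum>k<n. real_avg k (g k) x * S (Suc k) x powr (s - 1)) \<partial>M)"
    unfolding S_def using g by (intro nn_integral_partial_sums[where c=c, symmetric]) auto
  also have "\<dots> \<le> (\<integral>\<^sup>+x. ennreal (1 / s) * ennreal (S n x powr s) \<partial>M)"
  proof (intro nn_integral_mono)
    fix x
    have "(\<Sum>k<n. real_avg k (g k) x * S (Suc k) x powr (s - 1)) \<le> 1 / s * S n x powr s"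
      using tele[of x] s by (simp add: sum_distrib_left[symmetric] field_simps)
    then show "ennreal (\<Sum>k<n. real_avg k (g k) x * S (Suc k) x powr (s - 1)) \<le> ennreal (1 / s) * ennreal (S n x powr s)"
      using s by (subst ennreal_mult'[symmetric]) (auto intro!: ennreal_leI)
  qed
  also have "\<dots> = ennreal (1 / s) * (\<integral>\<^sup>+x. ennreal (S n x powr s) \<partial>M)"
    by (rule nn_integral_cmult) auto
  finally show ?thesis
    using s by (simp add: S_def F_def distrib_right add_left_mono)
qed

section \<open>Passage to arbitrary functions by truncation\<close>

text \<open>One parameter n cuts off both the values and the number of levels, so each truncation is
  bounded by n and has finitely many levels, and monotone convergence in n recovers
  \<open>G\<close>.\<close>

lemma truncation:
  fixes G :: "nat \<Rightarrow> 'b \<Rightarrow> ennreal" and n :: nat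
  defines "g \<equiv> \<lambda>n k x. (if k < n then enn2real (min (G k x) (of_nat n)) else 0)"
  shows "ennreal (g n k x) = (if k < n then min (G k x) (of_nat n) else 0)"
    and "0 \<le> g n k x" "g n k x \<le> real n"
    and "incseq (\<lambda>n. ennreal (g n k x))"
    and "(SUP n. ennreal (g n k x)) = G k x"
proof -
  have lt: "min (G k x) (of_nat n) < top" for n
    by (meson ennreal_of_nat_neq_top less_top min.strict_coboundedI2)
  show *: "ennreal (g n k x) = (if k < n then min (G k x) (of_nat n) else 0)" for n
    unfolding g_def using lt by auto
  show "0 \<le> g n k x" by (simp add: g_def)
  show "g n k x \<le> real n"
    unfolding g_def by (auto intro!: enn2real_leI simp: ennreal_of_nat_eq_real_of_nat)
  show "incseq (\<lambda>n. ennreal (g n k x))"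
    unfolding * by (intro incseq_SucI) (auto simp: min.coboundedI2 intro!: min.mono)
  show "(SUP n. ennreal (g n k x)) = G k x"
  proof (rule antisym)
    show "G k x \<le> (SUP n. ennreal (g n k x))"
    proof (rule dense_le)
      fix c assume c: "c < G k x"
      then have "c < top" by (meson less_le_trans top_greatest)
      then obtain m where m: "c < of_nat m" using ennreal_Ex_less_of_nat by blast
      \<comment> \<open>Large enough for level k to be kept and for the cut of the values to lie
        above c.\<close>
      let ?n = "max m (Suc k)"
      have "c < of_nat ?n"
        using m by (rule less_le_trans) simp
      then have "c \<le> ennreal (g ?n k x)"
        using c unfolding * by (auto intro: less_imp_le simp: less_max_iff_disj)
      then show "c \<le> (SUP n. ennreal (g n k x))"
        by (rule SUP_upper2[OF UNIV_I])
    qed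
    show "(SUP n. ennreal (g n k x)) \<le> G k x"
      unfolding * by (intro SUP_least) auto
  qed
qed

lemma nn_integral_enn_powr_SUP:
  assumes "0 < s" "\<And>n. (\<lambda>x. u n x) \<in> borel_measurable M" "\<And>x. incseq (\<lambda>n. u n x)"
  shows "(\<integral>\<^sup>+x. enn_powr (SUP n::nat. u n x) s \<partial>M) = (SUP n. \<integral>\<^sup>+x. enn_powr (u n x) s \<partial>M)"
  using assms
  by (subst enn_powr_SUP)
     (auto intro!: nn_integral_monotone_convergence_SUP enn_powr_mono simp: incseq_def le_fun_def)

context
  fixes G :: "nat \<Rightarrow> 'a \<Rightarrow> ennreal" and g :: "nat \<Rightarrow> nat \<Rightarrow> 'a \<Rightarrow> real"
  assumes G[measurable]: "\<And>k. G k \<in> borel_measurable M"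
  defines "g \<equiv> \<lambda>n k x. (if k < n then enn2real (min (G k x) (of_nat n)) else 0)"
begin

lemma borel_measurable_trunc [measurable]: "g n k \<in> borel_measurable M"
  unfolding g_def by measurable

lemma trunc:
  shows "0 \<le> g n k x" "g n k x \<le> real n"
    and "incseq (\<lambda>n. ennreal (g n k x))"
    and "(SUP n. ennreal (g n k x)) = G k x"
  unfolding g_def by (rule truncation)+

lemma suminf_trunc: "(\<Sum>k. ennreal (g n k x)) = ennreal (\<Sum>k<n. g n k x)"
proof -
  have "(\<Sum>k. ennreal (g n k x)) = (\<Sum>k<n. ennreal (g n k x))"
    by (intro suminf_finite) (auto simp: g_def)
  then show ?thesis by (simp add: trunc(1))
qed

lemma SUP_suminf_trunc: "(SUP n. ennreal (\<Sum>k<n. g n k x)) = (\<Sum>k. G k x)"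
  unfolding suminf_trunc[symmetric]
  by (subst ennreal_suminf_SUP_eq[symmetric]) (simp_all add: trunc(3,4))

lemma incseq_suminf_trunc: "incseq (\<lambda>n. ennreal (\<Sum>k<n. g n k x))"
  unfolding suminf_trunc[symmetric] using trunc(3)
  by (auto intro!: suminf_le simp: incseq_def)

lemma suminf_avg_trunc:
  assumes "x \<in> space M"
  shows "(\<Sum>k. avg k (\<lambda>x. ennreal (g n k x)) x) = ennreal (\<Sum>k<n. real_avg k (g n k) x)"
proof -
  have "(\<Sum>k. avg k (\<lambda>x. ennreal (g n k x)) x) = (\<Sum>k<n. avg k (\<lambda>x. ennreal (g n k x)) x)"
    by (intro suminf_finite) (auto simp: g_def avg_def)
  also have "\<dots> = (\<Sum>k<n. ennreal (real_avg k (g n k) x))"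
    using assms by (intro sum.cong refl ennreal_real_avg[symmetric, where c="real n"]) (auto simp: trunc(2))
  finally show ?thesis by (simp add: real_avg_nonneg)
qed

lemma SUP_avg_trunc: "(SUP n. avg k (\<lambda>x. ennreal (g n k x)) x) = avg k (G k) x"
  if [measurable]: "x \<in> space M"
proof -
  have "avg k (G k) x = (\<integral>\<^sup>+y. (SUP n. K k x y * ennreal (g n k y)) \<partial>M)"
    unfolding avg_def by (simp add: SUP_mult_left_ennreal[symmetric] trunc(4))
  also have "\<dots> = (SUP n. avg k (\<lambda>x. ennreal (g n k x)) x)"
    unfolding avg_def using trunc(3)
    by (intro nn_integral_monotone_convergence_SUP)
       (auto simp: incseq_def le_fun_def intro!: mult_left_mono)
  finally show ?thesis ..
qed

lemma incseq_avg_trunc: "incseq (\<lambda>n. avg k (\<lambda>x. ennreal (g n k x)) x)"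
  using trunc(3) by (auto simp: incseq_def intro!: avg_mono)

lemma SUP_suminf_avg_trunc:
  assumes "x \<in> space M"
  shows "(SUP n. ennreal (\<Sum>k<n. real_avg k (g n k) x)) = (\<Sum>k. avg k (G k) x)"
  unfolding suminf_avg_trunc[OF assms, symmetric]
  by (subst ennreal_suminf_SUP_eq[symmetric]) (simp_all add: incseq_avg_trunc SUP_avg_trunc assms)

lemma incseq_suminf_avg_trunc: "x \<in> space M \<Longrightarrow> incseq (\<lambda>n. ennreal (\<Sum>k<n. real_avg k (g n k) x))"
  unfolding suminf_avg_trunc[symmetric] incseq_def using incseq_avg_trunc
  by (auto simp del: suminf_avg_trunc simp: suminf_avg_trunc[symmetric] intro!: suminf_le dest: incseqD)

lemma suminf_avg_upper:
  assumes s: "1 < s"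
  shows "(\<integral>\<^sup>+x. enn_powr (\<Sum>k. avg k (G k) x) s \<partial>M)
      \<le> ennreal (2 * s * (2 * s) powr (s - 1)) * (\<integral>\<^sup>+x. enn_powr (\<Sum>k. G k x) s \<partial>M)"
proof -
  \<comment> \<open>The indicator makes the sequence increasing at every point; monotonicity of
    these sums of averages is available only on \<open>space M\<close>.\<close>
  let ?u = "\<lambda>n x. ennreal (\<Sum>k<n. real_avg k (g n k) x) * indicator (space M) x"
  have "(\<integral>\<^sup>+x. enn_powr (\<Sum>k. avg k (G k) x) s \<partial>M) = (\<integral>\<^sup>+x. enn_powr (SUP n. ?u n x) s \<partial>M)"
    by (intro nn_integral_cong) (simp add: SUP_suminf_avg_trunc)
  also have "\<dots> = (SUP n. \<integral>\<^sup>+x. enn_powr (?u n x) s \<partial>M)"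
  proof (rule nn_integral_enn_powr_SUP)
    show "incseq (\<lambda>n. ?u n x)" for x
      using incseq_suminf_avg_trunc[of x] by (auto simp: incseq_def indicator_def)
  qed (use s in auto)
  also have "\<dots> \<le> ennreal (2 * s * (2 * s) powr (s - 1)) * (\<integral>\<^sup>+x. enn_powr (\<Sum>k. G k x) s \<partial>M)"
  proof (rule SUP_least)
    fix n
    have "(\<integral>\<^sup>+x. enn_powr (?u n x) s \<partial>M) = (\<integral>\<^sup>+x. ennreal ((\<Sum>k<n. real_avg k (g n k) x) powr s) \<partial>M)"
      by (intro nn_integral_cong) (simp add: enn_powr_ennreal sum_nonneg real_avg_nonneg)
    also have "\<dots> \<le> ennreal (2 * s * (2 * s) powr (s - 1)) * (\<integral>\<^sup>+x. ennreal ((\<Sum>k<n. g n k x) powr s) \<partial>M)"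
      using s by (intro bounded_avg_upper[where c="real n"]) (auto simp: trunc(1,2))
    also have "(\<integral>\<^sup>+x. ennreal ((\<Sum>k<n. g n k x) powr s) \<partial>M) \<le> (\<integral>\<^sup>+x. enn_powr (\<Sum>k. G k x) s \<partial>M)"
    proof (intro nn_integral_mono)
      fix x
      have "ennreal ((\<Sum>k<n. g n k x) powr s) = enn_powr (ennreal (\<Sum>k<n. g n k x)) s"
        by (simp add: enn_powr_ennreal sum_nonneg trunc(1))
      also have "\<dots> \<le> enn_powr (\<Sum>k. G k x) s"
        unfolding SUP_suminf_trunc[symmetric] using s by (intro enn_powr_mono SUP_upper) auto
      finally show "ennreal ((\<Sum>k<n. g n k x) powr s) \<le> enn_powr (\<Sum>k. G k x) s" .
    qed
    finally show "(\<integral>\<^sup>+x. enn_powr (?u n x) s \<partial>M) \<le> ennreal (2 * s * (2 * s) powr (s - 1)) * (\<integral>\<^sup>+x. enn_powr (\<Sum>k. G k x) s \<partial>M)"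
      by (simp add: mult_left_mono)
  qed
  finally show ?thesis .
qed

text \<open>The added constant \<epsilon> costs a multiple of \<epsilon>^s times the total mass,
  which is finite; \<open>enn_powr_add_le\<close> splits it off at the price of the factor 2^s, and
  it is then made smaller than any e > 0.\<close>

lemma suminf_avg_lower:
  assumes s: "0 < s" "s < 1"
  shows "(\<integral>\<^sup>+x. enn_powr (\<Sum>k. G k x) s \<partial>M)
      \<le> ennreal ((1 + 1 / s) * 2 powr s) * (\<integral>\<^sup>+x. enn_powr (\<Sum>k. avg k (G k) x) s \<partial>M)"
proof -
  define C where "C = (1 + 1 / s) * 2 powr s"
  have C: "0 < C" using s by (auto simp: C_def intro!: mult_pos_pos add_pos_pos)
  let ?B = "\<integral>\<^sup>+x. enn_powr (\<Sum>k. avg k (G k) x) s \<partial>M"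
  have bound: "(\<integral>\<^sup>+x. ennreal ((\<Sum>k<n. g n k x) powr s) \<partial>M) \<le> ennreal C * ?B" for n
  proof (rule ennreal_le_epsilon)
    fix e :: real assume e: "0 < e"
    define V where "V = measure M (space M)"
    have V: "emeasure M (space M) = ennreal V" "0 \<le> V"
      by (simp_all add: V_def emeasure_eq_measure)
    \<comment> \<open>With this choice C \<epsilon>^s V = e V / (1 + V) \<le> e; the summand 1 keeps
      the denominator positive when V = 0.\<close>
    define \<epsilon> where "\<epsilon> = (e / (C * (1 + V))) powr (1 / s)"
    have \<epsilon>: "0 < \<epsilon>" using e C V(2) by (simp add: \<epsilon>_def)
    have "\<epsilon> powr s = e / (C * (1 + V))"
      using e C V(2) s by (simp add: \<epsilon>_def powr_powr)
    then have le: "C * (\<epsilon> powr s * V) \<le> e"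
    proof -
      assume "\<epsilon> powr s = e / (C * (1 + V))"
      then have "C * (\<epsilon> powr s * V) = e * (V / (1 + V))"
        using C V(2) by simp
      also have "\<dots> \<le> e"
        using e V(2) by (intro mult_left_le) (auto simp: field_simps)
      finally show ?thesis .
    qed
    have "(\<integral>\<^sup>+x. ennreal ((\<Sum>k<n. g n k x) powr s) \<partial>M)
       \<le> ennreal (1 + 1 / s) * (\<integral>\<^sup>+x. ennreal ((\<epsilon> + (\<Sum>k<n. real_avg k (g n k) x)) powr s) \<partial>M)"
      using s \<epsilon> by (intro bounded_avg_lower[where c="real n"]) (auto simp: trunc(1,2))
    also have "(\<integral>\<^sup>+x. ennreal ((\<epsilon> + (\<Sum>k<n. real_avg k (g n k) x)) powr s) \<partial>M)
      \<le> (\<integral>\<^sup>+x. ennreal (2 powr s) * (ennreal (\<epsilon> powr s) + enn_powr (\<Sum>k. avg k (G k) x) s) \<partial>M)"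
    proof (intro nn_integral_mono)
      fix x assume x: "x \<in> space M"
      let ?b = "\<Sum>k<n. real_avg k (g n k) x"
      have b: "0 \<le> ?b" by (simp add: sum_nonneg real_avg_nonneg)
      have "ennreal ((\<epsilon> + ?b) powr s) = enn_powr (ennreal \<epsilon> + ennreal ?b) s"
        using \<epsilon> b by (simp add: enn_powr_ennreal ennreal_plus[symmetric] del: ennreal_plus)
      also have "\<dots> \<le> ennreal (2 powr s) * (enn_powr (ennreal \<epsilon>) s + enn_powr (ennreal ?b) s)"
        using s by (intro enn_powr_add_le)
      also have "\<dots> \<le> ennreal (2 powr s) * (ennreal (\<epsilon> powr s) + enn_powr (\<Sum>k. avg k (G k) x) s)"
        unfolding SUP_suminf_avg_trunc[OF x, symmetric] using s \<epsilon>
        by (intro mult_left_mono add_mono enn_powr_mono SUP_upper) (auto simp: enn_powr_ennreal)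
      finally show "ennreal ((\<epsilon> + ?b) powr s) \<le> ennreal (2 powr s) * (ennreal (\<epsilon> powr s) + enn_powr (\<Sum>k. avg k (G k) x) s)" .
    qed
    also have "\<dots> = ennreal (2 powr s) * (ennreal (\<epsilon> powr s * V) + ?B)"
      by (simp add: nn_integral_cmult nn_integral_add V ennreal_mult')
    also have "ennreal (1 + 1 / s) * \<dots> = ennreal C * (ennreal (\<epsilon> powr s * V) + ?B)"
      using s by (simp add: C_def ennreal_mult' mult.assoc)
    also have "\<dots> = ennreal C * ?B + ennreal (C * (\<epsilon> powr s * V))"
      using C V(2) by (simp add: distrib_left ennreal_mult' add.commute)
    also have "\<dots> \<le> ennreal C * ?B + ennreal e"
      using le by (intro add_left_mono ennreal_leI)
    finally show "(\<integral>\<^sup>+x. ennreal ((\<Sum>k<n. g n k x) powr s) \<partial>M) \<le> ennreal C * ?B + ennreal e"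
      by (simp add: mult_left_mono)
  qed
  have "(\<integral>\<^sup>+x. enn_powr (\<Sum>k. G k x) s \<partial>M) = (SUP n. \<integral>\<^sup>+x. enn_powr (ennreal (\<Sum>k<n. g n k x)) s \<partial>M)"
    unfolding SUP_suminf_trunc[symmetric]
    using s incseq_suminf_trunc by (intro nn_integral_enn_powr_SUP) auto
  also have "\<dots> = (SUP n. \<integral>\<^sup>+x. ennreal ((\<Sum>k<n. g n k x) powr s) \<partial>M)"
    by (simp add: enn_powr_ennreal sum_nonneg trunc(1))
  also have "\<dots> \<le> ennreal C * ?B"
    by (intro SUP_least bound)
  finally show ?thesis by (simp add: C_def)
qed

end

end

section \<open>Dyadic kernels on the circle\<close>

context refining_averages
begin

context
  fixes N :: "'b measure" and \<kappa> :: "'b \<Rightarrow> nat" and u :: "'b \<Rightarrow> 'a \<Rightarrow> ennreal"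
  assumes N: "sigma_finite_measure N"
    and \<kappa>[measurable]: "\<kappa> \<in> N \<rightarrow>\<^sub>M count_space UNIV"
    and u: "(\<lambda>(r, y). u r y) \<in> borel_measurable (N \<Otimes>\<^sub>M M)"
begin

lemma u_measurable [measurable (raw)]:
  assumes [measurable]: "f \<in> L \<rightarrow>\<^sub>M N" "g \<in> L \<rightarrow>\<^sub>M M"
  shows "(\<lambda>x. u (f x) (g x)) \<in> borel_measurable L"
  using measurable_compose[OF _ u, of "\<lambda>x. (f x, g x)" L] by simp

text \<open>The level takes countably many values, so measurability can be checked with the level
  fixed.\<close>

lemma K_level_measurable [measurable (raw)]:
  assumes [measurable]: "f \<in> L \<rightarrow>\<^sub>M N" "g \<in> L \<rightarrow>\<^sub>M M" "h \<in> L \<rightarrow>\<^sub>M M"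
  shows "(\<lambda>x. K (\<kappa> (f x)) (g x) (h x)) \<in> borel_measurable L"
  by (rule measurable_compose_countable[where f="\<lambda>k x. K k (g x) (h x)"]) measurable

text \<open>Grouping the parameters r by their level turns an integral in which the averaging level
  depends on r into a sum with one function per level.\<close>

definition layer :: "nat \<Rightarrow> 'a \<Rightarrow> ennreal" where
  "layer k y = (\<integral>\<^sup>+r. (if \<kappa> r = k then u r y else 0) \<partial>N)"

lemma borel_measurable_layer [measurable]: "layer k \<in> borel_measurable M"
proof -
  interpret N: sigma_finite_measure N by (rule N)
  show ?thesis unfolding layer_def[abs_def] by measurable
qed

lemma suminf_level: "(\<Sum>k. if n = k then c k else 0) = (c n :: ennreal)"
proof -
  have "(\<Sum>k. if n = k then c k else 0) = (\<Sum>k\<in>{n}. if n = k then c k else 0)"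
    by (rule suminf_finite) auto
  then show ?thesis by simp
qed

lemma suminf_layer:
  assumes [measurable]: "y \<in> space M"
  shows "(\<Sum>k. layer k y) = (\<integral>\<^sup>+r. u r y \<partial>N)"
  unfolding layer_def
  by (subst nn_integral_suminf[symmetric]) (simp_all add: suminf_level)

text \<open>Tonelli on each layer; every r belongs to exactly one layer, so summation over k
  restores the integral with level \<open>\<kappa> r\<close>.\<close>

lemma suminf_avg_layer:
  assumes [measurable]: "x \<in> space M"
  shows "(\<Sum>k. avg k (layer k) x) = (\<integral>\<^sup>+r. \<integral>\<^sup>+y. K (\<kappa> r) x y * u r y \<partial>M \<partial>N)"
proof -
  interpret N: sigma_finite_measure N by (rule N)
  interpret P: pair_sigma_finite N M ..
  have "avg k (layer k) x = (\<integral>\<^sup>+r. (if \<kappa> r = k then \<integral>\<^sup>+y. K k x y * u r y \<partial>M else 0) \<partial>N)" for k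
  proof -
    have "avg k (layer k) x = (\<integral>\<^sup>+y. \<integral>\<^sup>+r. K k x y * (if \<kappa> r = k then u r y else 0) \<partial>N \<partial>M)"
      unfolding avg_def layer_def by (intro nn_integral_cong nn_integral_cmult[symmetric]) measurable
    also have "\<dots> = (\<integral>\<^sup>+r. \<integral>\<^sup>+y. K k x y * (if \<kappa> r = k then u r y else 0) \<partial>M \<partial>N)"
      by (rule P.Fubini') measurable
    also have "\<dots> = (\<integral>\<^sup>+r. (if \<kappa> r = k then \<integral>\<^sup>+y. K k x y * u r y \<partial>M else 0) \<partial>N)"
      by (intro nn_integral_cong) simp
    finally show ?thesis .
  qed
  then show ?thesis
    by (simp only:) (subst nn_integral_suminf[symmetric], simp_all add: suminf_level)
qed

lemma nn_integral_layers_upper: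
  assumes "1 < s"
  shows "(\<integral>\<^sup>+x. enn_powr (\<integral>\<^sup>+r. \<integral>\<^sup>+y. K (\<kappa> r) x y * u r y \<partial>M \<partial>N) s \<partial>M)
      \<le> ennreal (2 * s * (2 * s) powr (s - 1)) * (\<integral>\<^sup>+x. enn_powr (\<integral>\<^sup>+r. u r x \<partial>N) s \<partial>M)"
  using suminf_avg_upper[of layer s, OF borel_measurable_layer assms]
  by (simp add: suminf_avg_layer suminf_layer cong: nn_integral_cong)

lemma nn_integral_layers_lower:
  assumes "0 < s" "s < 1"
  shows "(\<integral>\<^sup>+x. enn_powr (\<integral>\<^sup>+r. u r x \<partial>N) s \<partial>M)
      \<le> ennreal ((1 + 1 / s) * 2 powr s) * (\<integral>\<^sup>+x. enn_powr (\<integral>\<^sup>+r. \<integral>\<^sup>+y. K (\<kappa> r) x y * u r y \<partial>M \<partial>N) s \<partial>M)"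
  using suminf_avg_lower[of layer s, OF borel_measurable_layer assms]
  by (simp add: suminf_avg_layer suminf_layer cong: nn_integral_cong)

end

end

section \<open>Dyadic cells of the circle\<close>

text \<open>The circle is R modulo 1, cut into 2^k arcs whose indices count modulo 2^k. No
  representative in a fixed period has to be chosen, so shifted grids need no separate
  treatment.\<close>

definition same_cell :: "nat \<Rightarrow> real \<Rightarrow> real \<Rightarrow> bool" where
  "same_cell k x y \<longleftrightarrow> (2::int) ^ k dvd \<lfloor>2 ^ k * x\<rfloor> - \<lfloor>2 ^ k * y\<rfloor>"

lemma same_cell_commute: "same_cell k x y \<longleftrightarrow> same_cell k y x"
  unfolding same_cell_def by (rule dvd_diff_commute)

lemma same_cell_trans: "same_cell k x y \<Longrightarrow> same_cell k y z \<Longrightarrow> same_cell k x z"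
  unfolding same_cell_def using dvd_add by fastforce

lemma floor_add_period: "\<lfloor>2 ^ k * (x + of_int m)\<rfloor> = \<lfloor>2 ^ k * x\<rfloor> + 2 ^ k * m"
proof -
  have "2 ^ k * (x + of_int m) = 2 ^ k * x + of_int (2 ^ k * m)" by (simp add: algebra_simps)
  then show ?thesis by (simp only: floor_add_int)
qed

lemma same_cell_iff_ex: "same_cell k x y \<longleftrightarrow> (\<exists>m::int. \<lfloor>2 ^ k * x\<rfloor> = \<lfloor>2 ^ k * (y + of_int m)\<rfloor>)"
  unfolding floor_add_period same_cell_def by (auto simp: dvd_def algebra_simps)

lemma same_cell_add_int: "same_cell k x (y + of_int m) \<longleftrightarrow> same_cell k x y"
proof -
  have "\<lfloor>2 ^ k * x\<rfloor> - \<lfloor>2 ^ k * (y + of_int m)\<rfloor> = \<lfloor>2 ^ k * x\<rfloor> - \<lfloor>2 ^ k * y\<rfloor> - 2 ^ k * m"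
    unfolding floor_add_period by simp
  then show ?thesis
    unfolding same_cell_def by (simp only: dvd_diff_left_iff[OF dvd_triv_left])
qed

text \<open>The index at level j is the index at level k divided by 2^(k-j) and rounded down. An
  integer translation turns the congruence of indices into an equality, which this division
  preserves.\<close>

lemma same_cell_mono:
  assumes "same_cell k x y" "j \<le> k"
  shows "same_cell j x y"
proof -
  have *: "\<lfloor>2 ^ j * z\<rfloor> = \<lfloor>2 ^ k * z\<rfloor> div 2 ^ (k - j)" for z :: real
  proof -
    have "(2::real) ^ k = 2 ^ j * 2 ^ (k - j)"
      using assms(2) by (simp flip: power_add)
    then have eq: "2 ^ j * z = 2 ^ k * z / of_int (2 ^ (k - j))"
      by simp
    show ?thesis unfolding eq by (rule floor_divide_real_eq_div) simp
  qed
  obtain m where "\<lfloor>2 ^ k * x\<rfloor> = \<lfloor>2 ^ k * (y + of_int m)\<rfloor>"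
    using assms(1) same_cell_iff_ex by auto
  then have "\<lfloor>2 ^ j * x\<rfloor> = \<lfloor>2 ^ j * (y + of_int m)\<rfloor>"
    unfolding * by simp
  then show ?thesis using same_cell_iff_ex by auto
qed

lemma same_cell_measurable [measurable]:
  assumes [measurable]: "f \<in> borel_measurable M" "g \<in> borel_measurable M"
  shows "Measurable.pred M (\<lambda>x. same_cell k (f x) (g x))"
proof -
  have "same_cell k (f x) (g x) \<longleftrightarrow>
    (\<exists>m::int. real_of_int \<lfloor>2 ^ k * f x\<rfloor> = real_of_int \<lfloor>2 ^ k * (g x + of_int m)\<rfloor>)" for x
    by (simp add: same_cell_iff_ex)
  then show ?thesis by simp
qed

text \<open>The one-third trick: an interval of length less than a third of the mesh cannot contain
  both a point of \<open>2\<^sup>-\<^sup>k \<int>\<close> and a point of \<open>2\<^sup>-\<^sup>k \<int> - 1/3\<close>, because \<open>3\<close> does not divide \<open>2\<^sup>k\<close>.\<close>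

lemma same_cell_one_third:
  fixes x y :: real
  assumes "3 * 2 ^ k * \<bar>x - y\<bar> < 1"
  shows "same_cell k x y \<or> same_cell k (x + 1/3) (y + 1/3)"
proof -
  have main: "\<lfloor>2 ^ k * x\<rfloor> = \<lfloor>2 ^ k * y\<rfloor> \<or> \<lfloor>2 ^ k * (x + 1/3)\<rfloor> = \<lfloor>2 ^ k * (y + 1/3)\<rfloor>"
    if "x \<le> y" "3 * 2 ^ k * (y - x) < 1" for x y :: real
  proof (rule ccontr)
    assume neg: "\<not> ?thesis"
    have le: "2 ^ k * x \<le> 2 ^ k * y" "2 ^ k * (x + 1/3) \<le> 2 ^ k * (y + 1/3)"
      using \<open>x \<le> y\<close> by (auto intro!: mult_left_mono)
    define n where "n = \<lfloor>2 ^ k * y\<rfloor>"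
    define n' where "n' = \<lfloor>2 ^ k * (y + 1/3)\<rfloor>"
    have "\<lfloor>2 ^ k * x\<rfloor> < n" "\<lfloor>2 ^ k * (x + 1/3)\<rfloor> < n'"
      using neg floor_mono[OF le(1)] floor_mono[OF le(2)] by (auto simp: n_def n'_def)
    then have 1: "2 ^ k * x < of_int n" "2 ^ k * (x + 1/3) < of_int n'"
      by (auto simp: floor_less_iff)
    have 2: "of_int n \<le> 2 ^ k * y" "of_int n' \<le> 2 ^ k * (y + 1/3)"
      by (auto simp: n_def n'_def)
    have "\<bar>3 * (of_int n' - of_int n) - 2 ^ k\<bar> < (1::real)"
      using 1 2 that(2) by (simp add: algebra_simps abs_less_iff)
    moreover have "3 * (of_int n' - of_int n) - 2 ^ k = real_of_int (3 * (n' - n) - 2 ^ k)"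
      by simp
    ultimately have "\<bar>real_of_int (3 * (n' - n) - 2 ^ k)\<bar> < 1"
      by (simp only:)
    then have "3 * (n' - n) - 2 ^ k = 0" by linarith
    then have "(3::int) dvd 2 ^ k" by (metis dvd_triv_left eq_iff_diff_eq_0)
    then have "(3::int) dvd 2" by (rule prime_dvd_power[rotated]) simp
    then show False by simp
  qed
  have *: "\<lfloor>2 ^ k * a\<rfloor> = \<lfloor>2 ^ k * b\<rfloor> \<Longrightarrow> same_cell k a b" for a b :: real
    by (simp add: same_cell_def)
  show ?thesis
  proof (cases "x \<le> y")
    case True then show ?thesis using main[of x y] assms * by auto
  next
    case False then show ?thesis using main[of y x] assms *[of x y] *[of "x+1/3" "y+1/3"] by auto
  qed
qed

definition circle_measure :: "real measure" where
  "circle_measure = restrict_space lborel {0..<2 * pi}"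

text \<open>The grid is shifted by the fraction \<open>a\<close> of the period. Cells have length 2
  \<pi> / 2^k; the height is the reciprocal, for total mass 1.\<close>

definition dyadic_kernel :: "real \<Rightarrow> nat \<Rightarrow> real \<Rightarrow> real \<Rightarrow> ennreal" where
  "dyadic_kernel a k x y =
    (if same_cell k (x / (2 * pi) + a) (y / (2 * pi) + a) then ennreal (2 ^ k / (2 * pi)) else 0)"

lemma nn_integral_circle:
  "(\<integral>\<^sup>+t. f t \<partial>circle_measure) = (\<integral>\<^sup>+t. f t * indicator {0..<2 * pi} t \<partial>lborel)"
  unfolding circle_measure_def by (rule nn_integral_restrict_space) simp

lemma finite_measure_circle: "finite_measure circle_measure"
  by (rule finite_measureI) (simp add: circle_measure_def emeasure_restrict_space)

lemma space_circle [simp]: "space circle_measure = {0..<2 * pi}"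
  by (simp add: circle_measure_def space_restrict_space)

lemma borel_measurable_circle:
  "f \<in> borel_measurable borel \<Longrightarrow> f \<in> borel_measurable circle_measure"
  unfolding circle_measure_def by (rule measurable_restrict_space1) simp

lemma id_circle_measurable: "(\<lambda>x. x) \<in> borel_measurable circle_measure"
  unfolding circle_measure_def by (rule measurable_restrict_space1) simp

lemma borel_measurable_circleI [measurable_dest]:
  "f \<in> L \<rightarrow>\<^sub>M circle_measure \<Longrightarrow> f \<in> borel_measurable L"
  using measurable_compose[OF _ id_circle_measurable] by blast

text \<open>Within one period a cell of the unshifted grid is a single half-open interval; reducing
  the index of X modulo 2^k finds it.\<close>

lemma same_cell_set:
  fixes t X :: real and k :: nat
  assumes t: "0 \<le> t" "t < 2 * pi"
  defines "j \<equiv> \<lfloor>2 ^ k * X\<rfloor> mod 2 ^ k"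
  shows "same_cell k X (t / (2 * pi)) \<longleftrightarrow> t \<in> {2 * pi * of_int j / 2 ^ k ..< 2 * pi * (of_int j + 1) / 2 ^ k}"
proof -
  define n where "n = \<lfloor>2 ^ k * (t / (2 * pi))\<rfloor>"
  have "0 \<le> 2 ^ k * (t / (2 * pi))" "2 ^ k * (t / (2 * pi)) < 2 ^ k"
    using t by (auto simp: field_simps)
  then have n: "0 \<le> n" "n < 2 ^ k"
    by (auto simp: n_def floor_less_iff)
  have "same_cell k X (t / (2 * pi)) \<longleftrightarrow> \<lfloor>2 ^ k * X\<rfloor> mod 2 ^ k = n mod 2 ^ k"
    by (simp add: same_cell_def n_def mod_eq_dvd_iff)
  also have "\<dots> \<longleftrightarrow> n = j"
    using n by (auto simp: j_def)
  also have "\<dots> \<longleftrightarrow> of_int j \<le> 2 ^ k * (t / (2 * pi)) \<and> 2 ^ k * (t / (2 * pi)) < of_int j + 1"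
    unfolding n_def by (rule floor_eq_iff)
  also have "\<dots> \<longleftrightarrow> t \<in> {2 * pi * of_int j / 2 ^ k ..< 2 * pi * (of_int j + 1) / 2 ^ k}"
    by (auto simp: field_simps)
  finally show ?thesis .
qed

text \<open>Periodicity removes the shift from the variable of integration; the cell is then one of
  the 2^k intervals that tile the period.\<close>

lemma nn_integral_dyadic_kernel:
  assumes a: "\<bar>a\<bar> < 1"
  shows "(\<integral>\<^sup>+y. dyadic_kernel a k x y \<partial>circle_measure) = 1"
proof -
  define X where "X = x / (2 * pi) + a"
  define h where "h t = (if same_cell k X (t / (2 * pi)) then ennreal (2 ^ k / (2 * pi)) else 0)" for t :: real
  have [measurable]: "h \<in> borel_measurable borel" unfolding h_def by measurable
  have per: "h (t + 2 * pi) = h t" for t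
    using same_cell_add_int[of k X "t / (2 * pi)" 1] by (simp add: h_def add_divide_distrib)
  define j where "j = \<lfloor>2 ^ k * X\<rfloor> mod 2 ^ k"
  have "j < 2 ^ k" unfolding j_def by (rule pos_mod_bound) simp
  then have "j + 1 \<le> 2 ^ k" by linarith
  moreover have "0 \<le> j" by (simp add: j_def)
  ultimately have j: "0 \<le> j" "j + 1 \<le> 2 ^ k" by simp_all
  then have "real_of_int (j + 1) \<le> real_of_int (2 ^ k)" by (subst of_int_le_iff)
  then have j': "of_int j + 1 \<le> (2::real) ^ k" by simp
  let ?l = "2 * pi * of_int j / 2 ^ k" and ?u = "2 * pi * (of_int j + 1) / 2 ^ k"
  have sub: "{?l..<?u} \<subseteq> {0..<2 * pi}"
  proof -
    have "2 * pi * (of_int j + 1) \<le> 2 * pi * 2 ^ k" using j' by (intro mult_left_mono) auto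
    then have "?u \<le> 2 * pi" by (simp add: pos_divide_le_eq)
    moreover have "0 \<le> ?l" using j by simp
    ultimately show ?thesis by auto
  qed
  have lu: "?l \<le> ?u" "?u - ?l = 2 * pi / 2 ^ k" by (auto simp: field_simps)
  have "(\<integral>\<^sup>+y. dyadic_kernel a k x y \<partial>circle_measure) = (\<integral>\<^sup>+y. h (y + 2 * pi * a) * indicator {0..<2 * pi} y \<partial>lborel)"
    by (simp add: nn_integral_circle dyadic_kernel_def h_def X_def add_divide_distrib)
  also have "\<dots> = (\<integral>\<^sup>+y. h y * indicator {0..<2 * pi} y \<partial>lborel)"
    using a by (intro nn_integral_periodic) (auto simp: per abs_mult)
  also have "\<dots> = (\<integral>\<^sup>+y. ennreal (2 ^ k / (2 * pi)) * indicator {?l..<?u} y \<partial>lborel)"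
  proof (intro nn_integral_cong)
    fix y :: real
    show "h y * indicator {0..<2 * pi} y = ennreal (2 ^ k / (2 * pi)) * indicator {?l..<?u} y"
    proof (cases "y \<in> {0..<2 * pi}")
      case True
      then show ?thesis
        using same_cell_set[of y k X] by (simp add: h_def j_def[symmetric] indicator_def)
    next
      case False
      then have "y \<notin> {?l..<?u}" using sub by blast
      then show ?thesis using False by (metis indicator_simps(2) mult_zero_right)
    qed
  qed
  also have "\<dots> = ennreal (2 ^ k / (2 * pi)) * ennreal (2 * pi / 2 ^ k)"
    by (subst nn_integral_cmult_indicator) (simp_all add: lu)
  also have "\<dots> = 1"
    by (subst ennreal_mult'[symmetric]) auto
  finally show ?thesis .
qed

text \<open>The offset m makes every grid m levels finer: m = 0 for cells that cover windows, m = 3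
  for cells that fit inside them.\<close>

lemma refining_averages_dyadic:
  assumes "\<bar>a\<bar> < 1"
  shows "refining_averages circle_measure (\<lambda>k. dyadic_kernel a (k + m))"
proof -
  note id_circle_measurable [measurable]
  interpret finite_measure circle_measure by (rule finite_measure_circle)
  show ?thesis
  proof
    show "(\<lambda>(x, y). dyadic_kernel a (k + m) x y) \<in> borel_measurable (circle_measure \<Otimes>\<^sub>M circle_measure)" for k
      unfolding dyadic_kernel_def by measurable
    show "dyadic_kernel a (k + m) x y = dyadic_kernel a (k + m) y x" for k x y
      by (simp add: dyadic_kernel_def same_cell_commute)
    show "(\<integral>\<^sup>+y. dyadic_kernel a (k + m) x y \<partial>circle_measure) = 1" for k x
      by (rule nn_integral_dyadic_kernel[OF assms])
    show "dyadic_kernel a (j + m) x z = dyadic_kernel a (j + m) y z"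
      if "dyadic_kernel a (k + m) x y \<noteq> 0" "j \<le> k" for k x y j z
    proof -
      have "same_cell (j + m) (x / (2 * pi) + a) (y / (2 * pi) + a)"
        using that same_cell_mono[of "k + m" _ _ "j + m"] by (auto simp: dyadic_kernel_def split: if_splits)
      then show ?thesis
        unfolding dyadic_kernel_def by (metis same_cell_commute same_cell_trans)
    qed
  qed
qed

section \<open>Windows and dyadic cells\<close>

text \<open>The angles y at which the circle of radius r meets the approach region with vertex
  \<open>cis t\<close>; see \<open>rcis_in_approach_region_iff\<close>.\<close>

definition window :: "real \<Rightarrow> real \<Rightarrow> real \<Rightarrow> bool" where
  "window r t y \<longleftrightarrow> (\<exists>k::int. \<bar>y - t + 2 * pi * of_int k\<bar> < 1 - r)"

lemma window_measurable [measurable]: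
  assumes [measurable]: "f \<in> borel_measurable M" "g \<in> borel_measurable M" "h \<in> borel_measurable M"
  shows "Measurable.pred M (\<lambda>x. window (f x) (g x) (h x))"
  unfolding window_def by measurable

text \<open>In units of the period, and up to an integer, t and y are closer than (1 - r) / (2
  \<pi>); the second assumption turns this into the hypothesis of the one-third trick.\<close>

lemma window_imp_same_cell:
  assumes "window r t y" "3 * 2 ^ k * (1 - r) \<le> 2 * pi"
  shows "same_cell k (t / (2 * pi)) (y / (2 * pi)) \<or> same_cell k (t / (2 * pi) + 1/3) (y / (2 * pi) + 1/3)"
proof -
  obtain m :: int where m: "\<bar>y - t + 2 * pi * of_int m\<bar> < 1 - r"
    using assms(1) by (auto simp: window_def)
  define y' where "y' = y / (2 * pi) + of_int m"
  have "2 * pi * \<bar>t / (2 * pi) - y'\<bar> = \<bar>2 * pi * (t / (2 * pi) - y')\<bar>"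
    by (simp add: abs_mult)
  also have "2 * pi * (t / (2 * pi) - y') = - (y - t + 2 * pi * of_int m)"
    by (simp add: y'_def field_simps)
  finally have "2 * pi * \<bar>t / (2 * pi) - y'\<bar> < 1 - r" using m by simp
  then have "3 * 2 ^ k * (2 * pi * \<bar>t / (2 * pi) - y'\<bar>) < 3 * 2 ^ k * (1 - r)"
    by simp
  also have "\<dots> \<le> 2 * pi" by fact
  finally have "2 * pi * (3 * 2 ^ k * \<bar>t / (2 * pi) - y'\<bar>) < 2 * pi * 1" by (simp add: mult_ac)
  then have "3 * 2 ^ k * \<bar>t / (2 * pi) - y'\<bar> < 1"
    by (subst (asm) mult_less_cancel_left_pos) auto
  from same_cell_one_third[OF this] show ?thesis
  proof
    assume "same_cell k (t / (2 * pi)) y'"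
    then show ?thesis by (simp add: y'_def same_cell_add_int)
  next
    assume "same_cell k (t / (2 * pi) + 1/3) (y' + 1/3)"
    moreover have "y' + 1/3 = (y / (2 * pi) + 1/3) + of_int m" by (simp add: y'_def)
    ultimately show ?thesis by (simp only: same_cell_add_int simp_thms)
  qed
qed

text \<open>Points of one half-open cell are closer than its length 2 \<pi> / 2^k, which is at most
  1 - r.\<close>

lemma same_cell_imp_window:
  assumes "same_cell k (t / (2 * pi)) (y / (2 * pi))" "2 * pi \<le> 2 ^ k * (1 - r)"
  shows "window r t y"
proof -
  obtain m :: int where m: "\<lfloor>2 ^ k * (t / (2 * pi))\<rfloor> = \<lfloor>2 ^ k * (y / (2 * pi) + of_int m)\<rfloor>"
    using assms(1) by (auto simp: same_cell_iff_ex)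
  then have "\<bar>2 ^ k * (y / (2 * pi) + of_int m) - 2 ^ k * (t / (2 * pi))\<bar> < 1" by linarith
  also have "2 ^ k * (y / (2 * pi) + of_int m) - 2 ^ k * (t / (2 * pi)) = 2 ^ k * (y - t + 2 * pi * of_int m) / (2 * pi)"
    by (simp add: field_simps)
  finally have "2 ^ k * \<bar>y - t + 2 * pi * of_int m\<bar> < 2 * pi"
    by (simp add: abs_mult)
  also have "\<dots> \<le> 2 ^ k * (1 - r)" by fact
  finally show ?thesis by (auto simp: window_def)
qed

text \<open>For 0 < r < 1 the largest k with 3 * 2^k * (1 - r) \<le> 2 \<pi>, that is, the finest
  grid to which the one-third trick applies at radius r.\<close>

definition level :: "real \<Rightarrow> nat" where
  "level r = nat \<lfloor>log 2 (2 * pi / (3 * (1 - r)))\<rfloor>"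

lemma level_measurable [measurable]: "level \<in> borel \<rightarrow>\<^sub>M count_space UNIV"
  unfolding level_def[abs_def] by measurable

lemma level_bounds:
  assumes r: "0 < r" "r < 1"
  shows "3 * 2 ^ level r * (1 - r) \<le> 2 * pi" "pi < 3 * 2 ^ level r * (1 - r)"
proof -
  define q where "q = 2 * pi / (3 * (1 - r))"
  \<comment> \<open>2 \<pi> > 3 makes the logarithm nonnegative, so that \<open>nat\<close> does not
    truncate.\<close>
  have "3 * (1 - r) \<le> 3" using r by simp
  also have "3 \<le> 2 * pi" using pi_gt3 by simp
  finally have "3 * (1 - r) \<le> 2 * pi" .
  then have q: "1 \<le> q" using r by (simp add: q_def field_simps)
  have qe: "q * (3 * (1 - r)) = 2 * pi" using r by (simp add: q_def)
  have f: "0 \<le> \<lfloor>log 2 q\<rfloor>" using q by simp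
  then have "real (level r) = of_int \<lfloor>log 2 q\<rfloor>" by (simp add: level_def q_def)
  then have l: "real (level r) \<le> log 2 q" "log 2 q < real (level r) + 1" by linarith+
  have "2 powr real (level r) \<le> q" using l(1) q by (simp add: le_log_iff)
  then have "2 ^ level r \<le> q" by (simp add: powr_realpow)
  then have "2 ^ level r * (3 * (1 - r)) \<le> q * (3 * (1 - r))" using r by (intro mult_right_mono) auto
  then show "3 * 2 ^ level r * (1 - r) \<le> 2 * pi" unfolding qe by (simp add: algebra_simps)
  have "q < 2 powr (real (level r) + 1)" using l(2) q by (simp add: log_less_iff)
  then have "q < 2 * 2 ^ level r" by (simp add: powr_add powr_realpow)
  then have "q * (3 * (1 - r)) < 2 * 2 ^ level r * (3 * (1 - r))" using r by (intro mult_strict_right_mono) auto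
  then show "pi < 3 * 2 ^ level r * (1 - r)" unfolding qe by (simp add: algebra_simps)
qed

text \<open>The height 1 / (1 - r) is the factor in the tent norm, not the reciprocal of the window
  length 2 (1 - r); the total mass is therefore 2.\<close>

definition window_kernel :: "real \<Rightarrow> real \<Rightarrow> real \<Rightarrow> ennreal" where
  "window_kernel r t y = (if window r t y then ennreal (1 / (1 - r)) else 0)"

lemma window_kernel_measurable [measurable]:
  assumes [measurable]: "f \<in> borel_measurable M" "g \<in> borel_measurable M" "h \<in> borel_measurable M"
  shows "(\<lambda>x. window_kernel (f x) (g x) (h x)) \<in> borel_measurable M"
  unfolding window_kernel_def by measurable

text \<open>The level is maximal, so the cells are not much longer than the window: \<pi> < 3 *
  2^level * (1 - r), with 3 rounded up to 4, gives the constant 8.\<close>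

lemma window_kernel_le:
  assumes r: "0 < r" "r < 1"
  shows "window_kernel r t y \<le> 8 * (dyadic_kernel 0 (level r) t y + dyadic_kernel (1/3) (level r) t y)"
proof (cases "window r t y")
  case True
  have "0 < 2 ^ level r * (1 - r)" using r by simp
  then have "pi \<le> 4 * (2 ^ level r * (1 - r))" using level_bounds[OF r] by linarith
  then have "1 / (1 - r) \<le> 8 * (2 ^ level r / (2 * pi))"
    using r by (simp add: field_simps)
  then have "ennreal (1 / (1 - r)) \<le> ennreal (8 * (2 ^ level r / (2 * pi)))"
    by (rule ennreal_leI)
  also have "\<dots> = 8 * ennreal (2 ^ level r / (2 * pi))"
    by (subst ennreal_mult') simp_all
  also have "\<dots> \<le> 8 * (dyadic_kernel 0 (level r) t y + dyadic_kernel (1/3) (level r) t y)"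
    using window_imp_same_cell[OF True level_bounds(1)[OF r]]
    by (intro mult_left_mono) (auto simp: dyadic_kernel_def)
  finally show ?thesis using True by (simp add: window_kernel_def)
qed (simp add: window_kernel_def)

text \<open>Three further halvings suffice: 8 * 2^level * (1 - r) exceeds 8 \<pi> / 3 > 2 \<pi>, so
  the cell lies in the window, and it is at most 16 \<pi> / 3 \<le> 6 \<pi>, which gives the
  constant 3.\<close>

lemma dyadic_kernel_le:
  assumes r: "0 < r" "r < 1"
  shows "dyadic_kernel 0 (level r + 3) t y \<le> 3 * window_kernel r t y"
proof (cases "same_cell (level r + 3) (t / (2 * pi)) (y / (2 * pi))")
  case True
  have pos: "0 < 2 ^ level r * (1 - r)" using r by simp
  have eq: "2 ^ (level r + 3) * (1 - r) = 8 * (2 ^ level r * (1 - r))"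
    by (simp add: power_add)
  then have "2 * pi \<le> 2 ^ (level r + 3) * (1 - r)"
    using level_bounds(2)[OF r] pos by linarith
  from same_cell_imp_window[OF True this] have W: "window r t y" .
  have "2 ^ (level r + 3) / (2 * pi) \<le> 3 * (1 / (1 - r))"
  proof -
    have "2 ^ (level r + 3) * (1 - r) \<le> 6 * pi"
      using level_bounds(1)[OF r] eq pi_gt_zero by linarith
    then show ?thesis using r by (simp add: field_simps)
  qed
  then have "ennreal (2 ^ (level r + 3) / (2 * pi)) \<le> ennreal (3 * (1 / (1 - r)))"
    by (rule ennreal_leI)
  also have "\<dots> = 3 * window_kernel r t y"
    using W by (subst ennreal_mult') (simp_all add: window_kernel_def)
  finally show ?thesis using True by (simp add: dyadic_kernel_def)
qed (simp add: dyadic_kernel_def)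

section \<open>Averages over windows\<close>

text \<open>The measure is dr and not r dr; the polar factor r is carried by the integrand
  \<open>u\<close>.\<close>

definition radius_measure :: "real measure" where
  "radius_measure = restrict_space lborel {0<..<1}"

lemma nn_integral_radius:
  "(\<integral>\<^sup>+r. f r \<partial>radius_measure) = (\<integral>\<^sup>+r. f r * indicator {0<..<1} r \<partial>lborel)"
  unfolding radius_measure_def by (rule nn_integral_restrict_space) simp

lemma space_radius [simp]: "space radius_measure = {0<..<1}"
  by (simp add: radius_measure_def space_restrict_space)

lemma finite_measure_radius: "finite_measure radius_measure"
  by (rule finite_measureI) (simp add: radius_measure_def emeasure_restrict_space)

lemma borel_measurable_radius:
  "f \<in> borel_measurable borel \<Longrightarrow> f \<in> borel_measurable radius_measure"
  unfolding radius_measure_def by (rule measurable_restrict_space1) simp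

lemma id_radius_measurable: "(\<lambda>x. x) \<in> borel_measurable radius_measure"
  unfolding radius_measure_def by (rule measurable_restrict_space1) simp

lemma borel_measurable_radiusI [measurable_dest]:
  "f \<in> L \<rightarrow>\<^sub>M radius_measure \<Longrightarrow> f \<in> borel_measurable L"
  using measurable_compose[OF _ id_radius_measurable] by blast

context
  fixes u :: "real \<Rightarrow> real \<Rightarrow> ennreal"
  assumes u: "(\<lambda>(r, y). u r y) \<in> borel_measurable (borel \<Otimes>\<^sub>M borel)"
begin

private lemma u_borel:
  assumes [measurable]: "f \<in> borel_measurable L" "g \<in> borel_measurable L"
  shows "(\<lambda>x. u (f x) (g x)) \<in> borel_measurable L"
  using measurable_compose[OF _ u, of "\<lambda>x. (f x, g x)" L] by simp

private lemma sigma_finite_radius: "sigma_finite_measure radius_measure"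
  using finite_measure_radius by (rule finite_measure.axioms)

private lemma level_radius: "level \<in> radius_measure \<rightarrow>\<^sub>M count_space UNIV"
  using measurable_compose[OF id_radius_measurable level_measurable] .

private lemma u_product: "(\<lambda>(r, y). u r y) \<in> borel_measurable (radius_measure \<Otimes>\<^sub>M circle_measure)"
proof -
  note u_borel [measurable (raw)] id_circle_measurable [measurable] id_radius_measurable [measurable]
  show ?thesis by measurable
qed

text \<open>The constant collects 8 from \<open>window_kernel_le\<close> and 2 from splitting a sum
  of two terms, both raised to s, and a factor 2 for the two grids.\<close>

lemma window_average_upper:
  assumes s: "1 < s"
  shows "(\<integral>\<^sup>+t. enn_powr (\<integral>\<^sup>+r. \<integral>\<^sup>+y. window_kernel r t y * u r y \<partial>circle_measure \<partial>radius_measure) s \<partial>circle_measure)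
    \<le> ennreal (16 powr s * (2 * (2 * s * (2 * s) powr (s - 1)))) * (\<integral>\<^sup>+t. enn_powr (\<integral>\<^sup>+r. u r t \<partial>radius_measure) s \<partial>circle_measure)"
proof -
  note u_borel [measurable (raw)] level_radius [measurable]
    id_circle_measurable [measurable] id_radius_measurable [measurable]
  interpret C: finite_measure circle_measure by (rule finite_measure_circle)
  interpret R: finite_measure radius_measure by (rule finite_measure_radius)
  define c where "c = 2 * s * (2 * s) powr (s - 1)"
  have c: "0 \<le> c" using s by (simp add: c_def)
  define E where "E a t = (\<integral>\<^sup>+r. \<integral>\<^sup>+y. dyadic_kernel a (level r) t y * u r y \<partial>circle_measure \<partial>radius_measure)" for a t
  have [measurable]: "(\<lambda>x. dyadic_kernel a (level (f x)) (g x) (h x)) \<in> borel_measurable L"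
    if [measurable]: "f \<in> borel_measurable L" "g \<in> borel_measurable L" "h \<in> borel_measurable L"
    for a f g h and L :: "'l measure"
    by (rule measurable_compose_countable[where f="\<lambda>k x. dyadic_kernel a k (g x) (h x)"])
       (unfold dyadic_kernel_def, measurable)
  let ?Y = "\<integral>\<^sup>+t. enn_powr (\<integral>\<^sup>+r. u r t \<partial>radius_measure) s \<partial>circle_measure"
  have [measurable]: "E a \<in> borel_measurable circle_measure" for a
    unfolding E_def[abs_def] by measurable
  have E: "(\<integral>\<^sup>+t. enn_powr (E a t) s \<partial>circle_measure) \<le> ennreal c * ?Y" if "\<bar>a\<bar> < 1" for a
    using refining_averages.nn_integral_layers_upper[OF refining_averages_dyadic[OF that, of 0]
        sigma_finite_radius level_radius u_product s]
    by (simp add: E_def c_def)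
  have "(\<integral>\<^sup>+t. enn_powr (\<integral>\<^sup>+r. \<integral>\<^sup>+y. window_kernel r t y * u r y \<partial>circle_measure \<partial>radius_measure) s \<partial>circle_measure)
    \<le> (\<integral>\<^sup>+t. ennreal (16 powr s) * (enn_powr (E 0 t) s + enn_powr (E (1/3) t) s) \<partial>circle_measure)"
  proof (intro nn_integral_mono)
    fix t
    have "(\<integral>\<^sup>+r. \<integral>\<^sup>+y. window_kernel r t y * u r y \<partial>circle_measure \<partial>radius_measure)
       \<le> (\<integral>\<^sup>+r. \<integral>\<^sup>+y. 8 * (dyadic_kernel 0 (level r) t y * u r y + dyadic_kernel (1/3) (level r) t y * u r y) \<partial>circle_measure \<partial>radius_measure)"
    proof (intro nn_integral_mono)
      fix r y assume "r \<in> space radius_measure"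
      then have "window_kernel r t y * u r y \<le> 8 * (dyadic_kernel 0 (level r) t y + dyadic_kernel (1/3) (level r) t y) * u r y"
        by (intro mult_right_mono window_kernel_le) auto
      then show "window_kernel r t y * u r y \<le> 8 * (dyadic_kernel 0 (level r) t y * u r y + dyadic_kernel (1/3) (level r) t y * u r y)"
        by (simp add: distrib_right mult.assoc)
    qed
    also have "\<dots> = ennreal 8 * (E 0 t + E (1/3) t)"
      unfolding E_def by (simp add: nn_integral_add nn_integral_cmult)
    finally have "enn_powr (\<integral>\<^sup>+r. \<integral>\<^sup>+y. window_kernel r t y * u r y \<partial>circle_measure \<partial>radius_measure) s
      \<le> enn_powr (ennreal 8 * (E 0 t + E (1/3) t)) s"
      using s by (intro enn_powr_mono) auto
    also have "\<dots> = ennreal (8 powr s) * enn_powr (E 0 t + E (1/3) t) s"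
      using s by (simp add: enn_powr_mult enn_powr_ennreal del: ennreal_numeral)
    also have "\<dots> \<le> ennreal (8 powr s) * (ennreal (2 powr s) * (enn_powr (E 0 t) s + enn_powr (E (1/3) t) s))"
      using s by (intro mult_left_mono enn_powr_add_le) auto
    also have "\<dots> = ennreal (16 powr s) * (enn_powr (E 0 t) s + enn_powr (E (1/3) t) s)"
      by (simp add: mult.assoc[symmetric] ennreal_mult'[symmetric] powr_mult[symmetric])
    finally show "enn_powr (\<integral>\<^sup>+r. \<integral>\<^sup>+y. window_kernel r t y * u r y \<partial>circle_measure \<partial>radius_measure) s
       \<le> ennreal (16 powr s) * (enn_powr (E 0 t) s + enn_powr (E (1/3) t) s)" .
  qed
  also have "\<dots> = ennreal (16 powr s) * ((\<integral>\<^sup>+t. enn_powr (E 0 t) s \<partial>circle_measure) + (\<integral>\<^sup>+t. enn_powr (E (1/3) t) s \<partial>circle_measure))"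
    by (simp add: nn_integral_cmult nn_integral_add)
  also have "\<dots> \<le> ennreal (16 powr s) * (ennreal c * ?Y + ennreal c * ?Y)"
    by (intro mult_left_mono add_mono E) auto
  also have "\<dots> = ennreal (16 powr s * (2 * c)) * ?Y"
    using c by (simp add: ennreal_mult' mult_2[symmetric] mult.assoc)
  finally show ?thesis unfolding c_def .
qed

text \<open>A single grid suffices, as only a cell inside the window is needed; an average over it
  is at most 3 times the integral against \<open>window_kernel\<close>.\<close>

lemma window_average_lower:
  assumes s: "0 < s" "s < 1"
  shows "(\<integral>\<^sup>+t. enn_powr (\<integral>\<^sup>+r. u r t \<partial>radius_measure) s \<partial>circle_measure)
    \<le> ennreal ((1 + 1 / s) * 2 powr s * 3 powr s) *
      (\<integral>\<^sup>+t. enn_powr (\<integral>\<^sup>+r. \<integral>\<^sup>+y. window_kernel r t y * u r y \<partial>circle_measure \<partial>radius_measure) s \<partial>circle_measure)"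
proof -
  note u_borel [measurable (raw)] level_radius [measurable]
    id_circle_measurable [measurable] id_radius_measurable [measurable]
  interpret C: finite_measure circle_measure by (rule finite_measure_circle)
  interpret R: finite_measure radius_measure by (rule finite_measure_radius)
  define c where "c = (1 + 1 / s) * 2 powr s"
  have c: "0 \<le> c" using s by (simp add: c_def)
  let ?A = "\<lambda>t. \<integral>\<^sup>+r. \<integral>\<^sup>+y. window_kernel r t y * u r y \<partial>circle_measure \<partial>radius_measure"
  have "(\<integral>\<^sup>+t. enn_powr (\<integral>\<^sup>+r. u r t \<partial>radius_measure) s \<partial>circle_measure)
    \<le> ennreal c * (\<integral>\<^sup>+t. enn_powr (\<integral>\<^sup>+r. \<integral>\<^sup>+y. dyadic_kernel 0 (level r + 3) t y * u r y \<partial>circle_measure \<partial>radius_measure) s \<partial>circle_measure)"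
    using refining_averages.nn_integral_layers_lower[OF refining_averages_dyadic[of 0 3]
        sigma_finite_radius level_radius u_product s]
    by (simp add: c_def)
  also have "(\<integral>\<^sup>+t. enn_powr (\<integral>\<^sup>+r. \<integral>\<^sup>+y. dyadic_kernel 0 (level r + 3) t y * u r y \<partial>circle_measure \<partial>radius_measure) s \<partial>circle_measure)
     \<le> (\<integral>\<^sup>+t. ennreal (3 powr s) * enn_powr (?A t) s \<partial>circle_measure)"
  proof (intro nn_integral_mono)
    fix t
    have "(\<integral>\<^sup>+r. \<integral>\<^sup>+y. dyadic_kernel 0 (level r + 3) t y * u r y \<partial>circle_measure \<partial>radius_measure)
       \<le> (\<integral>\<^sup>+r. \<integral>\<^sup>+y. 3 * (window_kernel r t y * u r y) \<partial>circle_measure \<partial>radius_measure)"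
    proof (intro nn_integral_mono)
      fix r y assume "r \<in> space radius_measure"
      then have "dyadic_kernel 0 (level r + 3) t y * u r y \<le> 3 * window_kernel r t y * u r y"
        by (intro mult_right_mono dyadic_kernel_le) auto
      then show "dyadic_kernel 0 (level r + 3) t y * u r y \<le> 3 * (window_kernel r t y * u r y)"
        by (simp add: mult.assoc)
    qed
    also have "\<dots> = ennreal 3 * ?A t"
      by (simp add: nn_integral_cmult)
    finally have "enn_powr (\<integral>\<^sup>+r. \<integral>\<^sup>+y. dyadic_kernel 0 (level r + 3) t y * u r y \<partial>circle_measure \<partial>radius_measure) s
       \<le> enn_powr (ennreal 3 * ?A t) s"
      using s by (intro enn_powr_mono) auto
    then show "enn_powr (\<integral>\<^sup>+r. \<integral>\<^sup>+y. dyadic_kernel 0 (level r + 3) t y * u r y \<partial>circle_measure \<partial>radius_measure) s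
       \<le> ennreal (3 powr s) * enn_powr (?A t) s"
      using s by (simp add: enn_powr_mult enn_powr_ennreal del: ennreal_numeral)
  qed
  also have "\<dots> = ennreal (3 powr s) * (\<integral>\<^sup>+t. enn_powr (?A t) s \<partial>circle_measure)"
    by (rule nn_integral_cmult) measurable
  finally show ?thesis
    using c by (simp add: c_def[symmetric] ennreal_mult mult.assoc mult_left_mono)
qed

end

section \<open>The norms in polar coordinates\<close>

text \<open>The argument is continuous off the nonpositive reals, and on them it is \<pi> except for
  the value 0 at 0.\<close>

lemma borel_measurable_Arg [measurable]: "Arg \<in> borel_measurable borel"
proof -
  have "Arg = (\<lambda>z. if z \<in> - \<real>\<^sub>\<le>\<^sub>0 then Arg z else if z = 0 then 0 else pi)"
    by (auto simp: fun_eq_iff Arg_zero elim!: nonpos_Reals_cases)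
  also have "\<dots> \<in> borel_measurable borel"
  proof -
    have "Arg \<in> borel_measurable (restrict_space borel (- \<real>\<^sub>\<le>\<^sub>0))"
      by (intro borel_measurable_continuous_on_restrict continuous_on_Arg)
    moreover have "(\<lambda>z::complex. if z = 0 then 0 else pi) \<in> borel_measurable (restrict_space borel {z. z \<notin> - \<real>\<^sub>\<le>\<^sub>0})"
      by (rule measurable_restrict_space1) measurable
    moreover have "- \<real>\<^sub>\<le>\<^sub>0 \<in> sets (borel :: complex measure)"
      by (intro borel_open open_Compl closed_nonpos_Reals_complex)
    ultimately show ?thesis
      by (subst measurable_If_restrict_space_iff) (simp_all only: Collect_mem_eq space_borel UNIV_I simp_thms)
  qed
  finally show ?thesis .
qed

lemma ex_Arg_rcis:
  assumes "0 < r"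
  shows "\<exists>m::int. Arg (rcis r t) = t + 2 * pi * of_int m"
proof -
  have nz: "rcis r t \<noteq> 0" using assms by simp
  have "cis (Arg (rcis r t)) = sgn (rcis r t)" using nz by (rule cis_Arg)
  also have "\<dots> = cis t"
    using assms by (simp add: rcis_def sgn_mult sgn_of_real sgn_cis)
  finally have "sin (Arg (rcis r t)) = sin t \<and> cos (Arg (rcis r t)) = cos t"
    by (simp add: complex_eq_iff)
  then obtain m :: int where "Arg (rcis r t) = t + 2 * m * pi"
    by (auto simp: sin_cos_eq_iff)
  then show ?thesis by (intro exI[of _ m]) (simp add: mult_ac)
qed

text \<open>\<open>Arg\<close> differs from the given angle by a multiple of 2 \<pi>, and the
  integer k on either side runs over all multiples.\<close>

lemma rcis_in_approach_region_iff:
  assumes r: "0 < r" "r < 1"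
  shows "rcis r y \<in> approach_region (cis t) \<longleftrightarrow> window r t y"
proof -
  obtain m where m: "Arg (rcis r y) = y + 2 * pi * of_int m" using ex_Arg_rcis[OF r(1)] by blast
  obtain n where n: "Arg (cis t) = t + 2 * pi * of_int n"
    using ex_Arg_rcis[of 1 t] by (auto simp: rcis_def)
  have eq: "Arg (rcis r y) - Arg (cis t) + 2 * pi * of_int k = y - t + 2 * pi * of_int (k + m - n)" for k
    by (simp add: m n algebra_simps)
  have "rcis r y \<in> approach_region (cis t) \<longleftrightarrow> (\<exists>k::int. \<bar>y - t + 2 * pi * of_int (k + m - n)\<bar> < 1 - r)"
    using r unfolding eq[symmetric] by (simp add: approach_region_def unit_disc_def)
  also have "\<dots> \<longleftrightarrow> window r t y"
    unfolding window_def
  proof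
    assume "\<exists>k::int. \<bar>y - t + 2 * pi * of_int k\<bar> < 1 - r"
    then obtain k :: int where "\<bar>y - t + 2 * pi * of_int k\<bar> < 1 - r" ..
    then have "\<bar>y - t + 2 * pi * of_int ((k - m + n) + m - n)\<bar> < 1 - r" by simp
    then show "\<exists>k::int. \<bar>y - t + 2 * pi * of_int (k + m - n)\<bar> < 1 - r" ..
  qed blast
  finally show ?thesis .
qed

lemma approach_region_borel [measurable]: "approach_region \<xi> \<in> sets borel"
proof -
  have "approach_region \<xi> = {z \<in> space borel. cmod z < 1 \<and> (\<exists>k::int. \<bar>Arg z - Arg \<xi> + 2 * pi * of_int k\<bar> < cmod \<xi> - cmod z)}"
    by (auto simp: approach_region_def unit_disc_def)
  also have "\<dots> \<in> sets borel" by measurable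
  finally show ?thesis .
qed

section \<open>Integrals over the disc in polar coordinates\<close>

lemma unit_disc_borel [measurable]: "unit_disc \<in> sets borel"
  by (simp add: unit_disc_def)

lemma space_area_measure [simp]: "space area_measure = unit_disc"
  by (simp add: area_measure_def space_scale_measure)

lemma borel_measurable_area_iff:
  "f \<in> borel_measurable area_measure \<longleftrightarrow> f \<in> borel_measurable (lebesgue_on unit_disc)"
  unfolding area_measure_def by (subst measurable_cong_sets[of _ "lebesgue_on unit_disc" _ borel]) auto

lemma borel_measurable_areaI:
  assumes "f \<in> borel_measurable borel"
  shows "f \<in> borel_measurable area_measure"
  unfolding borel_measurable_area_iff
  by (rule measurable_restrict_space1) (simp add: assms measurable_completion)

lemma nn_integral_area:
  assumes "F \<in> borel_measurable area_measure"
  shows "(\<integral>\<^sup>+z. F z \<partial>area_measure) = ennreal (1 / pi) * (\<integral>\<^sup>+z. F z * indicator unit_disc z \<partial>lborel)"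
proof -
  have "(\<integral>\<^sup>+z. F z \<partial>area_measure) = ennreal (1 / pi) * (\<integral>\<^sup>+z. F z \<partial>lebesgue_on unit_disc)"
    using assms unfolding area_measure_def
    by (intro nn_integral_scale_measure) (simp add: borel_measurable_area_iff area_measure_def[symmetric])
  also have "(\<integral>\<^sup>+z. F z \<partial>lebesgue_on unit_disc) = (\<integral>\<^sup>+z. F z * indicator unit_disc z \<partial>lebesgue)"
    by (rule nn_integral_restrict_space) simp
  finally show ?thesis by (simp add: nn_integral_completion)
qed

text \<open>Tonelli and composition with \<open>rcis\<close> are carried out for Borel functions,
  whereas functions on the disc are only Lebesgue measurable. Vanishing outside the disc lets the
  integrals run over the whole plane.\<close>

lemma area_borel_representative:
  fixes F :: "complex \<Rightarrow> ennreal"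
  assumes "F \<in> borel_measurable area_measure"
  obtains H where "H \<in> borel_measurable borel" "\<And>z. z \<notin> unit_disc \<Longrightarrow> H z = 0"
    "AE z in lborel. z \<in> unit_disc \<longrightarrow> F z = H z"
proof -
  have "(\<lambda>z. F z * indicator unit_disc z) \<in> borel_measurable lebesgue"
    using assms by (subst borel_measurable_restrict_space_iff_ennreal[symmetric]) (auto simp: borel_measurable_area_iff)
  then obtain H where H: "H \<in> borel_measurable lborel" "AE z in lborel. F z * indicator unit_disc z = H z"
    using completion_ex_borel_measurable by blast
  show thesis
  proof (rule that[of "\<lambda>z. H z * indicator unit_disc z"])
    show "(\<lambda>z. H z * indicator unit_disc z) \<in> borel_measurable borel"
      using H(1) by simp
    show "AE z in lborel. z \<in> unit_disc \<longrightarrow> F z = H z * indicator unit_disc z"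
      using H(2) by eventually_elim (auto simp: indicator_def split: if_splits)
  qed auto
qed

lemma nn_integral_polar_disc:
  assumes H[measurable]: "H \<in> borel_measurable borel" and H0: "\<And>z. z \<notin> unit_disc \<Longrightarrow> H z = (0::ennreal)"
  shows "(\<integral>\<^sup>+z. H z \<partial>lborel) = (\<integral>\<^sup>+t. \<integral>\<^sup>+r. H (rcis r t) * ennreal r \<partial>radius_measure \<partial>circle_measure)"
proof -
  have inner: "(\<integral>\<^sup>+r. H (rcis r t) * ennreal r * indicator {0<..} r * indicator {0..<2*pi} t \<partial>lborel)
     = (\<integral>\<^sup>+r. H (rcis r t) * ennreal r \<partial>radius_measure) * indicator {0..<2*pi} t" for t :: real
  proof -
    have "(\<integral>\<^sup>+r. H (rcis r t) * ennreal r * indicator {0<..} r * indicator {0..<2*pi} t \<partial>lborel)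
       = (\<integral>\<^sup>+r. H (rcis r t) * ennreal r * indicator {0<..<1} r * indicator {0..<2*pi} t \<partial>lborel)"
    proof (intro nn_integral_cong)
      fix r :: real
      show "H (rcis r t) * ennreal r * indicator {0<..} r * indicator {0..<2*pi} t
         = H (rcis r t) * ennreal r * indicator {0<..<1} r * indicator {0..<2*pi} t"
      proof (cases "1 \<le> r")
        case True
        then have "H (rcis r t) = 0" by (intro H0) (simp add: unit_disc_def)
        then show ?thesis by simp
      qed (simp add: indicator_def)
    qed
    also have "\<dots> = (\<integral>\<^sup>+r. H (rcis r t) * ennreal r * indicator {0<..<1} r \<partial>lborel) * indicator {0..<2*pi} t"
      by (rule nn_integral_multc) measurable
    finally show ?thesis by (simp only: nn_integral_radius)
  qed
  have "(\<integral>\<^sup>+z. H z \<partial>lborel) = (\<integral>\<^sup>+t. (\<integral>\<^sup>+r. H (rcis r t) * ennreal r \<partial>radius_measure) * indicator {0..<2*pi} t \<partial>lborel)"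
    by (simp only: nn_integral_polar[OF H] inner)
  then show ?thesis by (simp only: nn_integral_circle)
qed

lemma AE_polar:
  assumes "AE z in lborel. P z"
  shows "AE t in circle_measure. AE r in radius_measure. P (rcis r t)"
proof -
  interpret C: finite_measure circle_measure by (rule finite_measure_circle)
  interpret R: finite_measure radius_measure by (rule finite_measure_radius)
  from assms obtain N where N: "{z. \<not> P z} \<subseteq> N" "N \<in> null_sets lborel"
    by (auto elim!: AE_E simp: null_sets_def)
  then have [measurable]: "N \<in> sets borel" by auto
  let ?I = "\<lambda>z. indicator (N \<inter> unit_disc) z :: ennreal"
  have "(\<integral>\<^sup>+t. \<integral>\<^sup>+r. ?I (rcis r t) * ennreal r \<partial>radius_measure \<partial>circle_measure) = (\<integral>\<^sup>+z. ?I z \<partial>lborel)"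
    by (intro nn_integral_polar_disc[symmetric]) auto
  also have "\<dots> = emeasure lborel (N \<inter> unit_disc)"
    by simp
  also have "\<dots> = 0"
    using null_set_Int2[OF N(2), of unit_disc] by (auto simp: null_sets_def Int_commute)
  finally have ae: "AE t in circle_measure. (\<integral>\<^sup>+r. ?I (rcis r t) * ennreal r \<partial>radius_measure) = 0"
    by (subst (asm) nn_integral_0_iff_AE) (auto intro!: borel_measurable_circle)
  have imp: "AE r in radius_measure. P (rcis r t)"
    if "(\<integral>\<^sup>+r. ?I (rcis r t) * ennreal r \<partial>radius_measure) = 0" for t
  proof -
    have "AE r in radius_measure. ?I (rcis r t) * ennreal r = 0"
      using that by (subst (asm) nn_integral_0_iff_AE) (auto intro!: borel_measurable_radius)
    then show ?thesis
      using AE_space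
    proof eventually_elim
      case (elim r)
      then have "rcis r t \<notin> N" by (auto simp: unit_disc_def indicator_def split: if_splits)
      then show ?case using N(1) by auto
    qed
  qed
  show ?thesis by (rule eventually_mono[OF ae imp])
qed

lemma nn_integral_closed_circle:
  "(\<integral>\<^sup>+t. F t * indicator {0..2*pi} t \<partial>lebesgue) = (\<integral>\<^sup>+t. F t \<partial>circle_measure)"
  unfolding nn_integral_circle nn_integral_completion
  by (intro nn_integral_cong_AE AE_I[of _ _ "{2*pi}"]) (auto simp: indicator_def)

text \<open>Since 1 - r < \<pi>, a window in the middle of the period does not wrap around and is
  one interval of length 2 (1 - r).\<close>

lemma nn_integral_window_kernel:
  assumes r: "0 < r" "r < 1" and y: "y \<in> {0..<2 * pi}"
  shows "(\<integral>\<^sup>+t. window_kernel r t y \<partial>circle_measure) = 2"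
proof -
  define h where "h t = window_kernel r t y" for t
  have [measurable]: "h \<in> borel_measurable borel" unfolding h_def by measurable
  have "window r (t + 2 * pi) y \<longleftrightarrow> window r t y" for t
  proof -
    have "window r (t + 2 * pi) y \<longleftrightarrow> (\<exists>k::int. \<bar>y - t + 2 * pi * of_int (k - 1)\<bar> < 1 - r)"
      unfolding window_def by (simp add: algebra_simps)
    also have "\<dots> \<longleftrightarrow> window r t y"
      unfolding window_def
    proof
      assume "\<exists>k::int. \<bar>y - t + 2 * pi * of_int k\<bar> < 1 - r"
      then obtain k :: int where "\<bar>y - t + 2 * pi * of_int k\<bar> < 1 - r" ..
      then have "\<bar>y - t + 2 * pi * of_int ((k + 1) - 1)\<bar> < 1 - r" by simp
      then show "\<exists>k::int. \<bar>y - t + 2 * pi * of_int (k - 1)\<bar> < 1 - r" ..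
    qed blast
    finally show ?thesis .
  qed
  then have per: "h (t + 2 * pi) = h t" for t by (simp add: h_def window_kernel_def)
  have "(\<integral>\<^sup>+t. window_kernel r t y \<partial>circle_measure) = (\<integral>\<^sup>+t. h t * indicator {0..<2*pi} t \<partial>lborel)"
    by (simp add: nn_integral_circle h_def)
  \<comment> \<open>The shift places the centre y of the window at the midpoint \<pi> of the
    period.\<close>
  also have "\<dots> = (\<integral>\<^sup>+t. h (t + (y - pi)) * indicator {0..<2*pi} t \<partial>lborel)"
    using y by (intro nn_integral_periodic[symmetric] per) auto
  also have "\<dots> = (\<integral>\<^sup>+t. ennreal (1 / (1 - r)) * indicator {pi - (1 - r)<..<pi + (1 - r)} t \<partial>lborel)"
  proof (intro nn_integral_cong)
    fix t :: real
    have iff: "window r (t + (y - pi)) y \<longleftrightarrow> \<bar>pi - t\<bar> < 1 - r" if t: "0 \<le> t" "t < 2 * pi"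
    proof
      assume "window r (t + (y - pi)) y"
      then obtain k :: int where k: "\<bar>pi - t + 2 * pi * of_int k\<bar> < 1 - r"
        by (auto simp: window_def)
      have "k = 0"
      proof (rule ccontr)
        assume "k \<noteq> 0"
        then consider "k \<ge> 1" | "k \<le> -1" by linarith
        then show False
        proof cases
          case 1
          then have "2 * pi * 1 \<le> 2 * pi * of_int k" by (intro mult_left_mono) auto
          then show False using k t pi_gt3 r by linarith
        next
          case 2
          then have "real_of_int k \<le> - 1" by linarith
          then have "2 * pi * of_int k \<le> 2 * pi * (-1)" by (intro mult_left_mono) auto
          then show False using k t pi_gt3 r by linarith
        qed
      qed
      then show "\<bar>pi - t\<bar> < 1 - r" using k by simp
    next
      assume "\<bar>pi - t\<bar> < 1 - r"
      then show "window r (t + (y - pi)) y"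
        unfolding window_def by (intro exI[of _ 0]) simp
    qed
    have "t \<in> {0..<2*pi}" if "\<bar>pi - t\<bar> < 1 - r"
      using that r pi_gt3 by (simp add: abs_less_iff)
    then show "h (t + (y - pi)) * indicator {0..<2*pi} t = ennreal (1 / (1 - r)) * indicator {pi - (1 - r)<..<pi + (1 - r)} t"
      using iff by (auto simp: h_def window_kernel_def indicator_def abs_less_iff)
  qed
  also have "\<dots> = ennreal (1 / (1 - r)) * ennreal (2 * (1 - r))"
    using r by (subst nn_integral_cmult_indicator) auto
  also have "\<dots> = ennreal (1 / (1 - r) * (2 * (1 - r)))"
    using r by (subst ennreal_mult') auto
  also have "1 / (1 - r) * (2 * (1 - r)) = 2" using r by (simp add: field_simps)
  finally show ?thesis by simp
qed

text \<open>Integration over the vertex angle t before all else leaves the total mass 2 of each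
  window; this settles s = 1 without dyadic cells.\<close>

lemma nn_integral_window_average:
  assumes u: "(\<lambda>(r, y). u r y) \<in> borel_measurable (borel \<Otimes>\<^sub>M borel)"
  shows "(\<integral>\<^sup>+t. \<integral>\<^sup>+r. \<integral>\<^sup>+y. window_kernel r t y * u r y \<partial>circle_measure \<partial>radius_measure \<partial>circle_measure)
     = 2 * (\<integral>\<^sup>+t. \<integral>\<^sup>+r. u r t \<partial>radius_measure \<partial>circle_measure)"
proof -
  note id_circle_measurable [measurable] id_radius_measurable [measurable]
  interpret C: finite_measure circle_measure by (rule finite_measure_circle)
  interpret R: finite_measure radius_measure by (rule finite_measure_radius)
  interpret CR: pair_sigma_finite radius_measure circle_measure ..
  interpret CC: pair_sigma_finite circle_measure circle_measure ..
  have [measurable]: "(\<lambda>x. u (f x) (g x)) \<in> borel_measurable L"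
    if [measurable]: "f \<in> borel_measurable L" "g \<in> borel_measurable L" for f g and L :: "'l measure"
    using measurable_compose[OF _ u, of "\<lambda>x. (f x, g x)" L] by simp
  have "(\<integral>\<^sup>+t. \<integral>\<^sup>+r. \<integral>\<^sup>+y. window_kernel r t y * u r y \<partial>circle_measure \<partial>radius_measure \<partial>circle_measure)
     = (\<integral>\<^sup>+r. \<integral>\<^sup>+t. \<integral>\<^sup>+y. window_kernel r t y * u r y \<partial>circle_measure \<partial>circle_measure \<partial>radius_measure)"
    by (rule CR.Fubini') measurable
  also have "\<dots> = (\<integral>\<^sup>+r. \<integral>\<^sup>+y. \<integral>\<^sup>+t. window_kernel r t y * u r y \<partial>circle_measure \<partial>circle_measure \<partial>radius_measure)"
    by (intro nn_integral_cong CC.Fubini') measurable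
  also have "\<dots> = (\<integral>\<^sup>+r. \<integral>\<^sup>+y. 2 * u r y \<partial>circle_measure \<partial>radius_measure)"
  proof (intro nn_integral_cong)
    fix r y assume "r \<in> space radius_measure" "y \<in> space circle_measure"
    then show "(\<integral>\<^sup>+t. window_kernel r t y * u r y \<partial>circle_measure) = 2 * u r y"
      using nn_integral_window_kernel[of r y] by (subst nn_integral_multc) auto
  qed
  also have "\<dots> = 2 * (\<integral>\<^sup>+r. \<integral>\<^sup>+y. u r y \<partial>circle_measure \<partial>radius_measure)"
    by (simp add: nn_integral_cmult)
  also have "(\<integral>\<^sup>+r. \<integral>\<^sup>+y. u r y \<partial>circle_measure \<partial>radius_measure) = (\<integral>\<^sup>+t. \<integral>\<^sup>+r. u r t \<partial>radius_measure \<partial>circle_measure)"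
    by (rule CR.Fubini'[symmetric]) measurable
  finally show ?thesis .
qed

lemma weight_density_measurable:
  assumes "weight \<omega>" "f \<in> borel_measurable area_measure"
  shows "(\<lambda>z. ennreal (cmod (f z) powr p * \<omega> z)) \<in> borel_measurable area_measure"
  using assms by (auto simp: weight_def)

text \<open>Each of the three quantities depends on f only through |f|^p \<omega> up to null sets,
  so one Borel function \<open>u\<close> represents them all. That \<omega> is radial enters in the
  mixed norm, where the weight is evaluated at r instead of at the point with angle t.\<close>

lemma polar_representation:
  fixes f :: "complex \<Rightarrow> complex"
  assumes p: "0 < p" and \<omega>: "weight \<omega>" "radial \<omega>" and f: "f \<in> borel_measurable area_measure"
  obtains u where "(\<lambda>(r, y). u r y) \<in> borel_measurable (borel \<Otimes>\<^sub>M borel)"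
    "L_norm q p \<omega> f = enn_powr (ennreal (1 / (2 * pi)) *
        (\<integral>\<^sup>+t. enn_powr (\<integral>\<^sup>+r. u r t \<partial>radius_measure) (q / p) \<partial>circle_measure)) (1 / q)"
    "T_norm q p \<omega> f = enn_powr
        (\<integral>\<^sup>+t. enn_powr (ennreal (1 / pi) * (\<integral>\<^sup>+r. \<integral>\<^sup>+y. window_kernel r t y * u r y \<partial>circle_measure \<partial>radius_measure)) (q / p) \<partial>circle_measure) (1 / q)"
    "(\<integral>\<^sup>+z. ennreal (cmod (f z) powr p * \<omega> z) \<partial>area_measure) =
       ennreal (1 / pi) * (\<integral>\<^sup>+t. \<integral>\<^sup>+r. u r t \<partial>radius_measure \<partial>circle_measure)"
proof -
  interpret C: finite_measure circle_measure by (rule finite_measure_circle)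
  interpret R: finite_measure radius_measure by (rule finite_measure_radius)
  interpret CR: pair_sigma_finite radius_measure circle_measure ..
  define \<Phi> where "\<Phi> z = ennreal (cmod (f z) powr p * \<omega> z)" for z
  have \<Phi>: "\<Phi> \<in> borel_measurable area_measure"
    unfolding \<Phi>_def[abs_def] using \<omega>(1) f by (rule weight_density_measurable)
  obtain H where H[measurable]: "H \<in> borel_measurable borel" and H0: "\<And>z. z \<notin> unit_disc \<Longrightarrow> H z = 0"
    and eq: "AE z in lborel. z \<in> unit_disc \<longrightarrow> \<Phi> z = H z"
    using area_borel_representative[OF \<Phi>] by blast
  define u where "u r t = H (rcis r t) * ennreal r" for r t
  have [measurable]: "(\<lambda>x. u (g x) (h x)) \<in> borel_measurable L"
    if [measurable]: "g \<in> borel_measurable L" "h \<in> borel_measurable L" for g h and L :: "'l measure"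
    unfolding u_def by measurable
  show thesis
  proof (rule that[of u])
    show "(\<lambda>(r, y). u r y) \<in> borel_measurable (borel \<Otimes>\<^sub>M borel)" by measurable
    have "(\<integral>\<^sup>+z. \<Phi> z \<partial>area_measure) = ennreal (1 / pi) * (\<integral>\<^sup>+z. \<Phi> z * indicator unit_disc z \<partial>lborel)"
      by (rule nn_integral_area[OF \<Phi>])
    also have "(\<integral>\<^sup>+z. \<Phi> z * indicator unit_disc z \<partial>lborel) = (\<integral>\<^sup>+z. H z \<partial>lborel)"
    proof (rule nn_integral_cong_AE)
      show "AE z in lborel. \<Phi> z * indicator unit_disc z = H z"
        using eq by eventually_elim (auto simp: indicator_def H0)
    qed
    also have "\<dots> = (\<integral>\<^sup>+t. \<integral>\<^sup>+r. u r t \<partial>radius_measure \<partial>circle_measure)"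
      unfolding u_def using H H0 by (rule nn_integral_polar_disc)
    finally show "(\<integral>\<^sup>+z. ennreal (cmod (f z) powr p * \<omega> z) \<partial>area_measure) =
       ennreal (1 / pi) * (\<integral>\<^sup>+t. \<integral>\<^sup>+r. u r t \<partial>radius_measure \<partial>circle_measure)"
      by (simp add: \<Phi>_def)
  next
    \<comment> \<open>Only for almost every angle, because \<open>H\<close> agrees with the
      integrand off a planar null set.\<close>
    have "AE t in circle_measure. (\<integral>\<^sup>+r\<in>{0<..<1}. ennreal (cmod (f (rcis r t)) powr p * \<omega> (of_real r) * r) \<partial>lebesgue)
        = (\<integral>\<^sup>+r. u r t \<partial>radius_measure)"
      using AE_polar[OF eq]
    proof eventually_elim
      case (elim t)
      have "(\<integral>\<^sup>+r. ennreal (cmod (f (rcis r t)) powr p * \<omega> (of_real r) * r) \<partial>radius_measure) = (\<integral>\<^sup>+r. u r t \<partial>radius_measure)"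
      proof (rule nn_integral_cong_AE)
        show "AE r in radius_measure. ennreal (cmod (f (rcis r t)) powr p * \<omega> (of_real r) * r) = u r t"
          using elim AE_space
        proof eventually_elim
          case (elim r)
          then have r: "0 < r" "r < 1" by auto
          then have disc: "rcis r t \<in> unit_disc" by (simp add: unit_disc_def)
          then have "\<omega> (rcis r t) = \<omega> (of_real (cmod (rcis r t)))"
            using \<omega>(2) unfolding radial_def by blast
          also have "cmod (rcis r t) = r" using r by simp
          finally have "ennreal (cmod (f (rcis r t)) powr p * \<omega> (of_real r) * r) = \<Phi> (rcis r t) * ennreal r"
            using r by (simp add: \<Phi>_def ennreal_mult'')
          then show ?case using elim disc by (simp add: u_def)
        qed
      qed
      then show ?case
        by (simp add: nn_integral_completion nn_integral_radius)
    qed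
    then show "L_norm q p \<omega> f = enn_powr (ennreal (1 / (2 * pi)) *
        (\<integral>\<^sup>+t. enn_powr (\<integral>\<^sup>+r. u r t \<partial>radius_measure) (q / p) \<partial>circle_measure)) (1 / q)"
      unfolding L_norm_def nn_integral_closed_circle
      by (intro arg_cong2[where f=enn_powr] arg_cong2[where f="(*)"] nn_integral_cong_AE refl)
         (auto elim!: AE_mp)
  next
    \<comment> \<open>This is an area integral, insensitive to null sets, so the identity holds for
      every t.\<close>
    have "(\<integral>\<^sup>+z\<in>approach_region (cis t). ennreal (cmod (f z) powr p * \<omega> z / (1 - cmod z)) \<partial>area_measure)
       = ennreal (1 / pi) * (\<integral>\<^sup>+r. \<integral>\<^sup>+y. window_kernel r t y * u r y \<partial>circle_measure \<partial>radius_measure)" for t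
    proof -
      define G where "G z = ennreal (1 / (1 - cmod z)) * indicator (approach_region (cis t)) z" for z
      have [measurable]: "G \<in> borel_measurable borel" unfolding G_def[abs_def] by measurable
      have "(\<integral>\<^sup>+z\<in>approach_region (cis t). ennreal (cmod (f z) powr p * \<omega> z / (1 - cmod z)) \<partial>area_measure)
          = (\<integral>\<^sup>+z. \<Phi> z * G z \<partial>area_measure)"
      proof (intro nn_integral_cong)
        fix z assume "z \<in> space area_measure"
        then have "0 \<le> 1 - cmod z" by (simp add: unit_disc_def)
        then have "ennreal (cmod (f z) powr p * \<omega> z * (1 / (1 - cmod z))) = \<Phi> z * ennreal (1 / (1 - cmod z))"
          unfolding \<Phi>_def by (intro ennreal_mult'') simp
        then show "ennreal (cmod (f z) powr p * \<omega> z / (1 - cmod z)) * indicator (approach_region (cis t)) z = \<Phi> z * G z"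
          by (simp add: G_def mult.assoc)
      qed
      also have "\<dots> = ennreal (1 / pi) * (\<integral>\<^sup>+z. \<Phi> z * G z * indicator unit_disc z \<partial>lborel)"
        using \<Phi> borel_measurable_areaI[of G] by (intro nn_integral_area) simp
      also have "(\<integral>\<^sup>+z. \<Phi> z * G z * indicator unit_disc z \<partial>lborel) = (\<integral>\<^sup>+z. H z * G z \<partial>lborel)"
      proof (rule nn_integral_cong_AE)
        show "AE z in lborel. \<Phi> z * G z * indicator unit_disc z = H z * G z"
          using eq by eventually_elim (auto simp: indicator_def H0)
      qed
      also have "\<dots> = (\<integral>\<^sup>+y. \<integral>\<^sup>+r. H (rcis r y) * G (rcis r y) * ennreal r \<partial>radius_measure \<partial>circle_measure)"
        by (rule nn_integral_polar_disc) (auto simp: H0)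
      also have "\<dots> = (\<integral>\<^sup>+y. \<integral>\<^sup>+r. window_kernel r t y * u r y \<partial>radius_measure \<partial>circle_measure)"
      proof (intro nn_integral_cong)
        fix r y assume "r \<in> space radius_measure"
        then have "G (rcis r y) = window_kernel r t y"
          using rcis_in_approach_region_iff[of r y t] by (simp add: G_def window_kernel_def)
        then show "H (rcis r y) * G (rcis r y) * ennreal r = window_kernel r t y * u r y"
          by (simp add: u_def mult_ac)
      qed
      also have "\<dots> = (\<integral>\<^sup>+r. \<integral>\<^sup>+y. window_kernel r t y * u r y \<partial>circle_measure \<partial>radius_measure)"
        by (rule CR.Fubini') measurable
      finally show ?thesis .
    qed
    then show "T_norm q p \<omega> f = enn_powr
        (\<integral>\<^sup>+t. enn_powr (ennreal (1 / pi) * (\<integral>\<^sup>+r. \<integral>\<^sup>+y. window_kernel r t y * u r y \<partial>circle_measure \<partial>radius_measure)) (q / p) \<partial>circle_measure) (1 / q)"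
      unfolding T_norm_def nn_integral_closed_circle by simp
  qed
qed

section \<open>Comparison of the norms\<close>

lemma borel_measurable_window_average:
  assumes u: "(\<lambda>(r, y). u r y) \<in> borel_measurable (borel \<Otimes>\<^sub>M borel)"
  shows "(\<lambda>t. \<integral>\<^sup>+r. \<integral>\<^sup>+y. window_kernel r t y * u r y \<partial>circle_measure \<partial>radius_measure) \<in> borel_measurable circle_measure"
proof -
  note id_circle_measurable [measurable] id_radius_measurable [measurable]
  interpret C: finite_measure circle_measure by (rule finite_measure_circle)
  interpret R: finite_measure radius_measure by (rule finite_measure_radius)
  have [measurable]: "(\<lambda>x. u (f x) (g x)) \<in> borel_measurable L"
    if [measurable]: "f \<in> borel_measurable L" "g \<in> borel_measurable L" for f g and L :: "'l measure"
    using measurable_compose[OF _ u, of "\<lambda>x. (f x, g x)" L] by simp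
  show ?thesis by measurable
qed

lemma nn_integral_enn_powr_window_average:
  assumes u: "(\<lambda>(r, y). u r y) \<in> borel_measurable (borel \<Otimes>\<^sub>M borel)" and "0 < s" "0 \<le> c"
  shows "(\<integral>\<^sup>+t. enn_powr (ennreal c * (\<integral>\<^sup>+r. \<integral>\<^sup>+y. window_kernel r t y * u r y \<partial>circle_measure \<partial>radius_measure)) s \<partial>circle_measure)
    = ennreal (c powr s) * (\<integral>\<^sup>+t. enn_powr (\<integral>\<^sup>+r. \<integral>\<^sup>+y. window_kernel r t y * u r y \<partial>circle_measure \<partial>radius_measure) s \<partial>circle_measure)"
proof -
  note borel_measurable_window_average[OF u, measurable]
  show ?thesis
    using assms(2,3) by (simp add: enn_powr_mult enn_powr_ennreal nn_integral_cmult)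
qed

lemma ennreal_mult_collapse: "0 \<le> a \<Longrightarrow> ennreal a * (ennreal b * X) = ennreal (a * b) * X"
  by (simp only: ennreal_mult' mult.assoc)

text \<open>Both norms share the outer root, so it suffices to compare the integrals under it; C
  becomes C^(1/q).\<close>

lemma norm_dominatedI:
  assumes "0 < q" "0 < C"
    and "\<And>f. f \<in> borel_measurable area_measure \<Longrightarrow>
      \<exists>X Y. N f = enn_powr X (1 / q) \<and> N' f = enn_powr Y (1 / q) \<and> X \<le> ennreal C * Y"
  shows "norm_dominated N N'"
  unfolding norm_dominated_def
proof (intro exI[of _ "C powr (1 / q)"] conjI ballI)
  fix f :: "complex \<Rightarrow> complex" assume "f \<in> borel_measurable area_measure"
  then obtain X Y where XY: "N f = enn_powr X (1 / q)" "N' f = enn_powr Y (1 / q)" "X \<le> ennreal C * Y"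
    using assms(3) by blast
  have "N f \<le> enn_powr (ennreal C * Y) (1 / q)"
    unfolding XY(1) using XY(3) assms(1) by (intro enn_powr_mono) auto
  also have "\<dots> = ennreal (C powr (1 / q)) * N' f"
    using assms(1,2) by (simp add: enn_powr_mult enn_powr_ennreal XY(2))
  finally show "N f \<le> ennreal (C powr (1 / q)) * N' f" .
qed (use assms in simp)

lemma norm_dominated_finite:
  assumes "norm_dominated N N'" "f \<in> borel_measurable area_measure" "N' f < \<infinity>"
  shows "N f < \<infinity>"
proof -
  obtain C where "N f \<le> ennreal C * N' f"
    using assms(1,2) unfolding norm_dominated_def by blast
  also have "\<dots> < \<infinity>" using assms(3) by (simp add: ennreal_mult_less_top)
  finally show ?thesis .
qed

text \<open>Besides the constant of the window averages, (1 / \<pi>)^s stems from the normalised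
  area in the inner integral and 2 \<pi> from the normalisation of the mixed norm.\<close>

lemma T_norm_dominated_L_norm:
  assumes "0 < p" "p < q" and \<omega>: "weight \<omega>" "radial \<omega>"
  shows "norm_dominated (T_norm q p \<omega>) (L_norm q p \<omega>)"
proof -
  define s where "s = q / p"
  have s: "1 < s" using assms by (simp add: s_def)
  define c where "c = 16 powr s * (2 * (2 * s * (2 * s) powr (s - 1)))"
  have c: "0 < c" using s by (simp add: c_def)
  show ?thesis
  proof (rule norm_dominatedI[where q=q])
    show "0 < (1 / pi) powr s * c * (2 * pi)" using c by simp
    fix f :: "complex \<Rightarrow> complex" assume f: "f \<in> borel_measurable area_measure"
    obtain u where
      u: "(\<lambda>(r, y). u r y) \<in> borel_measurable (borel \<Otimes>\<^sub>M borel)" and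
      L: "L_norm q p \<omega> f = enn_powr (ennreal (1 / (2 * pi)) *
        (\<integral>\<^sup>+t. enn_powr (\<integral>\<^sup>+r. u r t \<partial>radius_measure) (q / p) \<partial>circle_measure)) (1 / q)" and
      T: "T_norm q p \<omega> f = enn_powr
        (\<integral>\<^sup>+t. enn_powr (ennreal (1 / pi) * (\<integral>\<^sup>+r. \<integral>\<^sup>+y. window_kernel r t y * u r y \<partial>circle_measure \<partial>radius_measure)) (q / p) \<partial>circle_measure) (1 / q)" and
      A: "(\<integral>\<^sup>+z. ennreal (cmod (f z) powr p * \<omega> z) \<partial>area_measure) =
       ennreal (1 / pi) * (\<integral>\<^sup>+t. \<integral>\<^sup>+r. u r t \<partial>radius_measure \<partial>circle_measure)"
      by (rule polar_representation[OF \<open>0 < p\<close> \<omega> f, where q=q]) (rule that)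
    let ?X = "\<integral>\<^sup>+t. enn_powr (\<integral>\<^sup>+r. u r t \<partial>radius_measure) s \<partial>circle_measure"
    have "(\<integral>\<^sup>+t. enn_powr (ennreal (1 / pi) * (\<integral>\<^sup>+r. \<integral>\<^sup>+y. window_kernel r t y * u r y \<partial>circle_measure \<partial>radius_measure)) s \<partial>circle_measure)
      = ennreal ((1 / pi) powr s) * (\<integral>\<^sup>+t. enn_powr (\<integral>\<^sup>+r. \<integral>\<^sup>+y. window_kernel r t y * u r y \<partial>circle_measure \<partial>radius_measure) s \<partial>circle_measure)"
      using s by (intro nn_integral_enn_powr_window_average u) auto
    also have "\<dots> \<le> ennreal ((1 / pi) powr s) * (ennreal c * ?X)"
      unfolding c_def using s by (intro mult_left_mono window_average_upper u) auto
    also have "\<dots> = ennreal ((1 / pi) powr s * c * (2 * pi)) * (ennreal (1 / (2 * pi)) * ?X)"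
      using c by (simp add: ennreal_mult_collapse)
    finally have le: "(\<integral>\<^sup>+t. enn_powr (ennreal (1 / pi) * (\<integral>\<^sup>+r. \<integral>\<^sup>+y. window_kernel r t y * u r y \<partial>circle_measure \<partial>radius_measure)) s \<partial>circle_measure)
      \<le> ennreal ((1 / pi) powr s * c * (2 * pi)) * (ennreal (1 / (2 * pi)) * ?X)" .
    show "\<exists>X Y. T_norm q p \<omega> f = enn_powr X (1 / q) \<and> L_norm q p \<omega> f = enn_powr Y (1 / q) \<and>
        X \<le> ennreal ((1 / pi) powr s * c * (2 * pi)) * Y"
      unfolding L T s_def[symmetric] by (rule exI, rule exI, rule conjI[OF refl conjI[OF refl le]])
  qed (use assms in simp)
qed

lemma L_norm_dominated_T_norm:
  assumes "0 < q" "q < p" and \<omega>: "weight \<omega>" "radial \<omega>"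
  shows "norm_dominated (L_norm q p \<omega>) (T_norm q p \<omega>)"
proof -
  have p: "0 < p" using assms by simp
  define s where "s = q / p"
  have s: "0 < s" "s < 1" using assms by (auto simp: s_def)
  define c where "c = (1 + 1 / s) * 2 powr s * 3 powr s"
  have c: "0 < c" using s by (auto simp: c_def intro!: mult_pos_pos add_pos_pos)
  show ?thesis
  proof (rule norm_dominatedI[where q=q])
    show "0 < 1 / (2 * pi) * c * pi powr s" using c by simp
    fix f :: "complex \<Rightarrow> complex" assume f: "f \<in> borel_measurable area_measure"
    obtain u where
      u: "(\<lambda>(r, y). u r y) \<in> borel_measurable (borel \<Otimes>\<^sub>M borel)" and
      L: "L_norm q p \<omega> f = enn_powr (ennreal (1 / (2 * pi)) *
        (\<integral>\<^sup>+t. enn_powr (\<integral>\<^sup>+r. u r t \<partial>radius_measure) (q / p) \<partial>circle_measure)) (1 / q)" and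
      T: "T_norm q p \<omega> f = enn_powr
        (\<integral>\<^sup>+t. enn_powr (ennreal (1 / pi) * (\<integral>\<^sup>+r. \<integral>\<^sup>+y. window_kernel r t y * u r y \<partial>circle_measure \<partial>radius_measure)) (q / p) \<partial>circle_measure) (1 / q)" and
      A: "(\<integral>\<^sup>+z. ennreal (cmod (f z) powr p * \<omega> z) \<partial>area_measure) =
       ennreal (1 / pi) * (\<integral>\<^sup>+t. \<integral>\<^sup>+r. u r t \<partial>radius_measure \<partial>circle_measure)"
      by (rule polar_representation[OF p \<omega> f, where q=q]) (rule that)
    let ?X = "\<integral>\<^sup>+t. enn_powr (\<integral>\<^sup>+r. u r t \<partial>radius_measure) s \<partial>circle_measure"
    let ?Z = "\<integral>\<^sup>+t. enn_powr (\<integral>\<^sup>+r. \<integral>\<^sup>+y. window_kernel r t y * u r y \<partial>circle_measure \<partial>radius_measure) s \<partial>circle_measure"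
    have Y: "(\<integral>\<^sup>+t. enn_powr (ennreal (1 / pi) * (\<integral>\<^sup>+r. \<integral>\<^sup>+y. window_kernel r t y * u r y \<partial>circle_measure \<partial>radius_measure)) s \<partial>circle_measure)
      = ennreal ((1 / pi) powr s) * ?Z" (is "?Y = _")
      using s by (intro nn_integral_enn_powr_window_average u) auto
    have "ennreal (1 / (2 * pi)) * ?X \<le> ennreal (1 / (2 * pi)) * (ennreal c * ?Z)"
      unfolding c_def using s by (intro mult_left_mono window_average_lower u) auto
    \<comment> \<open>Inserting \<pi>^s (1 / \<pi>)^s = 1 recovers the tent integral from
      \<open>Y\<close>.\<close>
    also have "ennreal c * ?Z = ennreal (c * (pi powr s * (1 / pi) powr s)) * ?Z"
      by (simp add: powr_mult[symmetric])
    also have "ennreal (1 / (2 * pi)) * \<dots> = ennreal (1 / (2 * pi) * c * pi powr s) * ?Y"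
      unfolding Y using c by (simp add: ennreal_mult_collapse mult.assoc)
    finally have le: "ennreal (1 / (2 * pi)) * ?X \<le> ennreal (1 / (2 * pi) * c * pi powr s) * ?Y" .
    show "\<exists>X Y. L_norm q p \<omega> f = enn_powr X (1 / q) \<and> T_norm q p \<omega> f = enn_powr Y (1 / q) \<and>
        X \<le> ennreal (1 / (2 * pi) * c * pi powr s) * Y"
      unfolding L T s_def[symmetric] by (rule exI, rule exI, rule conjI[OF refl conjI[OF refl le]])
  qed (use assms in simp)
qed

text \<open>For s = 1 the inner powers disappear and Tonelli gives exact ratios, whence the
  constants 1/2 and 2 for the p-th powers in the equivalences.\<close>

lemma norms_eq_exponents:
  assumes p: "0 < p" and \<omega>: "weight \<omega>" "radial \<omega>" and f: "f \<in> borel_measurable area_measure"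
  obtains X where "L_norm p p \<omega> f = enn_powr (ennreal (1 / (2 * pi)) * X) (1 / p)"
    "(\<integral>\<^sup>+z. ennreal (cmod (f z) powr p * \<omega> z) \<partial>area_measure) = ennreal (1 / pi) * X"
    "T_norm p p \<omega> f = enn_powr (ennreal (2 / pi) * X) (1 / p)"
proof -
  obtain u where
      u: "(\<lambda>(r, y). u r y) \<in> borel_measurable (borel \<Otimes>\<^sub>M borel)" and
      L: "L_norm p p \<omega> f = enn_powr (ennreal (1 / (2 * pi)) *
        (\<integral>\<^sup>+t. enn_powr (\<integral>\<^sup>+r. u r t \<partial>radius_measure) (p / p) \<partial>circle_measure)) (1 / p)" and
      T: "T_norm p p \<omega> f = enn_powr
        (\<integral>\<^sup>+t. enn_powr (ennreal (1 / pi) * (\<integral>\<^sup>+r. \<integral>\<^sup>+y. window_kernel r t y * u r y \<partial>circle_measure \<partial>radius_measure)) (p / p) \<partial>circle_measure) (1 / p)" and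
      A: "(\<integral>\<^sup>+z. ennreal (cmod (f z) powr p * \<omega> z) \<partial>area_measure) =
       ennreal (1 / pi) * (\<integral>\<^sup>+t. \<integral>\<^sup>+r. u r t \<partial>radius_measure \<partial>circle_measure)"
      by (rule polar_representation[OF p \<omega> f, where q=p]) (rule that)
  let ?X = "\<integral>\<^sup>+t. \<integral>\<^sup>+r. u r t \<partial>radius_measure \<partial>circle_measure"
  have "(\<integral>\<^sup>+t. ennreal (1 / pi) * (\<integral>\<^sup>+r. \<integral>\<^sup>+y. window_kernel r t y * u r y \<partial>circle_measure \<partial>radius_measure) \<partial>circle_measure)
     = ennreal (1 / pi) * (2 * ?X)"
    by (simp only: nn_integral_cmult[OF borel_measurable_window_average[OF u]] nn_integral_window_average[OF u])
  also have "\<dots> = ennreal (1 / pi * 2) * ?X"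
    by (subst ennreal_mult') (simp_all add: mult.assoc)
  finally show thesis
    using p L T A by (intro that[of ?X]) simp_all
qed

lemma norm_equivalent_L_Lebesgue:
  assumes p: "0 < p" and \<omega>: "weight \<omega>" "radial \<omega>"
  shows "norm_equivalent (L_norm p p \<omega>) (Lebesgue_norm p \<omega>)"
  unfolding norm_equivalent_def
proof
  show "norm_dominated (L_norm p p \<omega>) (Lebesgue_norm p \<omega>)"
  proof (rule norm_dominatedI[where q=p and C="1/2"])
    fix f :: "complex \<Rightarrow> complex" assume "f \<in> borel_measurable area_measure"
    from norms_eq_exponents[OF p \<omega> this] obtain X where
      X: "L_norm p p \<omega> f = enn_powr (ennreal (1 / (2 * pi)) * X) (1 / p)"
      "(\<integral>\<^sup>+z. ennreal (cmod (f z) powr p * \<omega> z) \<partial>area_measure) = ennreal (1 / pi) * X" by blast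
    have eq: "ennreal (1 / (2 * pi)) * X = ennreal (1 / 2) * (ennreal (1 / pi) * X)"
      by (subst ennreal_mult_collapse) simp_all
    show "\<exists>X Y. L_norm p p \<omega> f = enn_powr X (1 / p) \<and> Lebesgue_norm p \<omega> f = enn_powr Y (1 / p) \<and> X \<le> ennreal (1 / 2) * Y"
      unfolding X Lebesgue_norm_def by (rule exI, rule exI, rule conjI[OF refl conjI[OF refl eq_refl[OF eq]]])
  qed (use p in auto)
  show "norm_dominated (Lebesgue_norm p \<omega>) (L_norm p p \<omega>)"
  proof (rule norm_dominatedI[where q=p and C=2])
    fix f :: "complex \<Rightarrow> complex" assume "f \<in> borel_measurable area_measure"
    from norms_eq_exponents[OF p \<omega> this] obtain X where
      X: "L_norm p p \<omega> f = enn_powr (ennreal (1 / (2 * pi)) * X) (1 / p)"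
      "(\<integral>\<^sup>+z. ennreal (cmod (f z) powr p * \<omega> z) \<partial>area_measure) = ennreal (1 / pi) * X" by blast
    have eq: "ennreal (1 / pi) * X = ennreal 2 * (ennreal (1 / (2 * pi)) * X)"
      by (subst ennreal_mult_collapse) simp_all
    show "\<exists>X Y. Lebesgue_norm p \<omega> f = enn_powr X (1 / p) \<and> L_norm p p \<omega> f = enn_powr Y (1 / p) \<and> X \<le> ennreal 2 * Y"
      unfolding X Lebesgue_norm_def by (rule exI, rule exI, rule conjI[OF refl conjI[OF refl eq_refl[OF eq]]])
  qed (use p in auto)
qed

lemma norm_equivalent_Lebesgue_T:
  assumes p: "0 < p" and \<omega>: "weight \<omega>" "radial \<omega>"
  shows "norm_equivalent (Lebesgue_norm p \<omega>) (T_norm p p \<omega>)"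
  unfolding norm_equivalent_def
proof
  show "norm_dominated (Lebesgue_norm p \<omega>) (T_norm p p \<omega>)"
  proof (rule norm_dominatedI[where q=p and C="1/2"])
    fix f :: "complex \<Rightarrow> complex" assume "f \<in> borel_measurable area_measure"
    from norms_eq_exponents[OF p \<omega> this] obtain X where
      X: "(\<integral>\<^sup>+z. ennreal (cmod (f z) powr p * \<omega> z) \<partial>area_measure) = ennreal (1 / pi) * X" 
      "T_norm p p \<omega> f = enn_powr (ennreal (2 / pi) * X) (1 / p)" by blast
    have eq: "ennreal (1 / pi) * X = ennreal (1 / 2) * (ennreal (2 / pi) * X)"
      by (subst ennreal_mult_collapse) simp_all
    show "\<exists>X Y. Lebesgue_norm p \<omega> f = enn_powr X (1 / p) \<and> T_norm p p \<omega> f = enn_powr Y (1 / p) \<and> X \<le> ennreal (1 / 2) * Y"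
      unfolding X Lebesgue_norm_def by (rule exI, rule exI, rule conjI[OF refl conjI[OF refl eq_refl[OF eq]]])
  qed (use p in auto)
  show "norm_dominated (T_norm p p \<omega>) (Lebesgue_norm p \<omega>)"
  proof (rule norm_dominatedI[where q=p and C=2])
    fix f :: "complex \<Rightarrow> complex" assume "f \<in> borel_measurable area_measure"
    from norms_eq_exponents[OF p \<omega> this] obtain X where
      X: "(\<integral>\<^sup>+z. ennreal (cmod (f z) powr p * \<omega> z) \<partial>area_measure) = ennreal (1 / pi) * X" 
      "T_norm p p \<omega> f = enn_powr (ennreal (2 / pi) * X) (1 / p)" by blast
    have eq: "ennreal (2 / pi) * X = ennreal 2 * (ennreal (1 / pi) * X)"
      by (subst ennreal_mult_collapse) simp_all
    show "\<exists>X Y. T_norm p p \<omega> f = enn_powr X (1 / p) \<and> Lebesgue_norm p \<omega> f = enn_powr Y (1 / p) \<and> X \<le> ennreal 2 * Y"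
      unfolding X Lebesgue_norm_def by (rule exI, rule exI, rule conjI[OF refl conjI[OF refl eq_refl[OF eq]]])
  qed (use p in auto)
qed

lemma Lebesgue_norm_finite_iff:
  "Lebesgue_norm p \<omega> f < \<infinity> \<longleftrightarrow> (\<integral>\<^sup>+z. ennreal (cmod (f z) powr p * \<omega> z) \<partial>area_measure) < \<infinity>"
  by (simp only: Lebesgue_norm_def enn_powr_less_top_iff)

lemma spaces_eq_exponents:
  assumes p: "0 < p" and \<omega>: "weight \<omega>" "radial \<omega>"
  shows "L_space p p \<omega> = Lebesgue_space p \<omega>" "Lebesgue_space p \<omega> = T_space p p \<omega>"
proof -
  have *: "N f < \<infinity> \<longleftrightarrow> N' f < \<infinity>" if "norm_equivalent N N'" "f \<in> borel_measurable area_measure" for N N' f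
    using that norm_dominated_finite unfolding norm_equivalent_def by blast
  show "L_space p p \<omega> = Lebesgue_space p \<omega>"
    using *[OF norm_equivalent_L_Lebesgue[OF assms]]
    unfolding L_space_def Lebesgue_space_def Lebesgue_norm_finite_iff[symmetric] by blast
  show "Lebesgue_space p \<omega> = T_space p p \<omega>"
    using *[OF norm_equivalent_Lebesgue_T[OF assms]]
    unfolding T_space_def Lebesgue_space_def Lebesgue_norm_finite_iff[symmetric] by blast
qed

section \<open>Integrability of powers near zero\<close>

lemma nn_integral_powr_near_0_finite:
  assumes "b < 1" "0 \<le> \<delta>"
  shows "(\<integral>\<^sup>+t. ennreal (t powr (- b)) * indicator {0<..<\<delta>} t \<partial>lborel) < \<infinity>"
proof -
  have "((\<lambda>t. t powr (- b)) has_integral (\<delta> powr (- b + 1) / (- b + 1))) {0..\<delta>}"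
    using assms by (intro has_integral_powr_from_0) auto
  then have "(\<integral>\<^sup>+t. ennreal (t powr (- b)) * indicator {0..\<delta>} t \<partial>lebesgue) = ennreal (\<delta> powr (- b + 1) / (- b + 1))"
    by (simp add: nn_integral_completion nn_integral_has_integral_lebesgue')
  moreover have "(\<integral>\<^sup>+t. ennreal (t powr (- b)) * indicator {0<..<\<delta>} t \<partial>lborel) \<le> (\<integral>\<^sup>+t. ennreal (t powr (- b)) * indicator {0..\<delta>} t \<partial>lborel)"
    by (intro nn_integral_mono) (auto simp: indicator_def)
  ultimately show ?thesis
    by (simp add: nn_integral_completion le_less_trans[OF _ ennreal_less_top])
qed

text \<open>For every B > 0 the integral of 1 / t from d exp (-B) to d is exactly B.\<close>

lemma nn_integral_inverse_near_0:
  assumes "0 < \<delta>"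
  shows "(\<integral>\<^sup>+t. ennreal (t powr (- 1)) * indicator {0<..<\<delta>} t \<partial>lborel) = \<infinity>"
proof -
  let ?I = "\<integral>\<^sup>+t. ennreal (t powr (- 1)) * indicator {0<..<\<delta>} t \<partial>lborel"
  have "ennreal B \<le> ?I" if "0 < B" for B
  proof -
    define d where "d = \<delta> / 2"
    define e where "e = d * exp (- B)"
    have d: "0 < d" "d < \<delta>" using assms by (auto simp: d_def)
    have e: "0 < e" "e \<le> d" using d that by (auto simp: e_def mult_le_cancel_left1)
    have "ln e = ln d - B" using d by (simp add: e_def ln_mult)
    then have "ennreal B = ennreal (ln d - ln e)" by simp
    also have "\<dots> = (\<integral>\<^sup>+t. ennreal (inverse t) * indicator {e..d} t \<partial>lborel)"
      using e by (intro nn_integral_FTC_Icc[symmetric] DERIV_ln) auto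
    also have "\<dots> \<le> ?I"
      using e d by (intro nn_integral_mono) (auto simp: indicator_def powr_minus)
    finally show ?thesis .
  qed
  then have le: "ennreal B \<le> ?I" if "0 < B" for B using that by blast
  show ?thesis
  proof (cases ?I)
    case (real x)
    then have "ennreal (x + 1) \<le> ennreal x" using le[of "x + 1"] by simp
    then show ?thesis using real by simp
  qed simp
qed

section \<open>Strictness of the inclusions\<close>

lemma emeasure_circle: "emeasure circle_measure (space circle_measure) = ennreal (2 * pi)"
  unfolding space_circle by (simp add: circle_measure_def emeasure_restrict_space)

text \<open>On almost every ray the Borel representative agrees with the weight; one such ray
  supplies the profile \<open>w\<close>. The moment is finite because integrating it over all angles
  gives the total mass of the weight.\<close>

lemma weight_profile:
  assumes \<omega>: "weight \<omega>" "radial \<omega>"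
  obtains w where "w \<in> borel_measurable borel"
    "AE r in radius_measure. ennreal (\<omega> (of_real r)) = w r"
    "(\<integral>\<^sup>+r. w r * ennreal r \<partial>radius_measure) < \<infinity>"
proof -
  have F: "(\<lambda>z. ennreal (\<omega> z)) \<in> borel_measurable area_measure"
    using \<omega>(1) by (auto simp: weight_def)
  obtain H where H[measurable]: "H \<in> borel_measurable borel" and H0: "\<And>z. z \<notin> unit_disc \<Longrightarrow> H z = 0"
    and eq: "AE z in lborel. z \<in> unit_disc \<longrightarrow> ennreal (\<omega> z) = H z"
    using area_borel_representative[OF F] by blast
  have ae: "AE t in circle_measure. AE r in radius_measure. ennreal (\<omega> (of_real r)) = H (rcis r t)"
  proof (rule eventually_mono[OF AE_polar[OF eq]])
    fix t assume "AE r in radius_measure. rcis r t \<in> unit_disc \<longrightarrow> ennreal (\<omega> (rcis r t)) = H (rcis r t)"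
    then show "AE r in radius_measure. ennreal (\<omega> (of_real r)) = H (rcis r t)"
      using AE_space
    proof eventually_elim
      case (elim r)
      then have disc: "rcis r t \<in> unit_disc" and r: "0 < r" by (auto simp: unit_disc_def)
      have "\<omega> (rcis r t) = \<omega> (of_real (cmod (rcis r t)))"
        using \<omega>(2) disc unfolding radial_def by blast
      then show ?case using elim disc r by simp
    qed
  qed
  \<comment> \<open>The circle has positive measure, so what holds for almost every angle holds for
    some angle.\<close>
  have "ae_filter circle_measure \<noteq> bot"
    unfolding ae_filter_eq_bot_iff emeasure_circle by simp
  from eventually_happens'[OF this ae] obtain t
    where t: "AE r in radius_measure. ennreal (\<omega> (of_real r)) = H (rcis r t)" by blast
  let ?w = "\<lambda>r. H (rcis r t)"
  let ?m = "\<integral>\<^sup>+r. ?w r * ennreal r \<partial>radius_measure"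
  have "?m * ennreal (2 * pi) = (\<integral>\<^sup>+_. ?m \<partial>circle_measure)"
    by (simp only: nn_integral_const emeasure_circle)
  also have "\<dots> = (\<integral>\<^sup>+t. \<integral>\<^sup>+r. H (rcis r t) * ennreal r \<partial>radius_measure \<partial>circle_measure)"
  proof (rule nn_integral_cong_AE, rule eventually_mono[OF ae])
    fix t' assume "AE r in radius_measure. ennreal (\<omega> (of_real r)) = H (rcis r t')"
    with t have "AE r in radius_measure. H (rcis r t) * ennreal r = H (rcis r t') * ennreal r"
      by eventually_elim simp
    then show "?m = (\<integral>\<^sup>+r. H (rcis r t') * ennreal r \<partial>radius_measure)"
      by (rule nn_integral_cong_AE)
  qed
  also have "\<dots> = (\<integral>\<^sup>+z. H z \<partial>lborel)"
    by (rule nn_integral_polar_disc[symmetric]) (simp_all add: H0)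
  also have "\<dots> = (\<integral>\<^sup>+z. ennreal (\<omega> z) * indicator unit_disc z \<partial>lborel)"
  proof (rule nn_integral_cong_AE)
    show "AE z in lborel. H z = ennreal (\<omega> z) * indicator unit_disc z"
      using eq by eventually_elim (auto simp: indicator_def H0)
  qed
  finally have m: "ennreal (1 / pi) * (?m * ennreal (2 * pi)) = (\<integral>\<^sup>+z. ennreal (\<omega> z) \<partial>area_measure)"
    by (simp only: nn_integral_area[OF F])
  also have "\<dots> < \<infinity>"
  proof -
    have "(\<integral>\<^sup>+z. ennreal (\<omega> z) \<partial>area_measure) \<le> (\<integral>\<^sup>+z. ennreal (norm (\<omega> z)) \<partial>area_measure)"
      by (intro nn_integral_mono ennreal_leI) simp
    also have "\<dots> < \<infinity>"
      using \<omega>(1) by (simp add: weight_def integrable_iff_bounded)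
    finally show ?thesis .
  qed
  finally have "?m < \<infinity>"
    by (auto simp: ennreal_mult_less_top)
  moreover have "?w \<in> borel_measurable borel" by measurable
  ultimately show thesis using t that by blast
qed

text \<open>If no smaller concentric disc had mass, \<omega> would vanish almost everywhere along
  the radius and \<open>weight_hat \<omega> 0\<close> would be 0.\<close>

lemma weight_mass_in_disc:
  assumes w[measurable]: "w \<in> borel_measurable borel"
    and ae: "AE r in radius_measure. ennreal (\<omega> (of_real r)) = w r"
    and hat: "0 < weight_hat \<omega> 0"
  obtains \<rho> where "0 < \<rho>" "\<rho> < 1" "(\<integral>\<^sup>+r. w r * ennreal r * indicator {..<\<rho>} r \<partial>radius_measure) \<noteq> 0"
proof (rule ccontr)
  assume neg: "\<not> thesis"
  \<comment> \<open>The radii 1 - 1 / (n + 2) start at 1/2, hence are positive, and tend to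
    1.\<close>
  have *: "AE r in radius_measure. w r * ennreal r * indicator {..<1 - inverse (real (Suc (Suc n)))} r = 0" for n
  proof -
    have "inverse (real (Suc (Suc n))) < 1" "0 < inverse (real (Suc (Suc n)))"
      by (auto simp: field_simps)
    then have "(\<integral>\<^sup>+r. w r * ennreal r * indicator {..<1 - inverse (real (Suc (Suc n)))} r \<partial>radius_measure) = 0"
      using neg that[of "1 - inverse (real (Suc (Suc n)))"] by auto
    then show ?thesis
      by (subst (asm) nn_integral_0_iff_AE) (auto intro!: borel_measurable_radius)
  qed
  have "AE r in radius_measure. \<forall>n. w r * ennreal r * indicator {..<1 - inverse (real (Suc (Suc n)))} r = 0"
    unfolding AE_all_countable using * by blast
  then have "AE r in radius_measure. ennreal (\<omega> (of_real r)) = 0"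
    using ae AE_space
  proof eventually_elim
    case (elim r)
    then have r: "0 < r" "r < 1" by auto
    then obtain n where n: "inverse (real (Suc n)) < 1 - r"
      using reals_Archimedean[of "1 - r"] by auto
    have "inverse (real (Suc (Suc n))) \<le> inverse (real (Suc n))" by (simp add: field_simps)
    then have "r < 1 - inverse (real (Suc (Suc n)))" using n by linarith
    then have "w r * ennreal r = 0"
      using elim(1)[rule_format, of n] by (simp add: indicator_def split: if_splits)
    then show ?case using elim(2) r by simp
  qed
  then have "(\<integral>\<^sup>+r. ennreal (\<omega> (of_real r)) \<partial>radius_measure) = (\<integral>\<^sup>+r. 0 \<partial>radius_measure)"
    by (rule nn_integral_cong_AE)
  then have "weight_hat \<omega> 0 = 0"
    by (simp add: weight_hat_def nn_integral_completion nn_integral_radius)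
  then show False using hat by simp
qed

text \<open>Functions supported in the sector \<open>\<bar>z\<bar> < \<rho>, 0 < Arg z < 1 - \<rho>\<close>: at distance at least \<open>1 - \<rho>\<close> from
  the circle, the averaging over approach regions turns local into global integrability in \<open>Arg z\<close>.\<close>

definition sector_function :: "real \<Rightarrow> real \<Rightarrow> complex \<Rightarrow> complex" where
  "sector_function \<rho> a z =
    (if cmod z < \<rho> \<and> 0 < Arg z \<and> Arg z < 1 - \<rho> then of_real (Arg z powr a) else 0)"

lemma sector_function_measurable: "sector_function \<rho> a \<in> borel_measurable area_measure"
proof (rule borel_measurable_areaI)
  show "sector_function \<rho> a \<in> borel_measurable borel"
    unfolding sector_function_def[abs_def] by measurable
qed

text \<open>For t > \<pi> the argument is t - 2 \<pi> < 0 while t itself lies beyond 1 - \<rho>, so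
  both sides vanish; otherwise the argument is t.\<close>

lemma sector_function_rcis:
  assumes t: "0 \<le> t" "t < 2 * pi" and r: "0 < r" and \<rho>: "0 < \<rho>"
  shows "sector_function \<rho> a (rcis r t) = (if r < \<rho> \<and> t \<in> {0<..<1 - \<rho>} then of_real (t powr a) else 0)"
proof (cases "t \<le> pi")
  case True
  moreover have "- pi < t" using t pi_gt_zero by linarith
  ultimately have "Arg (rcis r t) = t" using r by (intro Arg_rcis) auto
  then show ?thesis using r by (auto simp: sector_function_def)
next
  case False
  have "rcis r (t - 2 * pi) = rcis r t" using rcis_periodic[of r "t - 2 * pi"] by simp
  moreover have "Arg (rcis r (t - 2 * pi)) = t - 2 * pi"
    using False t r by (intro Arg_rcis) auto
  ultimately have "Arg (rcis r t) = t - 2 * pi" by simp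
  moreover have "\<not> t < 1 - \<rho>" using False \<rho> pi_gt3 by linarith
  ultimately show ?thesis using t by (auto simp: sector_function_def)
qed

text \<open>The inner integral factors into the radial mass of the weight, finite and nonzero, and
  t^(a p); the outer power q / p turns the latter into t^(a q).\<close>

lemma L_norm_sector_function:
  assumes p: "0 < p" and q: "0 < q" and \<omega>: "weight \<omega>" "radial \<omega>" and w[measurable]: "w \<in> borel_measurable borel"
    and ae: "AE r in radius_measure. ennreal (\<omega> (of_real r)) = w r"
    and \<rho>: "0 < \<rho>" "\<rho> < 1"
    and fin: "(\<integral>\<^sup>+r. w r * ennreal r \<partial>radius_measure) < \<infinity>"
    and nz: "(\<integral>\<^sup>+r. w r * ennreal r * indicator {..<\<rho>} r \<partial>radius_measure) \<noteq> 0"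
  shows "L_norm q p \<omega> (sector_function \<rho> a) < \<infinity> \<longleftrightarrow>
    (\<integral>\<^sup>+t. ennreal (t powr (a * q)) * indicator {0<..<1 - \<rho>} t \<partial>lborel) < \<infinity>"
proof -
  let ?m = "\<integral>\<^sup>+r. w r * ennreal r * indicator {..<\<rho>} r \<partial>radius_measure"
  have "?m \<le> (\<integral>\<^sup>+r. w r * ennreal r \<partial>radius_measure)"
    by (intro nn_integral_mono) (auto simp: indicator_def)
  also have "\<dots> < \<infinity>" by (rule fin)
  finally have "?m < \<infinity>" .
  with nz obtain m where m: "?m = ennreal m" "0 < m" by (cases ?m) (auto simp: less_le)
  have inner: "(\<integral>\<^sup>+r\<in>{0<..<1}. ennreal (cmod (sector_function \<rho> a (rcis r t)) powr p * \<omega> (of_real r) * r) \<partial>lebesgue)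
     = ennreal (m * t powr (a * p)) * indicator {0<..<1 - \<rho>} t"
    if t: "t \<in> space circle_measure" for t
  proof -
    have "(\<integral>\<^sup>+r\<in>{0<..<1}. ennreal (cmod (sector_function \<rho> a (rcis r t)) powr p * \<omega> (of_real r) * r) \<partial>lebesgue)
      = (\<integral>\<^sup>+r. ennreal (cmod (sector_function \<rho> a (rcis r t)) powr p * \<omega> (of_real r) * r) \<partial>radius_measure)"
      by (simp add: nn_integral_completion nn_integral_radius)
    also have "\<dots> = (\<integral>\<^sup>+r. ennreal (t powr (a * p)) * indicator {0<..<1 - \<rho>} t * (w r * ennreal r * indicator {..<\<rho>} r) \<partial>radius_measure)"
    proof (rule nn_integral_cong_AE)
      show "AE r in radius_measure. ennreal (cmod (sector_function \<rho> a (rcis r t)) powr p * \<omega> (of_real r) * r)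
         = ennreal (t powr (a * p)) * indicator {0<..<1 - \<rho>} t * (w r * ennreal r * indicator {..<\<rho>} r)"
        using ae AE_space
      proof eventually_elim
        case (elim r)
        then have r: "0 < r" "r < 1" by auto
        have sf: "sector_function \<rho> a (rcis r t) = (if r < \<rho> \<and> t \<in> {0<..<1 - \<rho>} then of_real (t powr a) else 0)"
          using t r \<rho> by (intro sector_function_rcis) auto
        show ?case
        proof (cases "r < \<rho> \<and> t \<in> {0<..<1 - \<rho>}")
          case True
          then have "cmod (sector_function \<rho> a (rcis r t)) powr p = t powr (a * p)"
            by (simp add: sf powr_powr)
          moreover have "ennreal (t powr (a * p) * \<omega> (of_real r) * r) = ennreal (t powr (a * p)) * (w r * ennreal r)"
            using r elim(1) by (simp add: ennreal_mult' ennreal_mult'' mult.assoc)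
          ultimately show ?thesis using True by simp
        next
          case False
          then have "sector_function \<rho> a (rcis r t) = 0" by (simp only: sf if_False)
          then show ?thesis using p False by auto
        qed
      qed
    qed
    also have "\<dots> = ennreal (t powr (a * p)) * indicator {0<..<1 - \<rho>} t * ?m"
      by (rule nn_integral_cmult) (auto intro!: borel_measurable_radius)
    also have "\<dots> = ennreal (m * t powr (a * p)) * indicator {0<..<1 - \<rho>} t"
      using m by (simp add: ennreal_mult' mult_ac)
    finally show ?thesis .
  qed
  have "(\<integral>\<^sup>+t\<in>{0..2 * pi}. enn_powr (\<integral>\<^sup>+r\<in>{0<..<1}. ennreal (cmod (sector_function \<rho> a (rcis r t)) powr p * \<omega> (of_real r) * r) \<partial>lebesgue) (q / p) \<partial>lebesgue)
     = (\<integral>\<^sup>+t. enn_powr (ennreal (m * t powr (a * p)) * indicator {0<..<1 - \<rho>} t) (q / p) \<partial>circle_measure)"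
    unfolding nn_integral_closed_circle by (intro nn_integral_cong) (simp only: inner)
  also have "\<dots> = (\<integral>\<^sup>+t. ennreal (m powr (q / p)) * (ennreal (t powr (a * q)) * indicator {0<..<1 - \<rho>} t) \<partial>lborel)"
    unfolding nn_integral_circle
  proof (intro nn_integral_cong)
    fix t :: real
    show "enn_powr (ennreal (m * t powr (a * p)) * indicator {0<..<1 - \<rho>} t) (q / p) * indicator {0..<2 * pi} t
       = ennreal (m powr (q / p)) * (ennreal (t powr (a * q)) * indicator {0<..<1 - \<rho>} t)"
    proof (cases "t \<in> {0<..<1 - \<rho>}")
      case True
      then have "t < 2 * pi" using \<rho> pi_gt3 by auto
      moreover have "(m * t powr (a * p)) powr (q / p) = m powr (q / p) * t powr (a * q)"
        using p m by (simp add: powr_mult powr_powr)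
      ultimately have "enn_powr (ennreal (m * t powr (a * p))) (q / p) = ennreal (m powr (q / p)) * ennreal (t powr (a * q))"
        using m by (subst enn_powr_ennreal) (simp_all add: ennreal_mult')
      with \<open>t < 2 * pi\<close> show ?thesis using True by simp
    qed simp
  qed
  also have "\<dots> = ennreal (m powr (q / p)) * (\<integral>\<^sup>+t. ennreal (t powr (a * q)) * indicator {0<..<1 - \<rho>} t \<partial>lborel)"
    by (rule nn_integral_cmult) measurable
  finally show ?thesis
    using m unfolding L_norm_def enn_powr_less_top_iff
    by (auto simp add: ennreal_mult_less_top)
qed

text \<open>On the support 1 - |z| > 1 - \<rho>, so the area integral, up to this factor, bounds all
  tent integrals by one constant.\<close>

lemma T_norm_sector_function_finite:
  assumes p: "0 < p" and q: "0 < q" and \<omega>: "weight \<omega>" and \<rho>: "0 < \<rho>" "\<rho> < 1"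
    and fin: "(\<integral>\<^sup>+z. ennreal (cmod (sector_function \<rho> a z) powr p * \<omega> z) \<partial>area_measure) < \<infinity>"
  shows "T_norm q p \<omega> (sector_function \<rho> a) < \<infinity>"
proof -
  let ?f = "sector_function \<rho> a"
  let ?I = "\<integral>\<^sup>+z. ennreal (cmod (?f z) powr p * \<omega> z) \<partial>area_measure"
  define c where "c = ennreal (1 / (1 - \<rho>)) * ?I"
  have c: "c < \<infinity>" using fin by (simp add: c_def ennreal_mult_less_top)
  have "(\<integral>\<^sup>+z\<in>approach_region (cis t). ennreal (cmod (?f z) powr p * \<omega> z / (1 - cmod z)) \<partial>area_measure) \<le> c" for t
  proof -
    have "(\<integral>\<^sup>+z\<in>approach_region (cis t). ennreal (cmod (?f z) powr p * \<omega> z / (1 - cmod z)) \<partial>area_measure)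
       \<le> (\<integral>\<^sup>+z. ennreal (1 / (1 - \<rho>)) * ennreal (cmod (?f z) powr p * \<omega> z) \<partial>area_measure)"
    proof (intro nn_integral_mono)
      fix z assume "z \<in> space area_measure"
      then have z: "0 \<le> \<omega> z" "cmod z < 1" using \<omega> by (auto simp: weight_def unit_disc_def)
      show "ennreal (cmod (?f z) powr p * \<omega> z / (1 - cmod z)) * indicator (approach_region (cis t)) z
         \<le> ennreal (1 / (1 - \<rho>)) * ennreal (cmod (?f z) powr p * \<omega> z)"
      proof (cases "cmod z < \<rho>")
        case True
        have "cmod (?f z) powr p * \<omega> z / (1 - cmod z) \<le> cmod (?f z) powr p * \<omega> z / (1 - \<rho>)"
          using True z \<rho> by (intro divide_left_mono mult_nonneg_nonneg mult_pos_pos) auto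
        then have "ennreal (cmod (?f z) powr p * \<omega> z / (1 - cmod z)) \<le> ennreal (1 / (1 - \<rho>) * (cmod (?f z) powr p * \<omega> z))"
          by (intro ennreal_leI) simp
        also have "\<dots> = ennreal (1 / (1 - \<rho>)) * ennreal (cmod (?f z) powr p * \<omega> z)"
          using \<rho> by (intro ennreal_mult') simp
        finally show ?thesis by (auto simp: indicator_def)
      next
        case False
        then have "?f z = 0" by (simp add: sector_function_def)
        then show ?thesis using p by simp
      qed
    qed
    also have "\<dots> = c"
      unfolding c_def by (intro nn_integral_cmult weight_density_measurable \<omega> sector_function_measurable)
    finally show ?thesis .
  qed
  then have "(\<integral>\<^sup>+t\<in>{0..2 * pi}. enn_powr (\<integral>\<^sup>+z\<in>approach_region (cis t). ennreal (cmod (?f z) powr p * \<omega> z / (1 - cmod z)) \<partial>area_measure) (q / p) \<partial>lebesgue)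
     \<le> (\<integral>\<^sup>+t. enn_powr c (q / p) \<partial>circle_measure)"
    unfolding nn_integral_closed_circle using p q by (intro nn_integral_mono enn_powr_mono) auto
  also have "\<dots> = enn_powr c (q / p) * ennreal (2 * pi)"
    by (simp only: nn_integral_const emeasure_circle)
  also have "\<dots> < \<infinity>"
  proof -
    have "enn_powr c (q / p) < \<infinity>" using c by (simp only: enn_powr_less_top_iff)
    then show ?thesis by (auto simp: ennreal_mult_less_top)
  qed
  finally show ?thesis
    unfolding T_norm_def enn_powr_less_top_iff .
qed

text \<open>For t in \<open>{0<..<1 - \<rho>}\<close> the approach region contains the whole
  support, since |Arg z - t| < 1 - \<rho> < 1 - |z|; the tent integral there is at least the
  infinite area integral.\<close>

lemma T_norm_sector_function_infinite:
  assumes \<omega>: "weight \<omega>" and \<rho>: "0 < \<rho>" "\<rho> < 1" and p: "0 < p"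
    and inf: "(\<integral>\<^sup>+z. ennreal (cmod (sector_function \<rho> a z) powr p * \<omega> z) \<partial>area_measure) = \<infinity>"
  shows "T_norm q p \<omega> (sector_function \<rho> a) = \<infinity>"
proof -
  let ?f = "sector_function \<rho> a"
  have *: "(\<integral>\<^sup>+z\<in>approach_region (cis t). ennreal (cmod (?f z) powr p * \<omega> z / (1 - cmod z)) \<partial>area_measure) = \<infinity>"
    if t: "t \<in> {0<..<1 - \<rho>}" for t
  proof -
    have Arg: "Arg (cis t) = t" using t \<rho> pi_gt3 by (intro Arg_cis) auto
    have "(\<integral>\<^sup>+z. ennreal (cmod (?f z) powr p * \<omega> z) \<partial>area_measure)
      \<le> (\<integral>\<^sup>+z\<in>approach_region (cis t). ennreal (cmod (?f z) powr p * \<omega> z / (1 - cmod z)) \<partial>area_measure)"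
    proof (intro nn_integral_mono)
      fix z assume "z \<in> space area_measure"
      then have z: "0 \<le> \<omega> z" "cmod z < 1" "z \<in> unit_disc" using \<omega> by (auto simp: weight_def unit_disc_def)
      show "ennreal (cmod (?f z) powr p * \<omega> z)
         \<le> ennreal (cmod (?f z) powr p * \<omega> z / (1 - cmod z)) * indicator (approach_region (cis t)) z"
      proof (cases "?f z = 0")
        case True
        then show ?thesis using p by simp
      next
        case False
        then have s: "cmod z < \<rho>" "0 < Arg z" "Arg z < 1 - \<rho>"
          by (auto simp: sector_function_def split: if_splits)
        have "\<bar>Arg z - Arg (cis t) + 2 * pi * of_int 0\<bar> < cmod (cis t) - cmod z"
          using s t by (simp add: Arg abs_less_iff)
        then have "z \<in> approach_region (cis t)"
          using z(3) unfolding approach_region_def by blast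
        moreover have "cmod (?f z) powr p * \<omega> z \<le> cmod (?f z) powr p * \<omega> z / (1 - cmod z)"
          using z mult_left_mono[of "1 - cmod z" 1 "cmod (?f z) powr p * \<omega> z"]
          by (simp add: pos_le_divide_eq)
        ultimately show ?thesis by (simp add: ennreal_leI)
      qed
    qed
    then show ?thesis using inf by (simp add: top_unique)
  qed
  have "\<infinity> = (\<integral>\<^sup>+t. \<infinity> * indicator {0<..<1 - \<rho>} t \<partial>lborel)"
    using \<rho> by (subst nn_integral_cmult_indicator) (auto simp: ennreal_top_mult)
  also have "\<dots> \<le> (\<integral>\<^sup>+t\<in>{0..2 * pi}. enn_powr (\<integral>\<^sup>+z\<in>approach_region (cis t). ennreal (cmod (?f z) powr p * \<omega> z / (1 - cmod z)) \<partial>area_measure) (q / p) \<partial>lebesgue)"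
    unfolding nn_integral_completion
  proof (intro nn_integral_mono)
    fix t :: real
    show "\<infinity> * indicator {0<..<1 - \<rho>} t \<le> enn_powr (\<integral>\<^sup>+z\<in>approach_region (cis t). ennreal (cmod (?f z) powr p * \<omega> z / (1 - cmod z)) \<partial>area_measure) (q / p) * indicator {0..2 * pi} t"
    proof (cases "t \<in> {0<..<1 - \<rho>}")
      case True
      then have "t \<in> {0..2 * pi}" using \<rho> pi_gt3 by auto
      then show ?thesis unfolding *[OF True] by simp
    qed simp
  qed
  finally show ?thesis
    unfolding T_norm_def by (simp add: top_unique)
qed

text \<open>The powers are chosen at the border of integrability: for p < q, a = -1 / q gives a q =
  -1, divergent, and a p > -1, convergent; for q < p, a = -1 / p exchanges the roles.\<close>

lemma L_space_neq_T_space: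
  assumes p: "0 < p" and q: "0 < q" "p \<noteq> q" and \<omega>: "weight \<omega>" "radial \<omega>" and hat: "0 < weight_hat \<omega> 0"
  shows "p < q \<Longrightarrow> \<exists>f. f \<in> T_space q p \<omega> \<and> f \<notin> L_space q p \<omega>"
    and "q < p \<Longrightarrow> \<exists>f. f \<in> L_space q p \<omega> \<and> f \<notin> T_space q p \<omega>"
proof -
  obtain w where w: "w \<in> borel_measurable borel"
    "AE r in radius_measure. ennreal (\<omega> (of_real r)) = w r"
    "(\<integral>\<^sup>+r. w r * ennreal r \<partial>radius_measure) < \<infinity>"
    by (rule weight_profile[OF \<omega>])
  obtain \<rho> where \<rho>: "0 < \<rho>" "\<rho> < 1" "(\<integral>\<^sup>+r. w r * ennreal r * indicator {..<\<rho>} r \<partial>radius_measure) \<noteq> 0"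
    by (rule weight_mass_in_disc[OF w(1,2) hat])
  let ?f = "sector_function \<rho>"
  let ?J = "\<lambda>b. \<integral>\<^sup>+t. ennreal (t powr b) * indicator {0<..<1 - \<rho>} t \<partial>lborel"
  note meas = sector_function_measurable[of \<rho>]
  have L: "L_norm q' p \<omega> (?f a) < \<infinity> \<longleftrightarrow> ?J (a * q') < \<infinity>" if "0 < q'" for a q'
    using L_norm_sector_function[OF p that \<omega> w(1,2) \<rho>(1,2) w(3) \<rho>(3)] .
  \<comment> \<open>The area integral is the case of equal exponents, transferred through the
    equality of the spaces.\<close>
  have A: "(\<integral>\<^sup>+z. ennreal (cmod (?f a z) powr p * \<omega> z) \<partial>area_measure) < \<infinity> \<longleftrightarrow> ?J (a * p) < \<infinity>" for a
  proof -
    have "?f a \<in> L_space p p \<omega> \<longleftrightarrow> ?f a \<in> Lebesgue_space p \<omega>"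
      using spaces_eq_exponents[OF p \<omega>] by simp
    then show ?thesis
      using L[OF p] meas by (simp add: L_space_def Lebesgue_space_def)
  qed
  have inf: "?J (- 1) = \<infinity>" using \<rho> by (intro nn_integral_inverse_near_0) simp
  have fin: "?J (- b) < \<infinity>" if "b < 1" for b
    using \<rho> that by (intro nn_integral_powr_near_0_finite) auto
  show "\<exists>f. f \<in> T_space q p \<omega> \<and> f \<notin> L_space q p \<omega>" if "p < q"
  proof (intro exI conjI)
    have "?J (- 1 / q * p) < \<infinity>" using fin[of "p / q"] q that by simp
    then have "(\<integral>\<^sup>+z. ennreal (cmod (?f (- 1 / q) z) powr p * \<omega> z) \<partial>area_measure) < \<infinity>"
      by (simp only: A)
    from T_norm_sector_function_finite[OF p q(1) \<omega>(1) \<rho>(1,2) this]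
    show "?f (- 1 / q) \<in> T_space q p \<omega>" using meas by (simp add: T_space_def)
    have "\<not> ?J (- 1 / q * q) < \<infinity>" using inf q by simp
    then show "?f (- 1 / q) \<notin> L_space q p \<omega>" using L[OF q(1)] by (simp only: L_space_def mem_Collect_eq simp_thms)
  qed
  show "\<exists>f. f \<in> L_space q p \<omega> \<and> f \<notin> T_space q p \<omega>" if "q < p"
  proof (intro exI conjI)
    have "?J (- 1 / p * q) < \<infinity>" using fin[of "q / p"] p that by simp
    then show "?f (- 1 / p) \<in> L_space q p \<omega>" using L[OF q(1)] meas by (simp only: L_space_def mem_Collect_eq simp_thms)
    have "\<not> ?J (- 1 / p * p) < \<infinity>" using inf p by simp
    then have "(\<integral>\<^sup>+z. ennreal (cmod (?f (- 1 / p) z) powr p * \<omega> z) \<partial>area_measure) = \<infinity>"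
      unfolding A[symmetric] by (simp add: not_less top_unique)
    from T_norm_sector_function_infinite[OF \<omega>(1) \<rho>(1,2) p this]
    show "?f (- 1 / p) \<notin> T_space q p \<omega>" by (simp add: T_space_def)
  qed
qed

theorem proposition1p5:
  fixes p q :: real and \<omega> :: "complex \<Rightarrow> real"
  assumes "0 < p" and "0 < q"
    and "weight \<omega>" and "radial \<omega>"
    and "\<forall>z\<in>unit_disc. 0 < weight_hat \<omega> z"
  shows "(p < q \<longrightarrow>
            L_space q p \<omega> \<subset> T_space q p \<omega> \<and>
            norm_dominated (T_norm q p \<omega>) (L_norm q p \<omega>)) \<and>
         (L_space p p \<omega> = Lebesgue_space p \<omega> \<and>
            Lebesgue_space p \<omega> = T_space p p \<omega> \<and>
            norm_equivalent (L_norm p p \<omega>) (Lebesgue_norm p \<omega>) \<and>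
            norm_equivalent (Lebesgue_norm p \<omega>) (T_norm p p \<omega>)) \<and>
         (q < p \<longrightarrow>
            T_space q p \<omega> \<subset> L_space q p \<omega> \<and>
            norm_dominated (L_norm q p \<omega>) (T_norm q p \<omega>))"
proof (intro conjI impI)
  have hat: "0 < weight_hat \<omega> 0" using assms(5) by (simp add: unit_disc_def)
  note \<omega> = assms(3,4)
  show "norm_dominated (T_norm q p \<omega>) (L_norm q p \<omega>)" if "p < q"
    by (rule T_norm_dominated_L_norm[OF assms(1) that \<omega>])
  then have "L_space q p \<omega> \<subseteq> T_space q p \<omega>" if "p < q"
    using that norm_dominated_finite unfolding L_space_def T_space_def by blast
  then show "L_space q p \<omega> \<subset> T_space q p \<omega>" if "p < q"
    using that L_space_neq_T_space(1)[OF assms(1,2) _ \<omega> hat] by blast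
  show "norm_dominated (L_norm q p \<omega>) (T_norm q p \<omega>)" if "q < p"
    by (rule L_norm_dominated_T_norm[OF assms(2) that \<omega>])
  then have "T_space q p \<omega> \<subseteq> L_space q p \<omega>" if "q < p"
    using that norm_dominated_finite unfolding L_space_def T_space_def by blast
  then show "T_space q p \<omega> \<subset> L_space q p \<omega>" if "q < p"
    using that L_space_neq_T_space(2)[OF assms(1,2) _ \<omega> hat] by blast
  show "L_space p p \<omega> = Lebesgue_space p \<omega>" "Lebesgue_space p \<omega> = T_space p p \<omega>"
    by (rule spaces_eq_exponents[OF assms(1) \<omega>])+
  show "norm_equivalent (L_norm p p \<omega>) (Lebesgue_norm p \<omega>)"
    by (rule norm_equivalent_L_Lebesgue[OF assms(1) \<omega>])
  show "norm_equivalent (Lebesgue_norm p \<omega>) (T_norm p p \<omega>)"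
    by (rule norm_equivalent_Lebesgue_T[OF assms(1) \<omega>])
qed

end
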